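(* Consider $k$-class classification with linear predictors trained by gradient descent on the one-hot squared loss, with limiting solution $\widehat w_j=(\mathbf X^T\mathbf X+\lambda\mathbf I)^{-1}\mathbf X^T\mathbf y_j$ for $j=1,\dots,k$, and $\widehat f(x)=(\widehat w_1^Tx,\dots,\widehat w_k^Tx)$. Assume the training algorithm satisfies the hypothesis stability condition with constant $\beta=O(1)$. Then for any $\delta>0$, with probability at least $1-\delta$, $$\mathcal E_{\mathcal D}(\widehat f)\le\mathcal E_S(\widehat f)+(k-1)\Big(1-\frac{k}{k-1}\mathcal E_{\widetilde S}(\widehat f)\Big)+\Big(k+\sqrt k+\frac{m}{n\sqrt k}\Big)\sqrt{\frac{\log(4/\delta)}{2m}}+\sqrt{k(k-1)}\sqrt{\frac4\delta\Big(\frac1m+\frac{3\beta}{m+n}\Big)}.$$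
   Context: Setup: $\mathcal X=\mathbb R^d$, $\mathcal Y=\{1,\dots,k\}$, $\mathcal D$ a distribution on $\mathcal X\times\mathcal Y$. Clean data $S=\{(x_i,c_i)\}_{i=1}^n\sim\mathcal D^n$; randomly labeled data $\widetilde S=\{(x_i,c_i)\}_{i=n+1}^{n+m}$ drawn independently: for each point draw $(x,c^T)\sim\mathcal D$ and assign a label $c$ uniform on $\mathcal Y$ independently; $m<n$. $\mathbf X\in\mathbb R^{(n+m)\times d}$ has rows $x_i^T$; labels are one-hot encoded, $e_{c_i}\in\mathbb R^k$, and $\mathbf y_j\in\{0,1\}^{n+m}$ is the vector of $j$-th coordinates. The objective is $\mathcal L(w;\lambda)=\sum_i\|w^Tx_i-e_{c_i}\|_2^2+\lambda\sum_{j=1}^k\|w_j\|_2^2$ ($w=[w_1,\dots,w_k]$, $\lambda\ge0$), minimized by gradient descent from $0$ with step size $\eta\le1/(\|\mathbf X^T\mathbf X\|_{\mathrm{op}}+\lambda^2)$. The 0-1 error at $(x,c)$ is $\mathcal E(\widehat f(x),c)=\mathbb 1\{c\notin\arg\max_j\widehat w_j^Tx\}$; $\mathcal E_{\mathcal Q}$ is expected error under distribution $\mathcal Q$, $\mathcal E_T$ average error over a finite dataset $T$. Hypothesis stability with constant $\beta$: for training set $T$ of size $N$, $f=f(\mathcal A,T)$, $f_{(i)}=f(\mathcal A,T_{(i)})$ with $T_{(i)}$ being $T$ with its $i$-th point removed, for all $i$, $\mathbb E_{T,(x,y)\sim\mathcal D}[|\mathcal E(f(x),y)-\mathcal E(f_{(i)}(x),y)|]\le\beta/N$.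 *)

theory Defs
  imports "HOL-Probability.Probability"
begin

text \<open>Data points are pairs (x, c) with x :: real^'d and label c :: nat in {1..k}.
  A training set is a function T :: nat \<Rightarrow> (real^'d) \<times> nat together with a finite
  index set I of the points it contains; removing the i-th point is I - {i}.\<close>

definition outer_vec :: "real^'d \<Rightarrow> real^'d^'d" where
  "outer_vec x = (\<chi> a b. x $ a * x $ b)"

definition gram :: "(nat \<Rightarrow> (real^'d) \<times> nat) \<Rightarrow> nat set \<Rightarrow> real^'d^'d" where
  "gram T I = (\<Sum>i\<in>I. outer_vec (fst (T i)))"

definition Xty :: "(nat \<Rightarrow> (real^'d) \<times> nat) \<Rightarrow> nat set \<Rightarrow> nat \<Rightarrow> real^'d" where
  "Xty T I j = (\<Sum>i\<in>I. (if snd (T i) = j then 1 else 0) *\<^sub>R fst (T i))"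

text \<open>Limiting (ridge) solution w_j = (X^T X + lam I)^{-1} X^T y_j.  For lam > 0 this is the
  literal formula; for lam = 0 (where X^T X may be singular) the inverse is read as the
  limit lam' -> 0+, i.e. the Moore-Penrose pseudo-inverse solution (the gradient descent
  limit from 0), which coincides with the literal formula whenever X^T X is invertible.\<close>
definition ridge_w :: "real \<Rightarrow> (nat \<Rightarrow> (real^'d) \<times> nat) \<Rightarrow> nat set \<Rightarrow> nat \<Rightarrow> real^'d" where
  "ridge_w lam T I j =
     (if lam > 0 then matrix_inv (gram T I + lam *\<^sub>R mat 1) *v Xty T I j
      else Lim (at_right 0) (\<lambda>mu. matrix_inv (gram T I + mu *\<^sub>R mat 1) *v Xty T I j))"

definition argmax_cls :: "nat \<Rightarrow> (nat \<Rightarrow> real^'d) \<Rightarrow> real^'d \<Rightarrow> nat set" where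
  "argmax_cls k w x = {j \<in> {1..k}. \<forall>l\<in>{1..k}. w l \<bullet> x \<le> w j \<bullet> x}"

definition err01 :: "nat \<Rightarrow> (nat \<Rightarrow> real^'d) \<Rightarrow> (real^'d) \<times> nat \<Rightarrow> real" where
  "err01 k w z = (if snd z \<notin> argmax_cls k w (fst z) then 1 else 0)"

definition rand_label_dist :: "nat \<Rightarrow> ((real^'d) \<times> nat) measure \<Rightarrow> ((real^'d) \<times> nat) measure" where
  "rand_label_dist k D = distr D borel fst \<Otimes>\<^sub>M uniform_count_measure {1..k}"

definition sample_dist :: "nat \<Rightarrow> nat \<Rightarrow> nat \<Rightarrow> ((real^'d) \<times> nat) measure \<Rightarrow> (nat \<Rightarrow> (real^'d) \<times> nat) measure" where
  "sample_dist k n m D = (\<Pi>\<^sub>M i\<in>{..<n+m}. if i < n then D else rand_label_dist k D)"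

definition hyp_stable :: "nat \<Rightarrow> nat \<Rightarrow> nat \<Rightarrow> real \<Rightarrow> ((real^'d) \<times> nat) measure \<Rightarrow> real \<Rightarrow> bool" where
  "hyp_stable k n m lam D beta \<longleftrightarrow>
     (\<forall>i<n+m. (\<integral>T. (\<integral>z. \<bar>err01 k (ridge_w lam T {..<n+m}) z - err01 k (ridge_w lam T ({..<n+m} - {i})) z\<bar> \<partial>D)
                   \<partial>sample_dist k n m D) \<le> beta / real (n+m))"

end

theory Submission
  imports Defs
begin

text \<open>
  The excess of the claimed bound is \<open>R + acc_S - (k/m) \<Sum>i. a\<^sub>i\<close>, where \<open>R\<close> is the risk and \<open>a\<^sub>i\<close> says
  whether the random label of site \<open>i\<close> is fitted. The sites whose random label is the true one are
  exchangeable with the clean sample, which controls their share in the second moment. For the other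
  sites, stability in the form of leave-one-out errors gives in the second moment that the true label is
  missed at a rate of at least about \<open>R\<close>. It remains to see that wrong random labels are fitted at least
  about \<open>1/(k - 1)\<close> times as often as the true labels at their sites are missed. This holds for every
  fixed choice of points and true labels, with high probability over the random labels alone: fitted
  values are the gradient of a convex energy of the labels, so a labelling is determined by its fitted
  sites among all labellings of no larger energy, and a dimension count bounds the number of labellings
  with few fitted sites.
\<close>

section \<open>Weighted counting of label patterns\<close>

text \<open>Stability bounds only an expectation, so it enters through Chebyshev. It says nothing
  about how the predictor treats the very labels it was trained on; there, convexity of the energy
  replaces it. For k = 2 nothing is to be shown: a missed true label is a fitted wrong one. For k
  \<ge> 3 labels are flipped between two classes \<open>a\<close> and \<open>b\<close> only. A third
  class may win at a site, and then the flip decides nothing; auxiliary coins give such sites weight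
  1. The bounds for different pairs of classes are dependent and are combined by convexity of exp.
  The comparison tolerates an error t = 2k\<tau> with \<tau> = sqrt (ln (4/\<delta>) / (2m)). This
  exceeds the (k + sqrt k)\<tau> of the claim; the overshoot is paid by the last summand 2 sqrt
  (k(k-1)) X, because \<tau> \<le> 5/6 X. The failure probability splits into \<delta>/4 for the
  labels and 3\<delta>/4 for Chebyshev.\<close>

lemma underdetermined_system:
  fixes a :: "'z \<Rightarrow> 'c \<Rightarrow> real"
  assumes "finite Zs" "finite F" "card Zs < card F"
  shows "\<exists>\<phi>. (\<exists>c\<in>F. \<phi> c \<noteq> 0) \<and> (\<forall>Z\<in>Zs. (\<Sum>c\<in>F. \<phi> c * a Z c) = 0)"
  using assms
proof (induction Zs arbitrary: F a rule: finite_induct)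
  case empty
  then have "F \<noteq> {}" by auto
  then show ?case by (intro exI[of _ "\<lambda>_. 1"]) auto
next
  case (insert Z0 Zs)
  show ?case
  proof (cases "\<exists>c0\<in>F. a Z0 c0 \<noteq> 0")
    case False
    have "card Zs < card F" using insert by simp
    then obtain \<phi> where "\<exists>c\<in>F. \<phi> c \<noteq> 0" "\<forall>Z\<in>Zs. (\<Sum>c\<in>F. \<phi> c * a Z c) = 0"
      using insert.IH[of F a] insert.prems by blast
    then show ?thesis using False by (intro exI[of _ \<phi>]) auto
  next
    case True
    then obtain c0 where c0: "c0 \<in> F" "a Z0 c0 \<noteq> 0" by blast
    let ?F = "F - {c0}"
    \<comment> \<open>Gaussian elimination: this multiple of the equation \<open>Z0\<close> cancels
      the unknown \<open>c0\<close>, whose value that equation determines afterwards.\<close>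
    let ?a = "\<lambda>Z c. a Z c - a Z c0 * a Z0 c / a Z0 c0"
    have "card Zs < card ?F" using insert c0 by simp
    then obtain \<phi> where \<phi>: "\<exists>c\<in>?F. \<phi> c \<noteq> 0" "\<forall>Z\<in>Zs. (\<Sum>c\<in>?F. \<phi> c * ?a Z c) = 0"
      using insert.IH[of ?F ?a] insert.prems by auto
    define s where "s = (\<Sum>c\<in>?F. \<phi> c * a Z0 c)"
    define \<psi> where "\<psi> = \<phi>(c0 := - s / a Z0 c0)"
    have split: "(\<Sum>c\<in>F. \<psi> c * a Z c) = (\<Sum>c\<in>?F. \<phi> c * a Z c) - s / a Z0 c0 * a Z c0" for Z
    proof -
      have "(\<Sum>c\<in>F. \<psi> c * a Z c) = \<psi> c0 * a Z c0 + (\<Sum>c\<in>?F. \<psi> c * a Z c)"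
        using c0 insert.prems by (simp add: sum.remove)
      also have "(\<Sum>c\<in>?F. \<psi> c * a Z c) = (\<Sum>c\<in>?F. \<phi> c * a Z c)"
        by (intro sum.cong) (auto simp: \<psi>_def)
      finally show ?thesis by (simp add: \<psi>_def)
    qed
    have "(\<Sum>c\<in>F. \<psi> c * a Z c) = 0" if "Z \<in> insert Z0 Zs" for Z
    proof (cases "Z = Z0")
      case True
      then show ?thesis using c0 by (simp add: split s_def)
    next
      case False
      then have "0 = (\<Sum>c\<in>?F. \<phi> c * ?a Z c)" using \<phi> that by auto
      also have "\<dots> = (\<Sum>c\<in>?F. \<phi> c * a Z c) - (\<Sum>c\<in>?F. \<phi> c * a Z0 c * (a Z c0 / a Z0 c0))"
        by (simp add: sum_subtractf[symmetric] algebra_simps)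
      also have "(\<Sum>c\<in>?F. \<phi> c * a Z0 c * (a Z c0 / a Z0 c0)) = s * (a Z c0 / a Z0 c0)"
        unfolding s_def sum_distrib_right ..
      finally show ?thesis by (simp add: split)
    qed
    moreover have "\<exists>c\<in>F. \<psi> c \<noteq> 0" using \<phi>(1) by (auto simp: \<psi>_def)
    ultimately show ?thesis by blast
  qed
qed

text \<open>Inclusion-exclusion: it turns a condition on absent elements into a combination of
  monomials \<open>U \<subseteq> y\<close> of degree at most \<open>card B\<close>.\<close>

lemma sum_Pow_alternating:
  fixes B y :: "'a set"
  assumes "finite B"
  shows "(\<Sum>U\<in>Pow B. (- 1) ^ card U * of_bool (U \<subseteq> y)) = (of_bool (B \<inter> y = {}) :: real)"
  using assms
proof (induction B rule: finite_induct)
  case (insert b B)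
  have "(\<Sum>U\<in>Pow (insert b B). (- 1) ^ card U * of_bool (U \<subseteq> y) :: real)
     = (\<Sum>U\<in>Pow B. (- 1) ^ card U * of_bool (U \<subseteq> y))
       + (\<Sum>U\<in>insert b ` Pow B. (- 1) ^ card U * of_bool (U \<subseteq> y))"
    unfolding Pow_insert using insert by (subst sum.union_disjoint) auto
  also have "(\<Sum>U\<in>insert b ` Pow B. (- 1) ^ card U * of_bool (U \<subseteq> y) :: real)
     = (\<Sum>U\<in>Pow B. (- 1) ^ card (insert b U) * of_bool (insert b U \<subseteq> y))"
    by (subst sum.reindex) (use insert in \<open>auto simp: inj_on_def\<close>)
  also have "\<dots> = (\<Sum>U\<in>Pow B. - of_bool (b \<in> y) * ((- 1) ^ card U * of_bool (U \<subseteq> y)))"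
    using insert
    by (intro sum.cong refl) (subst card_insert_disjoint; auto simp: finite_subset of_bool_def)
  also have "\<dots> = - of_bool (b \<in> y) * of_bool (B \<inter> y = {})"
    unfolding sum_distrib_left[symmetric] insert.IH ..
  finally show ?case using insert by (simp add: of_bool_def)
qed auto

text \<open>The indicators of the subcubes \<open>{z. z \<inter> S y = y \<inter> S y}\<close> with \<open>card (S y) \<le> d\<close> are
  polynomials of degree at most \<open>d\<close>, and they are triangular with respect to \<open>E\<close>, hence linearly
  independent.\<close>
lemma card_teaching_sets_le:
  fixes S :: "'a set \<Rightarrow> 'a set" and E :: "'a set \<Rightarrow> real"
  assumes I: "finite I" and S: "\<And>y. y \<subseteq> I \<Longrightarrow> S y \<subseteq> I"
    and tri: "\<And>y y'. y \<subseteq> I \<Longrightarrow> y' \<subseteq> I \<Longrightarrow> y' \<noteq> y \<Longrightarrow> y' \<inter> S y = y \<inter> S y \<Longrightarrow> E y < E y'"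
  shows "card {y \<in> Pow I. card (S y) \<le> d} \<le> card {Z \<in> Pow I. card Z \<le> d}"
proof (rule ccontr)
  let ?F = "{y \<in> Pow I. card (S y) \<le> d}" and ?Z = "{Z \<in> Pow I. card Z \<le> d}"
  assume "\<not> ?thesis"
  \<comment> \<open>If \<open>?F\<close> outnumbered the monomials \<open>Z \<subseteq> y\<close> of
    degree at most \<open>d\<close>, some nonzero \<phi> on \<open>?F\<close> would annihilate them
    all.\<close>
  then obtain \<phi> where \<phi>: "\<exists>c\<in>?F. \<phi> c \<noteq> 0" "\<And>Z. Z \<in> ?Z \<Longrightarrow> (\<Sum>y\<in>?F. \<phi> y * of_bool (Z \<subseteq> y)) = (0::real)"
    using underdetermined_system[of ?Z ?F "\<lambda>Z y. of_bool (Z \<subseteq> y)"] I by auto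
  let ?P = "{y \<in> ?F. \<phi> y \<noteq> 0}"
  have P: "finite ?P" "?P \<noteq> {}" using I \<phi>(1) by auto
  have "Max (E ` ?P) \<in> E ` ?P" using P by (intro Max_in) auto
  \<comment> \<open>By \<open>tri\<close>, any other pattern in the subcube fixed by
    \<open>S y0\<close> has larger energy. At the top energy of the support, \<open>y0\<close> is
    therefore alone in its subcube.\<close>
  then obtain y0 where y0: "y0 \<in> ?P" and y0_max: "E y0 = Max (E ` ?P)" by auto
  have max: "E y \<le> E y0" if "y \<in> ?P" for y
    unfolding y0_max using P(1) that by (intro Max_ge) auto
  let ?A = "S y0 \<inter> y0" and ?B = "S y0 - y0"
  have fS: "finite (S y0)" using S y0 I by (auto intro: finite_subset)
  have ind: "of_bool (y \<inter> S y0 = y0 \<inter> S y0) = (\<Sum>U\<in>Pow ?B. (- 1) ^ card U * (of_bool (?A \<union> U \<subseteq> y) :: real))" for y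
  proof -
    have "(\<Sum>U\<in>Pow ?B. (- 1) ^ card U * (of_bool (?A \<union> U \<subseteq> y) :: real))
        = of_bool (?A \<subseteq> y) * (\<Sum>U\<in>Pow ?B. (- 1) ^ card U * of_bool (U \<subseteq> y))"
      unfolding sum_distrib_left by (intro sum.cong) (auto simp: of_bool_def)
    also have "\<dots> = of_bool (?A \<subseteq> y) * of_bool (?B \<inter> y = {})"
      by (subst sum_Pow_alternating) (use fS in auto)
    also have "\<dots> = of_bool (y \<inter> S y0 = y0 \<inter> S y0)"
      unfolding of_bool_conj[symmetric] by (rule arg_cong[of _ _ of_bool]) blast
    finally show ?thesis by simp
  qed
  have "(\<Sum>y\<in>?F. \<phi> y * of_bool (y \<inter> S y0 = y0 \<inter> S y0))
      = (\<Sum>U\<in>Pow ?B. (- 1) ^ card U * (\<Sum>y\<in>?F. \<phi> y * of_bool (?A \<union> U \<subseteq> y)))"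
    unfolding ind sum_distrib_left by (subst sum.swap) (simp add: mult_ac)
  also have "\<dots> = 0"
  proof (intro sum.neutral ballI)
    fix U assume U: "U \<in> Pow ?B"
    have "?A \<union> U \<subseteq> S y0" using U by auto
    then have "?A \<union> U \<in> ?Z" using y0 S[of y0] card_mono[OF fS, of "?A \<union> U"] by auto
    then show "(- 1) ^ card U * (\<Sum>y\<in>?F. \<phi> y * of_bool (?A \<union> U \<subseteq> y)) = 0"
      by (simp only: \<phi>(2) mult_zero_right)
  qed
  finally have "(\<Sum>y\<in>?F. \<phi> y * of_bool (y \<inter> S y0 = y0 \<inter> S y0)) = 0" .
  moreover have "(\<Sum>y\<in>?F. \<phi> y * of_bool (y \<inter> S y0 = y0 \<inter> S y0)) = (\<Sum>y\<in>?F. if y = y0 then \<phi> y0 else 0)"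
  proof (intro sum.cong refl)
    fix y assume y: "y \<in> ?F"
    have "\<phi> y = 0" if "y \<noteq> y0" "y \<inter> S y0 = y0 \<inter> S y0"
    proof (rule ccontr)
      assume "\<phi> y \<noteq> 0"
      then have "E y \<le> E y0" using max y by blast
      moreover have "E y0 < E y" using tri[of y0 y] y y0 that by auto
      ultimately show False by simp
    qed
    then show "\<phi> y * of_bool (y \<inter> S y0 = y0 \<inter> S y0) = (if y = y0 then \<phi> y0 else 0)" by auto
  qed
  ultimately have "\<phi> y0 = 0" using y0 I by (simp add: sum.delta)
  then show False using y0 by simp
qed

text \<open>Abel summation: up to a common constant, \<open>x ^ j\<close> is a combination of the
  indicators \<open>j \<le> d\<close> with coefficients that are nonnegative for \<open>x\<close> in
  [0, 1].\<close>

lemma sum_power_le_of_card_le: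
  fixes f g :: "'a \<Rightarrow> nat" and x :: real
  assumes A: "finite A" and x: "0 \<le> x" "x \<le> 1"
    and le: "\<And>d. card {a \<in> A. f a \<le> d} \<le> card {a \<in> A. g a \<le> d}"
  shows "(\<Sum>a\<in>A. x ^ f a) \<le> (\<Sum>a\<in>A. x ^ g a)"
proof -
  define M where "M = Max (insert 0 (f ` A \<union> g ` A))"
  have M: "f a \<le> M" "g a \<le> M" if "a \<in> A" for a
    unfolding M_def using A that by (auto intro!: Max_ge)
  have telescope: "x ^ j = x ^ M + (\<Sum>d<M. of_bool (j \<le> d) * (x ^ d - x ^ Suc d))" if "j \<le> M" for j
  proof -
    have "(\<Sum>d<M. of_bool (j \<le> d) * (x ^ d - x ^ Suc d)) = (\<Sum>d\<in>{j..<M}. x ^ d - x ^ Suc d)"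
      by (intro sum.mono_neutral_cong_right) auto
    also have "\<dots> = x ^ j - x ^ M" using sum_Suc_diff'[OF that, of "\<lambda>d. - (x ^ d)"] by simp
    finally show ?thesis by simp
  qed
  have rep: "(\<Sum>a\<in>A. x ^ h a) = card A * x ^ M + (\<Sum>d<M. card {a \<in> A. h a \<le> d} * (x ^ d - x ^ Suc d))"
    if "\<And>a. a \<in> A \<Longrightarrow> h a \<le> M" for h
  proof -
    have "(\<Sum>a\<in>A. x ^ h a) = (\<Sum>a\<in>A. x ^ M + (\<Sum>d<M. of_bool (h a \<le> d) * (x ^ d - x ^ Suc d)))"
      by (intro sum.cong refl telescope that)
    also have "\<dots> = card A * x ^ M + (\<Sum>d<M. (\<Sum>a\<in>A. of_bool (h a \<le> d)) * (x ^ d - x ^ Suc d))"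
      unfolding sum.distrib sum_distrib_right by (subst (2) sum.swap) simp
    also have "(\<lambda>d. \<Sum>a\<in>A. of_bool (h a \<le> d)) = (\<lambda>d. real (card {a \<in> A. h a \<le> d}))"
      using A by (simp add: of_bool_def sum.If_cases Int_def)
    finally show ?thesis .
  qed
  have "card A * x ^ M + (\<Sum>d<M. card {a \<in> A. f a \<le> d} * (x ^ d - x ^ Suc d))
     \<le> card A * x ^ M + (\<Sum>d<M. card {a \<in> A. g a \<le> d} * (x ^ d - x ^ Suc d))"
    by (intro add_left_mono sum_mono mult_right_mono) (use le x in \<open>auto simp: mult_left_le_one_le\<close>)
  then show ?thesis using rep[of f] rep[of g] M by auto
qed

lemma sum_Pow_power: "finite I \<Longrightarrow> (\<Sum>Z\<in>Pow I. x ^ card Z) = (1 + x :: real) ^ card I"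
proof (induction I rule: finite_induct)
  case (insert b B)
  have "(\<Sum>U\<in>Pow (insert b B). x ^ card U) = (\<Sum>U\<in>Pow B. x ^ card U) + (\<Sum>U\<in>insert b ` Pow B. x ^ card U)"
    unfolding Pow_insert using insert by (subst sum.union_disjoint) auto
  also have "(\<Sum>U\<in>insert b ` Pow B. x ^ card U) = (\<Sum>U\<in>Pow B. x ^ card (insert b U))"
    by (subst sum.reindex) (use insert in \<open>auto simp: inj_on_def\<close>)
  also have "\<dots> = (\<Sum>U\<in>Pow B. x * x ^ card U)"
    using insert by (intro sum.cong refl) (subst card_insert_disjoint; auto simp: finite_subset)
  finally show ?case using insert by (simp add: sum_distrib_left[symmetric] algebra_simps)
qed auto

lemma sum_power_teaching_sets_le:
  fixes S :: "'a set \<Rightarrow> 'a set" and E :: "'a set \<Rightarrow> real" and x :: real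
  assumes I: "finite I" and S: "\<And>y. y \<subseteq> I \<Longrightarrow> S y \<subseteq> I"
    and tri: "\<And>y y'. y \<subseteq> I \<Longrightarrow> y' \<subseteq> I \<Longrightarrow> y' \<noteq> y \<Longrightarrow> y' \<inter> S y = y \<inter> S y \<Longrightarrow> E y < E y'"
    and x: "0 \<le> x" "x \<le> 1"
  shows "(\<Sum>y\<in>Pow I. x ^ card (S y)) \<le> (1 + x) ^ card I"
proof -
  have "card {y \<in> Pow I. card (S y) \<le> d} \<le> card {Z \<in> Pow I. card Z \<le> d}" for d
    by (rule card_teaching_sets_le[OF I]) (fact S, fact tri)
  then show ?thesis
    unfolding sum_Pow_power[OF I, symmetric] by (intro sum_power_le_of_card_le) (use I x in auto)
qed

text \<open>Agreement with \<open>y\<close> is an involution of \<open>Pow I\<close>, so matches may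
  be read as membership. The sum then factorizes over the sites: 1 + x inside \<open>B\<close>, 2
  outside.\<close>

lemma sum_Pow_matching_power:
  fixes x :: real
  assumes I: "finite I" and B: "B \<subseteq> I"
  shows "(\<Sum>r\<in>Pow I. x ^ card {i \<in> B. i \<in> y \<longleftrightarrow> i \<in> r}) = 2 ^ card (I - B) * (1 + x) ^ card B"
proof -
  let ?h = "\<lambda>r. {i \<in> I. i \<in> y \<longleftrightarrow> i \<in> r}"
  have "(\<Sum>r\<in>Pow I. x ^ card {i \<in> B. i \<in> y \<longleftrightarrow> i \<in> r}) = (\<Sum>r\<in>Pow I. x ^ card (B \<inter> r))"
    by (rule sum.reindex_bij_witness[where i = ?h and j = ?h])
       (use B in \<open>auto intro!: arg_cong[where f = "\<lambda>s. x ^ card s"]\<close>)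
  also have "\<dots> = (\<Sum>r\<in>Pow I. (\<Prod>i\<in>r. if i \<in> B then x else 1) * (\<Prod>i\<in>I - r. 1))"
  proof (intro sum.cong refl)
    fix r assume "r \<in> Pow I"
    then have "finite r" using I finite_subset by auto
    then have "(\<Prod>i\<in>r. if i \<in> B then x else 1) = x ^ card (B \<inter> r)"
      by (simp add: prod.If_cases Int_commute)
    then show "x ^ card (B \<inter> r) = (\<Prod>i\<in>r. if i \<in> B then x else 1) * (\<Prod>i\<in>I - r. 1)" by simp
  qed
  also have "\<dots> = (\<Prod>i\<in>I. (if i \<in> B then x else 1) + 1)"
    by (rule prod_add[OF I, symmetric])
  also have "\<dots> = (\<Prod>i\<in>I. if i \<in> B then 1 + x else 2)"
    by (intro prod.cong) auto
  also have "\<dots> = 2 ^ card (I - B) * (1 + x) ^ card B"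
    using I B by (simp add: prod.If_cases Int_absorb1 Diff_eq)
  finally show ?thesis .
qed

text \<open>At sites outside \<open>act y\<close> the coin of \<open>r\<close> decides what counts as agreement, so averaging the
  previous bound over \<open>r\<close> makes these sites drop out.\<close>
lemma sum_active_sites_weight_le:
  fixes act sat :: "'a set \<Rightarrow> 'a set" and E :: "'a set \<Rightarrow> 'a set \<Rightarrow> real" and x :: real
  assumes I: "finite I" and act: "\<And>y. y \<subseteq> I \<Longrightarrow> act y \<subseteq> I" and sat: "\<And>y. y \<subseteq> I \<Longrightarrow> sat y \<subseteq> act y"
    and tri: "\<And>r y y'. r \<subseteq> I \<Longrightarrow> y \<subseteq> I \<Longrightarrow> y' \<subseteq> I \<Longrightarrow> y' \<noteq> y \<Longrightarrow>
       (\<And>i. i \<in> I \<Longrightarrow> i \<in> sat y \<or> i \<notin> act y \<and> (i \<in> y \<longleftrightarrow> i \<in> r) \<Longrightarrow> i \<in> y' \<longleftrightarrow> i \<in> y) \<Longrightarrow> E r y < E r y'"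
    and x: "0 \<le> x" "x \<le> 1"
  shows "(\<Sum>y\<in>Pow I. (2 / (1 + x)) ^ card (act y - sat y) * (2 * x / (1 + x)) ^ card (sat y)) \<le> 2 ^ card I"
proof -
  \<comment> \<open>Averaged over \<open>r\<close>, an inactive site contributes (1 + x)/2, an
    active one 1 or \<open>x\<close>. Dividing by (1 + x)/2 for every site leaves exactly the
    weights of the claim.\<close>
  define S where "S r y = sat y \<union> {i \<in> I - act y. i \<in> y \<longleftrightarrow> i \<in> r}" for r y
  have "(\<Sum>y\<in>Pow I. x ^ card (S r y)) \<le> (1 + x) ^ card I" if r: "r \<subseteq> I" for r
  proof (rule sum_power_teaching_sets_le[where E = "E r", OF I])
    show "S r y \<subseteq> I" if "y \<subseteq> I" for y using act[OF that] sat[OF that] by (auto simp: S_def)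
    show "E r y < E r y'" if "y \<subseteq> I" "y' \<subseteq> I" "y' \<noteq> y" "y' \<inter> S r y = y \<inter> S r y" for y y'
    proof (rule tri[OF r that(1-3)])
      fix i assume "i \<in> I" "i \<in> sat y \<or> i \<notin> act y \<and> (i \<in> y \<longleftrightarrow> i \<in> r)"
      then have "i \<in> S r y" by (auto simp: S_def)
      then show "i \<in> y' \<longleftrightarrow> i \<in> y" using that(4) by blast
    qed
  qed (use x in auto)
  then have "(\<Sum>r\<in>Pow I. \<Sum>y\<in>Pow I. x ^ card (S r y)) \<le> (\<Sum>r\<in>Pow I. (1 + x) ^ card I)"
    by (intro sum_mono) auto
  also have "\<dots> = 2 ^ card I * (1 + x) ^ card I" using I by (simp add: card_Pow)
  also have "(\<Sum>r\<in>Pow I. \<Sum>y\<in>Pow I. x ^ card (S r y)) = (\<Sum>y\<in>Pow I. \<Sum>r\<in>Pow I. x ^ card (S r y))"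
    by (rule sum.swap)
  also have "\<dots> = (\<Sum>y\<in>Pow I. (2 / (1 + x)) ^ card (act y - sat y) * (2 * x / (1 + x)) ^ card (sat y) * (1 + x) ^ card I)"
  proof (intro sum.cong refl)
    fix y assume "y \<in> Pow I"
    then have y: "y \<subseteq> I" by simp
    have fin: "finite (act y)" "finite (sat y)"
      using act[OF y] sat[OF y] I by (auto intro: finite_subset)
    have cS: "card (S r y) = card (sat y) + card {i \<in> I - act y. i \<in> y \<longleftrightarrow> i \<in> r}" for r
      unfolding S_def using sat[OF y] fin I by (subst card_Un_disjoint) auto
    have "(\<Sum>r\<in>Pow I. x ^ card (S r y)) = x ^ card (sat y) * (2 ^ card (I - (I - act y)) * (1 + x) ^ card (I - act y))"
      unfolding cS power_add sum_distrib_left[symmetric] using I by (subst sum_Pow_matching_power) auto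
    also have "I - (I - act y) = act y" using act[OF y] by blast
    also have "card (act y) = card (act y - sat y) + card (sat y)"
      using card_mono[OF fin(1) sat[OF y]] card_Diff_subset[OF fin(2) sat[OF y]] by simp
    finally have 1: "(\<Sum>r\<in>Pow I. x ^ card (S r y)) =
       x ^ card (sat y) * (2 ^ (card (act y - sat y) + card (sat y)) * (1 + x) ^ card (I - act y))" .
    have 2: "card I = card (act y - sat y) + card (sat y) + card (I - act y)"
      using card_mono[OF fin(1) sat[OF y]] card_Diff_subset[OF fin(2) sat[OF y]]
        card_mono[OF I act[OF y]] card_Diff_subset[OF fin(1) act[OF y]] by simp
    show "(\<Sum>r\<in>Pow I. x ^ card (S r y)) =
       (2 / (1 + x)) ^ card (act y - sat y) * (2 * x / (1 + x)) ^ card (sat y) * (1 + x) ^ card I"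
      unfolding 1 2 using x by (simp add: power_add power_divide power_mult_distrib field_simps)
  qed
  finally have "(\<Sum>y\<in>Pow I. (2 / (1 + x)) ^ card (act y - sat y) * (2 * x / (1 + x)) ^ card (sat y)) * (1 + x) ^ card I
      \<le> 2 ^ card I * (1 + x) ^ card I"
    unfolding sum_distrib_right .
  then show ?thesis using x by (simp add: mult_le_cancel_right)
qed

section \<open>Ridge regression\<close>

text \<open>The right-hand side stays free so that linearity in the labels is available while the
  points are fixed.\<close>

definition ridge_sol :: "real \<Rightarrow> (nat \<Rightarrow> (real^'d) \<times> nat) \<Rightarrow> nat set \<Rightarrow> real^'d \<Rightarrow> real^'d" where
  "ridge_sol mu T I b = matrix_inv (gram T I + mu *\<^sub>R mat 1) *v b"

lemma ridge_w_def': "ridge_w lam T I j =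
    (if lam > 0 then ridge_sol lam T I (Xty T I j) else Lim (at_right 0) (\<lambda>mu. ridge_sol mu T I (Xty T I j)))"
  by (simp add: ridge_w_def ridge_sol_def)

lemma outer_vec_mult: "outer_vec x *v w = (x \<bullet> w) *\<^sub>R x"
  by (simp add: outer_vec_def matrix_vector_mult_def inner_vec_def vec_eq_iff sum_distrib_right
      sum_distrib_left mult_ac)

lemma gram_mult: "gram T I *v w = (\<Sum>i\<in>I. (fst (T i) \<bullet> w) *\<^sub>R fst (T i))"
proof (cases "finite I")
  case True
  then show ?thesis
    unfolding gram_def
    by (induction I rule: finite_induct) (auto simp: matrix_vector_mult_add_rdistrib outer_vec_mult)
qed (simp add: gram_def)

lemma reg_gram_mult: "(gram T I + mu *\<^sub>R mat 1) *v w = (\<Sum>i\<in>I. (fst (T i) \<bullet> w) *\<^sub>R fst (T i)) + mu *\<^sub>R w"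
  by (simp add: matrix_vector_mult_add_rdistrib gram_mult scaleR_matrix_vector_assoc[symmetric])

lemma inner_reg_gram:
  "v \<bullet> ((gram T I + mu *\<^sub>R mat 1) *v w) = (\<Sum>i\<in>I. (fst (T i) \<bullet> w) * (fst (T i) \<bullet> v)) + mu * (v \<bullet> w)"
  by (simp add: reg_gram_mult inner_add_right inner_sum_right inner_commute)

lemma reg_gram_injective:
  assumes "mu > 0" "(gram T I + mu *\<^sub>R mat 1) *v w = 0"
  shows "w = 0"
proof -
  have "0 = w \<bullet> ((gram T I + mu *\<^sub>R mat 1) *v w)" using assms by simp
  also have "\<dots> = (\<Sum>i\<in>I. (fst (T i) \<bullet> w)\<^sup>2) + mu * (w \<bullet> w)"
    unfolding inner_reg_gram by (simp add: power2_eq_square)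
  also have "\<dots> \<ge> mu * (w \<bullet> w)" by (simp add: sum_nonneg)
  finally have "w \<bullet> w \<le> 0" using assms(1) by (simp add: mult_le_0_iff)
  then show ?thesis by (metis inner_eq_zero_iff inner_ge_zero order_antisym)
qed

lemma invertible_reg_gram: "mu > 0 \<Longrightarrow> invertible (gram T I + mu *\<^sub>R mat 1)"
  unfolding invertible_left_inverse matrix_left_invertible_injective inj_def
  by (metis reg_gram_injective matrix_vector_mult_diff_distrib eq_iff_diff_eq_0)

lemma ridge_sol_normal_eq:
  assumes "mu > 0"
  shows "(gram T I + mu *\<^sub>R mat 1) *v ridge_sol mu T I b = b"
proof -
  let ?A = "gram T I + mu *\<^sub>R mat 1"
  have "?A ** matrix_inv ?A = mat 1"
    using invertible_reg_gram[OF assms, of T I] unfolding invertible_def matrix_inv_def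
    by (rule someI2_ex) auto
  then show ?thesis by (simp add: ridge_sol_def matrix_vector_mul_assoc)
qed

lemma ridge_sol_unique:
  assumes "mu > 0" "(gram T I + mu *\<^sub>R mat 1) *v w = b"
  shows "ridge_sol mu T I b = w"
proof -
  have "(gram T I + mu *\<^sub>R mat 1) *v (ridge_sol mu T I b - w) = 0"
    using assms ridge_sol_normal_eq[OF assms(1)] by (simp add: matrix_vector_mult_diff_distrib)
  then show ?thesis using reg_gram_injective[OF assms(1)] by fastforce
qed

lemma ridge_sol_add: "ridge_sol mu T I (b + b') = ridge_sol mu T I b + ridge_sol mu T I b'"
  and ridge_sol_diff: "ridge_sol mu T I (b - b') = ridge_sol mu T I b - ridge_sol mu T I b'"
  and ridge_sol_scaleR: "ridge_sol mu T I (c *\<^sub>R b) = c *\<^sub>R ridge_sol mu T I b"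
  by (simp_all add: ridge_sol_def matrix_vector_right_distrib matrix_vector_mult_diff_distrib
      matrix_vector_mult_scaleR)

text \<open>Testing the normal equation with its own solution gives a resolvent bound that does not
  depend on the data; it controls the limit of vanishing regularization.\<close>

lemma mu_norm_ridge_sol_le:
  assumes "mu > 0"
  shows "mu * norm (ridge_sol mu T I u) \<le> norm u"
proof -
  let ?w = "ridge_sol mu T I u"
  have "mu * (norm ?w)\<^sup>2 \<le> (\<Sum>i\<in>I. (fst (T i) \<bullet> ?w)\<^sup>2) + mu * (?w \<bullet> ?w)"
    by (simp add: sum_nonneg power2_norm_eq_inner)
  also have "\<dots> = ?w \<bullet> u"
    using inner_reg_gram[of ?w T I mu ?w] ridge_sol_normal_eq[OF assms, of T I u]
    by (simp add: power2_eq_square)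
  also have "\<dots> \<le> norm ?w * norm u" by (rule norm_cauchy_schwarz)
  finally have "norm ?w * (mu * norm ?w) \<le> norm ?w * norm u" by (simp add: power2_eq_square mult_ac)
  then show ?thesis by (cases "?w = 0") auto
qed

text \<open>The Gram map sends the span of the points to itself, with trivial kernel: a vector in
  the kernel is orthogonal to every point, hence to itself.\<close>

lemma gram_surj_on_span:
  fixes T :: "nat \<Rightarrow> (real^'d) \<times> nat"
  assumes b: "b \<in> span ((\<lambda>i. fst (T i)) ` I)" and I: "finite I"
  shows "\<exists>u\<in>span ((\<lambda>i. fst (T i)) ` I). gram T I *v u = b"
proof -
  let ?X = "span ((\<lambda>i. fst (T i)) ` I)"
  let ?G = "\<lambda>w. gram T I *v w"
  have lin: "linear ?G" by simp
  have sub: "?G ` ?X \<subseteq> ?X"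
    by (auto simp: gram_mult intro!: span_sum span_scale intro: span_base)
  have inj: "inj_on ?G ?X"
  proof (subst linear_inj_on_iff_eq_0[OF lin subspace_span], intro ballI impI)
    fix w assume w: "w \<in> ?X" "?G w = 0"
    have "0 = w \<bullet> ?G w" using w by simp
    also have "\<dots> = (\<Sum>i\<in>I. (fst (T i) \<bullet> w)\<^sup>2)"
      by (simp add: gram_mult inner_sum_right inner_commute power2_eq_square)
    finally have "\<forall>i\<in>I. fst (T i) \<bullet> w = 0" using I by (subst (asm) eq_commute) (simp add: sum_nonneg_eq_0_iff)
    then have "orthogonal w w"
      by (intro orthogonal_to_span[OF w(1)]) (auto simp: orthogonal_def inner_commute)
    then show "w = 0" by (simp add: orthogonal_def)
  qed
  have "dim (?G ` ?X) = dim ?X"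
    using dim_image_eq[OF lin, of ?X] inj by (simp add: span_span)
  then have "?G ` ?X = ?X"
    using sub by (intro subspace_dim_equal linear_subspace_image[OF lin]) auto
  then show ?thesis using b by (metis imageE)
qed

lemma Xty_in_span: "Xty T I j \<in> span ((\<lambda>i. fst (T i)) ` I)"
  unfolding Xty_def by (intro span_sum span_scale span_base) auto

lemma ridge_sol_Xty_convergent:
  fixes T :: "nat \<Rightarrow> (real^'d) \<times> nat"
  assumes I: "finite I"
  shows "\<exists>v. ((\<lambda>mu. ridge_sol mu T I (Xty T I j)) \<longlongrightarrow> v) (at_right 0)"
proof -
  let ?X = "span ((\<lambda>i. fst (T i)) ` I)"
  obtain v where v: "v \<in> ?X" "gram T I *v v = Xty T I j"
    using gram_surj_on_span[OF Xty_in_span I] by metis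
  \<comment> \<open>A second preimage is taken so that the error becomes -\<mu>(u - \<mu> s u), with
    \<open>s\<close> the regularized solution map; this is of order \<mu>.\<close>
  obtain u where u: "gram T I *v u = v" using gram_surj_on_span[OF v(1) I] by metis
  have bound: "norm (ridge_sol mu T I (Xty T I j) - v) \<le> mu * (2 * norm u)" if mu: "mu > 0" for mu
  proof -
    let ?s = "ridge_sol mu T I"
    have gr: "?s (gram T I *v w) = w - mu *\<^sub>R ?s w" for w
      using ridge_sol_unique[OF mu, of T I w "gram T I *v w + mu *\<^sub>R w"]
      by (simp add: matrix_vector_mult_add_rdistrib scaleR_matrix_vector_assoc[symmetric]
          ridge_sol_add ridge_sol_scaleR algebra_simps)
    have "?s (Xty T I j) - v = - (mu *\<^sub>R (u - mu *\<^sub>R ?s u))"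
      using gr[of v] gr[of u] v(2) u by simp
    also have "norm \<dots> = mu * norm (u - mu *\<^sub>R ?s u)" using mu by simp
    also have "\<dots> \<le> mu * (norm u + mu * norm (?s u))"
      using mu norm_triangle_ineq4[of u "mu *\<^sub>R ?s u"] by (intro mult_left_mono) auto
    also have "\<dots> \<le> mu * (2 * norm u)"
      using mu mu_norm_ridge_sol_le[OF mu, of T I u] by (intro mult_left_mono) auto
    finally show ?thesis .
  qed
  have "((\<lambda>mu. mu * (2 * norm u)) \<longlongrightarrow> 0) (at_right 0)" by (auto intro!: tendsto_eq_intros)
  then have "((\<lambda>mu. ridge_sol mu T I (Xty T I j) - v) \<longlongrightarrow> 0) (at_right 0)"
    by (rule Lim_null_comparison[rotated]) (auto simp: eventually_at_right_field intro!: exI[of _ 1] bound)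
  then show ?thesis using Lim_null by blast
qed

text \<open>One sequence of positive regularizations serves both branches of \<open>ridge_w\<close>:
  facts are proved for invertible systems and then passed to the limit.\<close>

definition mu_seq :: "real \<Rightarrow> nat \<Rightarrow> real" where
  "mu_seq lam t = (if lam > 0 then lam else inverse (real (Suc t)))"

lemma mu_seq_pos: "mu_seq lam t > 0"
  by (simp add: mu_seq_def)

lemma ridge_w_tendsto:
  assumes "finite I"
  shows "(\<lambda>t. ridge_sol (mu_seq lam t) T I (Xty T I j)) \<longlonglongrightarrow> ridge_w lam T I j"
proof (cases "lam > 0")
  case False
  obtain v where v: "((\<lambda>mu. ridge_sol mu T I (Xty T I j)) \<longlongrightarrow> v) (at_right 0)"
    using ridge_sol_Xty_convergent[OF assms] by blast
  have "filterlim (\<lambda>t. inverse (real (Suc t))) (at_right 0) sequentially"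
    by (rule tendsto_imp_filterlim_at_right[OF LIMSEQ_inverse_real_of_nat]) simp
  from filterlim_compose[OF v this] show ?thesis
    using False tendsto_Lim[OF trivial_limit_at_right_real v] by (simp add: ridge_w_def' mu_seq_def)
qed (simp add: ridge_w_def' mu_seq_def)

lemma ridge_w_cong:
  assumes "gram T I = gram T' I'" "Xty T I j = Xty T' I' j"
  shows "ridge_w lam T I j = ridge_w lam T' I' j"
  using assms by (simp add: ridge_w_def)

text \<open>Linearity in the right-hand side, passed to the limit. It keeps the sum of two class
  scores fixed when labels are flipped between these two classes.\<close>

lemma ridge_w_sum_cong:
  assumes I: "finite I" and gram: "gram T I = gram T' I" 
    and eq: "Xty T I a + Xty T I b = Xty T' I a + Xty T' I b"
  shows "ridge_w lam T I a + ridge_w lam T I b = ridge_w lam T' I a + ridge_w lam T' I b"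
proof (rule LIMSEQ_unique)
  show "(\<lambda>t. ridge_sol (mu_seq lam t) T I (Xty T I a) + ridge_sol (mu_seq lam t) T I (Xty T I b))
      \<longlonglongrightarrow> ridge_w lam T I a + ridge_w lam T I b"
    by (intro tendsto_add ridge_w_tendsto I)
  have "ridge_sol mu T I (Xty T I a) + ridge_sol mu T I (Xty T I b)
      = ridge_sol mu T' I (Xty T' I a) + ridge_sol mu T' I (Xty T' I b)" for mu
    unfolding ridge_sol_add[symmetric] eq by (simp add: ridge_sol_def gram)
  then show "(\<lambda>t. ridge_sol (mu_seq lam t) T I (Xty T I a) + ridge_sol (mu_seq lam t) T I (Xty T I b))
      \<longlonglongrightarrow> ridge_w lam T' I a + ridge_w lam T' I b"
    by (simp only:) (intro tendsto_add ridge_w_tendsto I)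
qed

text \<open>The Sherman-Morrison identity with leverage \<open>h\<close>. The leverage is the same
  for all classes, so training on \<open>i\<close> moves all scores at that point towards its
  one-hot label by one common fraction.\<close>

lemma ridge_w_leave_one_out:
  fixes T :: "nat \<Rightarrow> (real^'d) \<times> nat"
  assumes I: "finite I" and i: "i \<in> I"
  shows "\<exists>h\<in>{0..1}. \<forall>j. ridge_w lam T I j \<bullet> fst (T i) =
     (1 - h) * (ridge_w lam T (I - {i}) j \<bullet> fst (T i)) + h * of_bool (snd (T i) = j)"
proof -
  let ?x = "fst (T i)"
  define h where "h t = ?x \<bullet> ridge_sol (mu_seq lam t) T I ?x" for t
  have gram: "gram T I *v w = gram T (I - {i}) *v w + (?x \<bullet> w) *\<^sub>R ?x" for w
    unfolding gram_mult using I i by (subst sum.remove[of I i]) auto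
  have xty: "Xty T I j = Xty T (I - {i}) j + of_bool (snd (T i) = j) *\<^sub>R ?x" for j
    unfolding Xty_def using I i by (subst sum.remove[of I i]) auto
  have h: "h t \<in> {0..1}" for t
  proof -
    let ?u = "ridge_sol (mu_seq lam t) T I ?x"
    note mu = mu_seq_pos[of lam t]
    \<comment> \<open>Tested with its own solution, the normal equation writes \<open>h t\<close> as
      a sum of nonnegative terms, one of which is the square of \<open>h t\<close>.\<close>
    have "h t = (\<Sum>i\<in>I. (fst (T i) \<bullet> ?u)\<^sup>2) + mu_seq lam t * (?u \<bullet> ?u)"
      using inner_reg_gram[of ?u T I "mu_seq lam t" ?u] ridge_sol_normal_eq[OF mu, of T I ?x]
      by (simp add: power2_eq_square h_def inner_commute)
    moreover have "(fst (T i) \<bullet> ?u)\<^sup>2 \<le> (\<Sum>i\<in>I. (fst (T i) \<bullet> ?u)\<^sup>2)"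
      using I i by (intro member_le_sum) auto
    moreover have "0 \<le> mu_seq lam t * (?u \<bullet> ?u)" using mu by simp
    ultimately have "(h t)\<^sup>2 \<le> h t" by (simp add: h_def)
    then have "h t * (1 - h t) \<ge> 0" by (simp add: algebra_simps power2_eq_square)
    then show ?thesis by (auto simp: zero_le_mult_iff)
  qed
  have step: "ridge_sol (mu_seq lam t) T I (Xty T I j) \<bullet> ?x =
      (1 - h t) * (ridge_sol (mu_seq lam t) T (I - {i}) (Xty T (I - {i}) j) \<bullet> ?x) + h t * of_bool (snd (T i) = j)" for t j
  proof -
    let ?mu = "mu_seq lam t"
    let ?w = "ridge_sol ?mu T (I - {i}) (Xty T (I - {i}) j)"
    let ?d = "(of_bool (snd (T i) = j) - ?w \<bullet> ?x) :: real"
    note mu = mu_seq_pos[of lam t]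
    \<comment> \<open>The leave-one-out solution solves the full system in which the response at
      \<open>i\<close> is its own prediction; \<open>?d\<close> is the correction to the actual
      response.\<close>
    have "(gram T I + ?mu *\<^sub>R mat 1) *v ?w
        = (gram T (I - {i}) + ?mu *\<^sub>R mat 1) *v ?w + (?x \<bullet> ?w) *\<^sub>R ?x"
      by (simp add: matrix_vector_mult_add_rdistrib gram)
    also have "\<dots> = Xty T (I - {i}) j + (?x \<bullet> ?w) *\<^sub>R ?x" using ridge_sol_normal_eq[OF mu] by simp
    also have "\<dots> = Xty T I j - ?d *\<^sub>R ?x" by (simp add: xty algebra_simps inner_commute)
    finally have "ridge_sol ?mu T I (Xty T I j - ?d *\<^sub>R ?x) = ?w" by (rule ridge_sol_unique[OF mu])
    then have eq: "ridge_sol ?mu T I (Xty T I j) = ?w + ?d *\<^sub>R ridge_sol ?mu T I ?x"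
      unfolding ridge_sol_diff ridge_sol_scaleR by (metis diff_eq_eq)
    show ?thesis unfolding eq by (simp add: inner_add_left h_def inner_commute algebra_simps)
  qed
  \<comment> \<open>Compactness of [0, 1] provides a limit leverage along a subsequence. This
    suffices, since the scores converge along the whole sequence, and one subsequence serves all
    classes.\<close>
  obtain l r where l: "l \<in> {0..1}" and r: "strict_mono r" and lim: "(h \<circ> r) \<longlonglongrightarrow> l"
    using seq_compactE[OF compact_imp_seq_compact[OF compact_Icc[of "0::real" 1]], of h] h by metis
  show ?thesis
  proof (intro bexI[OF _ l] allI)
    fix j
    have "(\<lambda>t. ridge_sol (mu_seq lam t) T I (Xty T I j) \<bullet> ?x) \<longlonglongrightarrow> ridge_w lam T I j \<bullet> ?x"
      by (intro tendsto_intros ridge_w_tendsto I)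
    from LIMSEQ_subseq_LIMSEQ[OF this r]
    have 1: "(\<lambda>t. ridge_sol (mu_seq lam (r t)) T I (Xty T I j) \<bullet> ?x) \<longlonglongrightarrow> ridge_w lam T I j \<bullet> ?x"
      by (simp add: o_def)
    have "(\<lambda>t. ridge_sol (mu_seq lam t) T (I - {i}) (Xty T (I - {i}) j) \<bullet> ?x) \<longlonglongrightarrow> ridge_w lam T (I - {i}) j \<bullet> ?x"
      by (intro tendsto_intros ridge_w_tendsto) (use I in auto)
    from LIMSEQ_subseq_LIMSEQ[OF this r]
    have "(\<lambda>t. (1 - h (r t)) * (ridge_sol (mu_seq lam (r t)) T (I - {i}) (Xty T (I - {i}) j) \<bullet> ?x)
         + h (r t) * of_bool (snd (T i) = j)) \<longlonglongrightarrow>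
        (1 - l) * (ridge_w lam T (I - {i}) j \<bullet> ?x) + l * of_bool (snd (T i) = j)"
      using lim by (intro tendsto_add tendsto_mult tendsto_diff tendsto_const) (simp_all add: o_def)
    then show "ridge_w lam T I j \<bullet> ?x =
       (1 - l) * (ridge_w lam T (I - {i}) j \<bullet> ?x) + l * of_bool (snd (T i) = j)"
      using 1 unfolding step by (rule LIMSEQ_unique[rotated])
  qed
qed

text \<open>The fitted values are half the gradient of the convex quadratic form
  \<open>\<Sum>j. b\<^sub>j\<^sup>T (X\<^sup>T X + \<mu> I)\<inverse> b\<^sub>j\<close> of the one-hot labels, where \<open>b\<^sub>j = X\<^sup>T y\<^sub>j\<close>.\<close>
lemma ridge_w_energy:
  fixes T T' :: "nat \<Rightarrow> (real^'d) \<times> nat"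
  assumes I: "finite I" and x: "\<And>l. l \<in> I \<Longrightarrow> fst (T' l) = fst (T l)"
  shows "2 * ((\<Sum>l\<in>I. ridge_w lam T I (snd (T' l)) \<bullet> fst (T l)) - (\<Sum>l\<in>I. ridge_w lam T I (snd (T l)) \<bullet> fst (T l)))
    \<le> (\<Sum>l\<in>I. ridge_w lam T' I (snd (T' l)) \<bullet> fst (T l)) - (\<Sum>l\<in>I. ridge_w lam T I (snd (T l)) \<bullet> fst (T l))"
proof -
  have gram: "gram T' I = gram T I" using x by (simp add: gram_def)
  define s where "s t j = ridge_sol (mu_seq lam t) T I (Xty T I j)" for t j
  define s' where "s' t j = ridge_sol (mu_seq lam t) T' I (Xty T' I j)" for t j
  have lim: "(\<lambda>t. s t j) \<longlonglongrightarrow> ridge_w lam T I j" "(\<lambda>t. s' t j) \<longlonglongrightarrow> ridge_w lam T' I j" for j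
    unfolding s_def s'_def by (intro ridge_w_tendsto I)+
  \<comment> \<open>Labels are arbitrary numbers here, so sums over classes run over the finitely
    many labels that occur.\<close>
  define L where "L = (\<lambda>l. snd (T l)) ` I \<union> (\<lambda>l. snd (T' l)) ` I"
  have L: "finite L" using I by (simp add: L_def)
  have regroup: "(\<Sum>l\<in>I. v (snd (U l)) \<bullet> fst (T l)) = (\<Sum>j\<in>L. v j \<bullet> Xty U I j)"
    if U: "\<And>l. l \<in> I \<Longrightarrow> snd (U l) \<in> L" "\<And>l. l \<in> I \<Longrightarrow> fst (U l) = fst (T l)" for U v
  proof -
    have "(\<Sum>j\<in>L. v j \<bullet> Xty U I j) = (\<Sum>j\<in>L. \<Sum>l\<in>I. if snd (U l) = j then v j \<bullet> fst (U l) else 0)"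
      unfolding Xty_def inner_sum_right by (intro sum.cong) auto
    also have "\<dots> = (\<Sum>l\<in>I. \<Sum>j\<in>L. if snd (U l) = j then v j \<bullet> fst (U l) else 0)" by (rule sum.swap)
    also have "\<dots> = (\<Sum>l\<in>I. v (snd (U l)) \<bullet> fst (T l))"
      using L U by (intro sum.cong) (auto simp: sum.delta)
    finally show ?thesis by simp
  qed
  have reg: "(\<Sum>l\<in>I. v (snd (T l)) \<bullet> fst (T l)) = (\<Sum>j\<in>L. v j \<bullet> Xty T I j)"
    "(\<Sum>l\<in>I. v (snd (T' l)) \<bullet> fst (T l)) = (\<Sum>j\<in>L. v j \<bullet> Xty T' I j)" for v
    by (intro regroup; auto simp: L_def x)+
  have le: "2 * ((\<Sum>l\<in>I. s t (snd (T' l)) \<bullet> fst (T l)) - (\<Sum>l\<in>I. s t (snd (T l)) \<bullet> fst (T l)))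
    \<le> (\<Sum>l\<in>I. s' t (snd (T' l)) \<bullet> fst (T l)) - (\<Sum>l\<in>I. s t (snd (T l)) \<bullet> fst (T l))" for t
  proof -
    note mu = mu_seq_pos[of lam t]
    let ?A = "gram T I + mu_seq lam t *\<^sub>R mat 1"
    have "2 * (s t j \<bullet> Xty T' I j - s t j \<bullet> Xty T I j) \<le> s' t j \<bullet> Xty T' I j - s t j \<bullet> Xty T I j" for j
    proof -
      have b: "Xty T I j = ?A *v s t j" "Xty T' I j = ?A *v s' t j"
        using ridge_sol_normal_eq[OF mu, of T I "Xty T I j"] ridge_sol_normal_eq[OF mu, of T' I "Xty T' I j"]
          gram by (simp_all add: s_def s'_def)
      have sym: "v \<bullet> (?A *v w) = w \<bullet> (?A *v v)" for v w
        unfolding inner_reg_gram by (simp add: inner_commute mult.commute)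
      \<comment> \<open>Convexity: the quadratic form of the regularized Gram matrix is nonnegative
        at the difference of the two solutions, and symmetry merges the cross terms.\<close>
      let ?e = "s' t j - s t j"
      have "0 \<le> ?e \<bullet> (?A *v ?e)"
        using mu by (simp add: inner_reg_gram sum_nonneg)
      also have "\<dots> = s' t j \<bullet> Xty T' I j + s t j \<bullet> Xty T I j - 2 * (s t j \<bullet> Xty T' I j)"
        unfolding b using sym[of "s' t j" "s t j"]
        by (simp add: matrix_vector_mult_diff_distrib inner_diff_left inner_diff_right)
      finally show ?thesis by simp
    qed
    then have "(\<Sum>j\<in>L. 2 * (s t j \<bullet> Xty T' I j - s t j \<bullet> Xty T I j)) \<le> (\<Sum>j\<in>L. s' t j \<bullet> Xty T' I j - s t j \<bullet> Xty T I j)"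
      by (intro sum_mono)
    then show ?thesis unfolding reg by (simp add: sum_subtractf sum_distrib_left[symmetric])
  qed
  have "(\<lambda>t. 2 * ((\<Sum>l\<in>I. s t (snd (T' l)) \<bullet> fst (T l)) - (\<Sum>l\<in>I. s t (snd (T l)) \<bullet> fst (T l)))) \<longlonglongrightarrow>
      2 * ((\<Sum>l\<in>I. ridge_w lam T I (snd (T' l)) \<bullet> fst (T l)) - (\<Sum>l\<in>I. ridge_w lam T I (snd (T l)) \<bullet> fst (T l)))"
    by (intro tendsto_intros lim)
  moreover have "(\<lambda>t. (\<Sum>l\<in>I. s' t (snd (T' l)) \<bullet> fst (T l)) - (\<Sum>l\<in>I. s t (snd (T l)) \<bullet> fst (T l))) \<longlonglongrightarrow>
      (\<Sum>l\<in>I. ridge_w lam T' I (snd (T' l)) \<bullet> fst (T l)) - (\<Sum>l\<in>I. ridge_w lam T I (snd (T l)) \<bullet> fst (T l))"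
    by (intro tendsto_intros lim)
  ultimately show ?thesis by (rule LIMSEQ_le) (use le in blast)
qed

section \<open>Most random labels are not fitted better than the true ones\<close>

lemma argmax_cls_nonempty:
  assumes "k > 0"
  shows "argmax_cls k w x \<noteq> {}"
proof -
  let ?V = "(\<lambda>j. w j \<bullet> x) ` {1..k}"
  have "Max ?V \<in> ?V" using assms by (intro Max_in) auto
  then obtain j where j: "j \<in> {1..k}" "w j \<bullet> x = Max ?V" by auto
  then have "j \<in> argmax_cls k w x" by (auto simp: argmax_cls_def)
  then show ?thesis by blast
qed

lemma argmax_cls_subset: "argmax_cls k w x \<subseteq> {1..k}"
  by (auto simp: argmax_cls_def)

definition relabel :: "(nat \<Rightarrow> (real^'d) \<times> nat) \<Rightarrow> (nat \<Rightarrow> nat) \<Rightarrow> nat \<Rightarrow> (real^'d) \<times> nat" where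
  "relabel z c = (\<lambda>l. (fst (z l), c l))"

lemma fst_relabel [simp]: "fst (relabel z c l) = fst (z l)"
  and snd_relabel [simp]: "snd (relabel z c l) = c l"
  by (simp_all add: relabel_def)

definition pred :: "nat \<Rightarrow> real \<Rightarrow> (nat \<Rightarrow> (real^'d) \<times> nat) \<Rightarrow> nat set \<Rightarrow> nat \<Rightarrow> nat set" where
  "pred k lam T I i = argmax_cls k (ridge_w lam T I) (fst (T i))"

text \<open>Sites whose true label is \<open>a\<close> or \<open>b\<close> are left out, so a flip
  only exchanges wrong labels and the set of wrongly labelled sites stays the same.\<close>

definition pair_sites :: "(nat \<Rightarrow> (real^'d) \<times> nat) \<Rightarrow> nat set \<Rightarrow> nat \<Rightarrow> nat \<Rightarrow> (nat \<Rightarrow> nat) \<Rightarrow> nat set" where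
  "pair_sites z J a b c = {i \<in> J. c i \<in> {a, b} \<and> snd (z i) \<notin> {a, b}}"

text \<open>The two nontrivial values average to 1, as they would if a fair coin decided whether the
  label is predicted. For \<open>x\<close> < 1 a fitted label costs and a missed one gains.\<close>

definition pair_weight :: "nat \<Rightarrow> real \<Rightarrow> (nat \<Rightarrow> (real^'d) \<times> nat) \<Rightarrow> nat set \<Rightarrow> nat set \<Rightarrow> real \<Rightarrow> nat \<Rightarrow> nat \<Rightarrow> (nat \<Rightarrow> nat) \<Rightarrow> nat \<Rightarrow> real" where
  "pair_weight k lam z I J x a b c i =
     (if i \<in> pair_sites z J a b c \<and> pred k lam (relabel z c) I i \<inter> {a, b} \<noteq> {}
      then (if c i \<in> pred k lam (relabel z c) I i then 2 * x / (1 + x) else 2 / (1 + x)) else 1)"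

definition pair_config :: "(nat \<Rightarrow> (real^'d) \<times> nat) \<Rightarrow> nat set \<Rightarrow> nat \<Rightarrow> nat \<Rightarrow> (nat \<Rightarrow> nat) \<Rightarrow> nat set \<Rightarrow> nat \<Rightarrow> nat" where
  "pair_config z J a b c y = (\<lambda>i. if i \<in> pair_sites z J a b c then (if i \<in> y then a else b) else c i)"

lemma pair_sites_config:
  "pair_sites z J a b (pair_config z J a b c y) = pair_sites z J a b c"
  by (auto simp: pair_sites_def pair_config_def)

text \<open>Flipping labels between \<open>a\<close> and \<open>b\<close> changes neither the scores of the other classes nor the sum of
  the scores of \<open>a\<close> and \<open>b\<close>; so, for these flips, \<open>\<theta> i\<close> below is a fixed threshold that a score has to
  reach, and it can be encoded by a field \<open>\<tau> i\<close> added to the energy. The constant \<open>\<eta>\<close> breaks ties.\<close>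
lemma sum_pair_configs_weight_le:
  fixes z :: "nat \<Rightarrow> (real^'d) \<times> nat"
  assumes I: "finite I" "J \<subseteq> I" and k: "3 \<le> k" and ab: "a \<in> {1..k}" "b \<in> {1..k}" "a \<noteq> b"
    and x: "0 < x" "x \<le> 1"
  shows "(\<Sum>y\<in>Pow J. \<Prod>i\<in>J. pair_weight k lam z I J x a b (pair_config z J a b c y) i) \<le> 2 ^ card J"
proof -
  define W where "W = pair_sites z J a b c"
  define C where "C = pair_config z J a b c"
  define T where "T y = relabel z (C y)" for y
  define f where "f y j i = ridge_w lam (T y) I j \<bullet> fst (z i)" for y j i
  define A where "A y i = argmax_cls k (ridge_w lam (T y) I) (fst (z i))" for y i
  define act where "act y = {i \<in> W. A y i \<inter> {a, b} \<noteq> {}}" for y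
  define sat where "sat y = {i \<in> W. C y i \<in> A y i}" for y
  have J: "finite J" using I finite_subset by blast
  have WJ: "W \<subseteq> J" by (auto simp: W_def pair_sites_def)
  have CW: "C y i = (if i \<in> y then a else b)" if "i \<in> W" for y i
    using that by (simp add: C_def pair_config_def W_def)
  have CnW: "C y i = c i" if "i \<notin> W" for y i
    using that by (simp add: C_def pair_config_def W_def)
  have Axy: "j \<in> A y i \<longleftrightarrow> j \<in> {1..k} \<and> (\<forall>l\<in>{1..k}. f y l i \<le> f y j i)" for j y i
    by (auto simp: A_def argmax_cls_def f_def)
  have gram: "gram (T y) I = gram (T {}) I" for y by (simp add: gram_def T_def)
  have cab: "c i \<in> {a, b}" if "i \<in> W" for i using that by (auto simp: W_def pair_sites_def)
  have f_other: "f y j i = f {} j i" if "j \<notin> {a, b}" for y j i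
  proof -
    have "C y l = j \<longleftrightarrow> C {} l = j" for l using that CW[of l] CnW[of l] by (cases "l \<in> W") auto
    then have "Xty (T y) I j = Xty (T {}) I j" by (simp add: Xty_def T_def)
    then show ?thesis unfolding f_def by (simp add: ridge_w_cong[OF gram[of y]])
  qed
  have f_sum: "f y a i + f y b i = f {} a i + f {} b i" for y i
  proof -
    have "(if C y l = a then 1 else 0) + (if C y l = b then 1 else 0)
       = ((if C {} l = a then 1 else 0) + (if C {} l = b then 1 else 0) :: real)" for l
      using ab(3) CW[of l] CnW[of l] by (cases "l \<in> W") auto
    then have "Xty (T y) I a + Xty (T y) I b = Xty (T {}) I a + Xty (T {}) I b"
      unfolding Xty_def sum.distrib[symmetric] scaleR_add_left[symmetric] by (simp add: T_def)
    from ridge_w_sum_cong[OF I(1) gram[of y] this] show ?thesis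
      unfolding f_def by (metis inner_add_left)
  qed
  \<comment> \<open>The third classes; \<open>k\<close> \<ge> 3 makes the maximum that defines the
    threshold one over a nonempty set.\<close>
  define R where "R = {1..k} - {a, b}"
  have R: "finite R" "R \<noteq> {}"
  proof -
    have "card {1..k} - card {a, b} \<le> card R" unfolding R_def by (intro diff_card_le_card_Diff) auto
    then have "card R > 0" using k ab by auto
    then show "finite R" "R \<noteq> {}" by (auto simp: card_gt_0_iff)
  qed
  define \<theta> where "\<theta> i = Max ((\<lambda>j. f {} j i) ` R)" for i
  have \<theta>_ge: "f y j i \<le> \<theta> i" if "j \<in> R" for y j i
    unfolding \<theta>_def using R that f_other[of j y i] by (intro Max_ge) (auto simp: R_def)
  have \<theta>_attained: "\<exists>j\<in>R. f y j i = \<theta> i" for y i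
  proof -
    have "\<theta> i \<in> (\<lambda>j. f {} j i) ` R" unfolding \<theta>_def using R by (intro Max_in) auto
    then obtain j where j: "j \<in> R" "\<theta> i = f {} j i" by auto
    then have "f y j i = \<theta> i" using f_other[of j y i] by (simp add: R_def)
    with j(1) show ?thesis by blast
  qed
  have A_iff: "j \<in> A y i \<longleftrightarrow> \<theta> i \<le> f y j i \<and> f y o' i \<le> f y j i" if "{j, o'} = {a, b}" for j o' y i
  proof -
    have "{1..k} = insert j (insert o' R)" using that ab by (auto simp: R_def)
    then have "j \<in> A y i \<longleftrightarrow> (\<forall>l\<in>R. f y l i \<le> f y j i) \<and> f y o' i \<le> f y j i"
      unfolding Axy by auto
    also have "(\<forall>l\<in>R. f y l i \<le> f y j i) \<longleftrightarrow> \<theta> i \<le> f y j i"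
      using \<theta>_ge \<theta>_attained[of y i] by (metis order_trans)
    finally show ?thesis .
  qed
  \<comment> \<open>All positive shortfalls of a score of \<open>a\<close> or \<open>b\<close> below
    its threshold, over all flips. They are finitely many, so one positive \<eta> lies below or at
    each of them.\<close>
  define gaps where "gaps = {\<theta> i - f y j i | i y j. i \<in> W \<and> y \<subseteq> J \<and> j \<in> {a, b} \<and> f y j i < \<theta> i}"
  have "gaps \<subseteq> (\<lambda>(i, y, j). \<theta> i - f y j i) ` (W \<times> Pow J \<times> {a, b})"
  proof
    fix v assume "v \<in> gaps"
    then obtain i y j where "v = \<theta> i - f y j i" "i \<in> W" "y \<subseteq> J" "j \<in> {a, b}" by (auto simp: gaps_def)
    then show "v \<in> (\<lambda>(i, y, j). \<theta> i - f y j i) ` (W \<times> Pow J \<times> {a, b})"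
      by (intro image_eqI[of _ _ "(i, y, j)"]) auto
  qed
  then have "finite gaps" by (rule finite_subset) (use J finite_subset[OF WJ J] in auto)
  define \<eta> where "\<eta> = Min (insert 1 gaps)"
  have \<eta>_pos: "\<eta> > 0" unfolding \<eta>_def using \<open>finite gaps\<close> by (subst Min_gr_iff) (auto simp: gaps_def)
  have \<eta>_le: "\<eta> \<le> \<theta> i - f y j i" if "i \<in> W" "y \<subseteq> J" "j \<in> {a, b}" "f y j i < \<theta> i" for i y j
    unfolding \<eta>_def using \<open>finite gaps\<close> that by (intro Min_le) (auto simp: gaps_def)
  \<comment> \<open>As the two scores have a fixed sum, 2\<theta> minus that sum is their difference
    when the larger one just reaches the threshold. Subtracting \<eta> makes both cases below
    strict.\<close>
  define \<tau> where "\<tau> i = max 0 (2 * \<theta> i - (f {} a i + f {} b i) - \<eta>)" for i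
  define \<psi> where "\<psi> r y i = (if i \<in> W then \<tau> i else 1) * of_bool (i \<in> y \<longleftrightarrow> i \<in> r)" for r y i
  \<comment> \<open>The factor 2 matches \<open>ridge_w_energy\<close>, where twice the first-order
    change of the fitted values bounds the change of energy from below.\<close>
  define E where "E r y = (\<Sum>l\<in>I. f y (C y l) l) + 2 * (\<Sum>i\<in>J. \<psi> r y i)" for r y
  have "(\<Sum>y\<in>Pow J. (2 / (1 + x)) ^ card (act y - sat y) * (2 * x / (1 + x)) ^ card (sat y)) \<le> 2 ^ card J"
  proof (rule sum_active_sites_weight_le[OF J, where E = E])
    show "act y \<subseteq> J" for y using WJ by (auto simp: act_def)
    show "sat y \<subseteq> act y" for y by (auto simp: act_def sat_def CW split: if_splits)
    fix r y y' assume r: "r \<subseteq> J" and y: "y \<subseteq> J" and y': "y' \<subseteq> J" and ne: "y' \<noteq> y"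
      and agree: "\<And>i. i \<in> J \<Longrightarrow> i \<in> sat y \<or> i \<notin> act y \<and> (i \<in> y \<longleftrightarrow> i \<in> r) \<Longrightarrow> i \<in> y' \<longleftrightarrow> i \<in> y"
    define D where "D = {i \<in> J. (i \<in> y') \<noteq> (i \<in> y)}"
    have D: "finite D" "D \<noteq> {}" "D \<subseteq> J" using J y y' ne by (auto simp: D_def)
    \<comment> \<open>The first-order gain of flipping site \<open>i\<close> alone; by convexity,
      positive gains add up to a rise of the energy.\<close>
    define g where "g i = f y (C y' i) i - f y (C y i) i + (\<psi> r y' i - \<psi> r y i)" for i
    have g_pos: "g i > 0" if i: "i \<in> D" for i
    proof -
      have iJ: "i \<in> J" and flip: "(i \<in> y') \<noteq> (i \<in> y)" using i by (auto simp: D_def)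
      have nsat: "i \<notin> sat y" and abst: "i \<notin> act y \<Longrightarrow> (i \<in> y) \<noteq> (i \<in> r)" using agree[OF iJ] flip by auto
      show ?thesis
      proof (cases "i \<in> W")
        case False
        \<comment> \<open>Here a flip changes no label; only the unit field acts, and the flip moves
          towards \<open>r\<close>.\<close>
        then have "i \<notin> act y" by (simp add: act_def)
        then show ?thesis using False abst flip by (auto simp: g_def CnW \<psi>_def)
      next
        case True
        let ?c = "C y i" and ?o = "C y' i"
        have co: "{?c, ?o} = {a, b}" "{?o, ?c} = {a, b}" using CW[OF True] flip by auto
        have sum: "f y ?c i + f y ?o i = f {} a i + f {} b i"
          using f_sum[of y i] co ab(3) by (auto simp: doubleton_eq_iff)
        have nc: "?c \<notin> A y i" using nsat True by (simp add: sat_def)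
        have \<tau>0: "\<tau> i \<ge> 0" by (simp add: \<tau>_def)
        show ?thesis
        proof (cases "?o \<in> A y i")
          case oA: True
          then have o1: "\<theta> i \<le> f y ?o i" "f y ?c i \<le> f y ?o i" using A_iff[OF co(2)] by auto
          have o2: "f y ?c i < f y ?o i" using nc o1 A_iff[OF co(1)] by fastforce
          \<comment> \<open>If \<tau> is positive, this is twice the amount by which the new label's
            score exceeds \<theta>, plus \<eta>; if \<tau> is 0, it is a strict gain of
            score.\<close>
          have "f y ?o i - f y ?c i - \<tau> i > 0"
            using o1 o2 sum \<eta>_pos by (auto simp: \<tau>_def max_def)
          moreover have "g i \<ge> f y ?o i - f y ?c i - \<tau> i"
            using True \<tau>0 by (auto simp: g_def \<psi>_def of_bool_def)
          ultimately show ?thesis by linarith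
        next
          case oA: False
          have "A y i \<inter> {a, b} = {}" using nc oA unfolding co(1)[symmetric] by auto
          then have yr: "(i \<in> y) \<noteq> (i \<in> r)" using abst by (simp add: act_def)
          have lt: "f y ?c i < \<theta> i"
            using nc oA A_iff[OF co(1)] A_iff[OF co(2)] by fastforce
          have "\<eta> \<le> \<theta> i - f y ?c i"
            by (intro \<eta>_le[OF True y _ lt]) (simp add: co(1)[symmetric])
          \<comment> \<open>Now the field helps. The total is at least twice the shortfall of
            \<open>?c\<close> minus \<eta>, hence at least that shortfall.\<close>
          then have "f y ?o i - f y ?c i + \<tau> i > 0" using sum lt by (auto simp: \<tau>_def)
          moreover have "g i = f y ?o i - f y ?c i + \<tau> i"
            using True yr flip by (auto simp: g_def \<psi>_def)
          ultimately show ?thesis by linarith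
        qed
      qed
    qed
    have eq_off: "C y' l = C y l" if "l \<notin> D" for l
    proof (cases "l \<in> W")
      case True
      then show ?thesis using that WJ by (auto simp: D_def CW)
    qed (simp add: CnW)
    have "0 < (\<Sum>i\<in>D. g i)" using D g_pos by (intro sum_pos) auto
    also have "\<dots> = (\<Sum>i\<in>D. f y (C y' i) i - f y (C y i) i) + (\<Sum>i\<in>D. \<psi> r y' i - \<psi> r y i)"
      unfolding g_def by (simp add: sum.distrib)
    also have "(\<Sum>i\<in>D. f y (C y' i) i - f y (C y i) i) = (\<Sum>i\<in>I. f y (C y' i) i - f y (C y i) i)"
      using D I eq_off by (intro sum.mono_neutral_left) auto
    also have "(\<Sum>i\<in>D. \<psi> r y' i - \<psi> r y i) = (\<Sum>i\<in>J. \<psi> r y' i - \<psi> r y i)"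
      using D J by (intro sum.mono_neutral_left) (auto simp: D_def \<psi>_def)
    finally have pos: "0 < (\<Sum>i\<in>I. f y (C y' i) i) - (\<Sum>i\<in>I. f y (C y i) i) + ((\<Sum>i\<in>J. \<psi> r y' i) - (\<Sum>i\<in>J. \<psi> r y i))"
      by (simp add: sum_subtractf)
    have "2 * ((\<Sum>l\<in>I. f y (C y' l) l) - (\<Sum>l\<in>I. f y (C y l) l)) \<le> (\<Sum>l\<in>I. f y' (C y' l) l) - (\<Sum>l\<in>I. f y (C y l) l)"
      using ridge_w_energy[OF I(1), of "T y'" "T y" lam] by (simp add: T_def f_def)
    then show "E r y < E r y'" using pos by (simp add: E_def)
  qed (use x in auto)
  also have "(\<Sum>y\<in>Pow J. (2 / (1 + x)) ^ card (act y - sat y) * (2 * x / (1 + x)) ^ card (sat y))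
     = (\<Sum>y\<in>Pow J. \<Prod>i\<in>J. pair_weight k lam z I J x a b (pair_config z J a b c y) i)"
  proof (intro sum.cong refl)
    fix y assume "y \<in> Pow J"
    have sa: "sat y \<subseteq> act y" "act y \<subseteq> J" using WJ by (auto simp: act_def sat_def CW split: if_splits)
    have psC: "pair_sites z J a b (C y) = W" by (simp add: C_def pair_sites_config W_def)
    have predA: "pred k lam (relabel z (C y)) I i = A y i" for i
      by (simp add: pred_def A_def T_def)
    have pw: "pair_weight k lam z I J x a b (pair_config z J a b c y) i
       = (if i \<in> act y - sat y then 2 / (1 + x) else 1) * (if i \<in> sat y then 2 * x / (1 + x) else 1)" for i
      unfolding pair_weight_def C_def[symmetric] psC predA using sa(1) by (auto simp: act_def sat_def)
    have pow: "(\<Prod>i\<in>J. if i \<in> B then u else 1) = u ^ card B" if "B \<subseteq> J" for B and u :: real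
      using J that by (simp add: prod.If_cases Int_absorb1)
    then show "(2 / (1 + x)) ^ card (act y - sat y) * (2 * x / (1 + x)) ^ card (sat y) =
       (\<Prod>i\<in>J. pair_weight k lam z I J x a b (pair_config z J a b c y) i)"
      unfolding pw prod.distrib using sa by (subst (1 2) pow) auto
  qed
  finally show ?thesis .
qed

definition extend_labels :: "(nat \<Rightarrow> (real^'d) \<times> nat) \<Rightarrow> nat set \<Rightarrow> (nat \<Rightarrow> nat) \<Rightarrow> nat \<Rightarrow> nat" where
  "extend_labels z J c = (\<lambda>l. if l \<in> J then c l else snd (z l))"

text \<open>Each flip of pair sites permutes the labellings, so the sum may be averaged over flips
  and bounded orbit by orbit. Under uniform labels the product of weights thus has mean at most
  1.\<close>

lemma sum_labels_pair_weight_le: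
  fixes z :: "nat \<Rightarrow> (real^'d) \<times> nat"
  assumes I: "finite I" "J \<subseteq> I" and k: "3 \<le> k" and ab: "a \<in> {1..k}" "b \<in> {1..k}" "a \<noteq> b"
    and x: "0 < x" "x \<le> 1"
  shows "(\<Sum>c\<in>J \<rightarrow>\<^sub>E {1..k}. \<Prod>i\<in>J. pair_weight k lam z I J x a b (extend_labels z J c) i) \<le> card (J \<rightarrow>\<^sub>E {1..k})"
proof -
  let ?C = "J \<rightarrow>\<^sub>E {1..k}"
  define \<Psi> where "\<Psi> c = (\<Prod>i\<in>J. pair_weight k lam z I J x a b c i)" for c
  let ?e = "extend_labels z J"
  have J: "finite J" using I finite_subset by blast
  define flip where "flip y c = (\<lambda>i. if i \<in> J \<inter> y \<and> c i \<in> {a, b} \<and> snd (z i) \<notin> {a, b} then a + b - c i else c i)"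
    for y :: "nat set" and c :: "nat \<Rightarrow> nat"
  have flip2: "flip y (flip y c) = c" for y c by (auto simp: flip_def fun_eq_iff)
  have flipC: "flip y c \<in> ?C" if "c \<in> ?C" for y c
    using that ab by (auto simp: flip_def PiE_def Pi_def extensional_def)
  have "(\<Sum>c\<in>?C. \<Psi> (?e (flip y c))) = (\<Sum>c\<in>?C. \<Psi> (?e c))" for y
    by (rule sum.reindex_bij_witness[where i = "flip y" and j = "flip y"]) (use flip2 flipC in auto)
  then have "2 ^ card J * (\<Sum>c\<in>?C. \<Psi> (?e c)) = (\<Sum>y\<in>Pow J. \<Sum>c\<in>?C. \<Psi> (?e (flip y c)))"
    using J by (simp add: card_Pow)
  also have "\<dots> = (\<Sum>c\<in>?C. \<Sum>y\<in>Pow J. \<Psi> (?e (flip y c)))" by (rule sum.swap)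
  also have "\<dots> = (\<Sum>c\<in>?C. \<Sum>y\<in>Pow J. \<Psi> (pair_config z J a b (?e c) y))"
  proof (rule sum.cong[OF refl])
    fix c
    \<comment> \<open>\<open>flip\<close> acts relative to the present label while
      \<open>pair_config\<close> prescribes the label; \<open>h\<close> translates between the
      two.\<close>
    define h where "h y = {i \<in> J. i \<in> y \<longleftrightarrow> c i = b}" for y
    have hh: "h (h y) = y" if "y \<in> Pow J" for y using that by (auto simp: h_def)
    have "?e (flip y c) = pair_config z J a b (?e c) (h y)" for y
      using ab(3) by (auto simp: fun_eq_iff extend_labels_def flip_def pair_config_def pair_sites_def h_def)
    then show "(\<Sum>y\<in>Pow J. \<Psi> (?e (flip y c))) = (\<Sum>y\<in>Pow J. \<Psi> (pair_config z J a b (?e c) y))"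
      by (intro sum.reindex_bij_witness[where i = h and j = h]) (use hh in \<open>auto simp: h_def\<close>)
  qed
  also have "\<dots> \<le> (\<Sum>c\<in>?C. 2 ^ card J)"
    unfolding \<Psi>_def by (intro sum_mono sum_pair_configs_weight_le assms)
  also have "\<dots> = 2 ^ card J * real (card ?C)" by simp
  finally show ?thesis unfolding \<Psi>_def by simp
qed

definition wrong_fits :: "nat \<Rightarrow> real \<Rightarrow> (nat \<Rightarrow> (real^'d) \<times> nat) \<Rightarrow> nat set \<Rightarrow> nat set \<Rightarrow> (nat \<Rightarrow> nat) \<Rightarrow> nat set" where
  "wrong_fits k lam z I J c = {i \<in> J. c i \<noteq> snd (z i) \<and> c i \<in> pred k lam (relabel z c) I i}"

definition wrong_misses :: "nat \<Rightarrow> real \<Rightarrow> (nat \<Rightarrow> (real^'d) \<times> nat) \<Rightarrow> nat set \<Rightarrow> nat set \<Rightarrow> (nat \<Rightarrow> nat) \<Rightarrow> nat set" where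
  "wrong_misses k lam z I J c = {i \<in> J. c i \<noteq> snd (z i) \<and> snd (z i) \<notin> pred k lam (relabel z c) I i}"

text \<open>Hoeffding's lemma for a fair coin.\<close>

lemma ln_half_one_plus_exp_le:
  assumes "t \<ge> (0::real)"
  shows "ln ((1 + exp t) / 2) \<le> t / 2 + t\<^sup>2 / 8"
  using Hoeffdings_lemma_aux[OF assms, of "1/2"] by (simp add: field_simps)

text \<open>For a wrongly labelled site, each of the \<open>2 (k - 2)\<close> ordered pairs formed by its label and another
  wrong label contributes; a fitted label costs all of them, a label missed together with the true
  label gains at least the two formed with a predicted class.\<close>
lemma sum_ln_pair_weight_ge:
  fixes z :: "nat \<Rightarrow> (real^'d) \<times> nat"
  assumes J: "finite J" and k: "3 \<le> k" and c: "\<And>i. i \<in> J \<Longrightarrow> c i \<in> {1..k}"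
    and z: "\<And>i. i \<in> J \<Longrightarrow> snd (z i) \<in> {1..k}" and x: "0 < x" "x \<le> 1"
  defines "Q \<equiv> {(a, b) \<in> {1..k} \<times> {1..k}. a \<noteq> b}"
  shows "2 * (ln (2 / (1 + x)) * (real (card (wrong_misses k lam z I J c)) - real (card (wrong_fits k lam z I J c)))
      + ln (2 * x / (1 + x)) * (real k - 2) * real (card (wrong_fits k lam z I J c)))
     \<le> (\<Sum>(a, b)\<in>Q. \<Sum>i\<in>J. ln (pair_weight k lam z I J x a b c i))"
proof -
  let ?u = "ln (2 / (1 + x))" and ?v = "ln (2 * x / (1 + x))"
  have u: "?u \<ge> 0" using x by (intro ln_ge_zero) simp
  have v: "?v \<le> 0" using x by (subst ln_le_zero_iff) (simp_all add: field_simps)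
  have Q: "finite Q" unfolding Q_def by (rule finite_subset[of _ "{1..k} \<times> {1..k}"]) auto
  define A where "A i = pred k lam (relabel z c) I i" for i
  \<comment> \<open>Because of ties a site may fit both its wrong label and the true one. Misses
    minus fits therefore only underestimates the sites where both are missed, which is harmless as
    \<open>?u\<close> \<ge> 0.\<close>
  have site: "2 * (?u * (of_bool (c i \<noteq> snd (z i) \<and> snd (z i) \<notin> A i) - of_bool (c i \<noteq> snd (z i) \<and> c i \<in> A i))
      + ?v * (real k - 2) * of_bool (c i \<noteq> snd (z i) \<and> c i \<in> A i))
     \<le> (\<Sum>(a, b)\<in>Q. ln (pair_weight k lam z I J x a b c i))" if i: "i \<in> J" for i
  proof -
    let ?t = "snd (z i)"
    have pw: "ln (pair_weight k lam z I J x a b c i) =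
        (if c i \<in> {a, b} \<and> ?t \<notin> {a, b} \<and> A i \<inter> {a, b} \<noteq> {} then (if c i \<in> A i then ?v else ?u) else 0)" for a b
      using i by (simp add: pair_weight_def pair_sites_def A_def)
    consider (right) "c i = ?t" | (fit) "c i \<noteq> ?t" "c i \<in> A i" | (miss) "c i \<noteq> ?t" "c i \<notin> A i" by blast
    then show ?thesis
    proof cases
      case right
      then show ?thesis unfolding pw by (auto intro!: sum_nonneg)
    next
      case fit
      define D where "D = {1..k} - {c i, ?t}"
      let ?P = "Pair (c i) ` D \<union> (\<lambda>b. (b, c i)) ` D"
      have cardD: "card D = k - 2"
        unfolding D_def using c[OF i] z[OF i] fit by (subst card_Diff_subset) auto
      have "card ?P = card (Pair (c i) ` D) + card ((\<lambda>b. (b, c i)) ` D)"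
        by (intro card_Un_disjoint) (auto simp: D_def)
      also have "\<dots> = 2 * (k - 2)"
        by (subst (1 2) card_image) (auto simp: inj_on_def cardD)
      finally have cardP: "card ?P = 2 * (k - 2)" .
      have PQ: "?P \<subseteq> Q" using c[OF i] by (auto simp: Q_def D_def)
      have "\<not> (c i \<in> {a, b} \<and> ?t \<notin> {a, b})" if "(a, b) \<in> Q" "(a, b) \<notin> ?P" for a b
        using that by (auto simp: Q_def D_def image_iff)
      then have off: "ln (pair_weight k lam z I J x a b c i) = 0" if "(a, b) \<in> Q - ?P" for a b
        using that by (simp only: pw) auto
      have "(\<Sum>(a, b)\<in>Q. ln (pair_weight k lam z I J x a b c i)) = (\<Sum>(a, b)\<in>?P. ln (pair_weight k lam z I J x a b c i))"
      proof (rule sum.mono_neutral_right[OF Q PQ], rule ballI)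
        fix p assume "p \<in> Q - ?P"
        then show "(case p of (a, b) \<Rightarrow> ln (pair_weight k lam z I J x a b c i)) = 0"
          by (cases p) (simp only: prod.case off)
      qed
      also have "\<dots> = (\<Sum>p\<in>?P. ?v)"
        using fit by (intro sum.cong refl) (auto simp: pw D_def split: if_splits)
      also have "\<dots> = 2 * (real k - 2) * ?v" using k by (simp add: cardP of_nat_diff)
      finally show ?thesis using fit u by (simp add: algebra_simps)
    next
      case miss
      have nonneg: "ln (pair_weight k lam z I J x a b c i) \<ge> 0" for a b using miss u by (simp add: pw)
      show ?thesis
      proof (cases "?t \<in> A i")
        case True
        then show ?thesis using miss nonneg by (auto intro!: sum_nonneg)
      next
        case False
        \<comment> \<open>Some class is predicted, and it is neither of the two labels; the two
          ordered pairs it forms with \<open>c i\<close> are active and contribute \<open>?u\<close>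
          each.\<close>
        obtain g where g: "g \<in> A i" "g \<in> {1..k}"
          using argmax_cls_nonempty[of k] argmax_cls_subset k unfolding A_def pred_def by fastforce
        then have "g \<noteq> c i" "g \<noteq> ?t" using miss False by auto
        then have "2 * ?u = (\<Sum>(a, b)\<in>{(c i, g), (g, c i)}. ln (pair_weight k lam z I J x a b c i))"
          using g miss by (simp add: pw)
        also have "\<dots> \<le> (\<Sum>(a, b)\<in>Q. ln (pair_weight k lam z I J x a b c i))"
          using Q g c[OF i] \<open>g \<noteq> c i\<close> nonneg by (intro sum_mono2) (auto simp: Q_def)
        finally show ?thesis using miss False by simp
      qed
    qed
  qed
  have cards: "real (card {i \<in> J. P i}) = (\<Sum>i\<in>J. of_bool (P i))" for P
    using J by (simp add: of_bool_def sum.If_cases Int_def)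
  have "2 * (?u * (real (card (wrong_misses k lam z I J c)) - real (card (wrong_fits k lam z I J c)))
      + ?v * (real k - 2) * real (card (wrong_fits k lam z I J c)))
    = (\<Sum>i\<in>J. 2 * (?u * (of_bool (c i \<noteq> snd (z i) \<and> snd (z i) \<notin> A i) - of_bool (c i \<noteq> snd (z i) \<and> c i \<in> A i))
      + ?v * (real k - 2) * of_bool (c i \<noteq> snd (z i) \<and> c i \<in> A i)))"
    unfolding wrong_misses_def wrong_fits_def A_def[symmetric] cards
    by (simp only: sum_distrib_left[symmetric] sum.distrib sum_subtractf)
  also have "\<dots> \<le> (\<Sum>i\<in>J. \<Sum>(a, b)\<in>Q. ln (pair_weight k lam z I J x a b c i))"
    by (intro sum_mono site)
  also have "\<dots> = (\<Sum>(a, b)\<in>Q. \<Sum>i\<in>J. ln (pair_weight k lam z I J x a b c i))"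
    by (subst sum.swap) (simp add: case_prod_unfold)
  finally show ?thesis .
qed

lemma card_off_diagonal_pairs: "card {(a, b) \<in> {1..k} \<times> {1..k}. a \<noteq> b} = k * (k - 1)"
proof -
  have "{(a, b) \<in> {1..k} \<times> {1..k}. a \<noteq> b} = Sigma {1..k} (\<lambda>a. {1..k} - {a})" by auto
  then show ?thesis by simp
qed

text \<open>Collected, the coefficient of \<open>u\<close> is M + (K - 3)F up to a factor 2. It is
  nonnegative for K \<ge> 3, so \<open>u\<close> may be replaced by its quadratic lower
  bound.\<close>

lemma weighted_margin_ge:
  fixes M F u t K A P :: real
  assumes P: "2 * (u * (M - F) + (u - t) * (K - 2) * F) \<le> P" and u: "t / 2 - t\<^sup>2 / 8 \<le> u"
    and nonneg: "0 \<le> M" "0 \<le> F" "3 \<le> K" and t: "0 < t"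
    and A: "(1 - t / 4) * M \<ge> (K - 1) * (1 + t / 4) * F + A / t"
  shows "A \<le> P"
proof -
  let ?X = "M + (K - 3) * F"
  have "A = t * (A / t)" using t by simp
  also have "\<dots> \<le> t * ((1 - t / 4) * M - (K - 1) * (1 + t / 4) * F)"
    using A t by (intro mult_left_mono) auto
  also have "\<dots> = 2 * ((t / 2 - t\<^sup>2 / 8) * ?X - t * (K - 2) * F) - t\<^sup>2 / 2 * F"
    by (simp add: power2_eq_square field_simps)
  also have "\<dots> \<le> 2 * ((t / 2 - t\<^sup>2 / 8) * ?X - t * (K - 2) * F)" using nonneg by simp
  also have "\<dots> \<le> 2 * (u * ?X - t * (K - 2) * F)"
    using u nonneg by (intro mult_left_mono diff_right_mono mult_right_mono) auto
  also have "\<dots> = 2 * (u * (M - F) + (u - t) * (K - 2) * F)" by (simp add: algebra_simps)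
  also note P
  finally show ?thesis .
qed

text \<open>Markov's inequality for the exponential of the mean log-weight over ordered pairs of
  classes. The products for different pairs are dependent; convexity of exp needs only their
  separate means, each at most 1.\<close>

lemma card_few_wrong_fits_le:
  fixes z :: "nat \<Rightarrow> (real^'d) \<times> nat" and t L :: real
  assumes I: "finite I" "J \<subseteq> I" and k: "3 \<le> k" and z: "\<And>i. i \<in> J \<Longrightarrow> snd (z i) \<in> {1..k}"
    and t: "0 < t" "t \<le> 4"
  defines "C \<equiv> J \<rightarrow>\<^sub>E {1..k}"
  shows "real (card {c \<in> C. (1 - t / 4) * card (wrong_misses k lam z I J (extend_labels z J c)) \<ge>
       (real k - 1) * (1 + t / 4) * card (wrong_fits k lam z I J (extend_labels z J c)) + real k * (real k - 1) * L / t})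
     \<le> exp (- L) * card C"
proof -
  \<comment> \<open>With this \<open>x\<close> the logarithms of the two nontrivial weights differ
    by exactly \<open>t\<close>.\<close>
  define x where "x = exp (- t)"
  have x: "0 < x" "x \<le> 1" using t by (auto simp: x_def)
  let ?u = "ln (2 / (1 + x))" and ?v = "ln (2 * x / (1 + x))"
  have J: "finite J" using I finite_subset by blast
  have finC: "finite C" unfolding C_def using J by (intro finite_PiE) auto
  have Cne: "card C > 0" unfolding C_def using J k by (simp add: card_PiE)
  have u: "?u \<ge> t / 2 - t\<^sup>2 / 8"
  proof -
    have "?u = - ln ((1 + exp (- t)) / 2)" by (simp add: x_def ln_div)
    also have "(1 + exp (- t)) / 2 = exp (- t) * ((1 + exp t) / 2)" by (simp add: field_simps exp_minus)
    also have "- ln \<dots> = t - ln ((1 + exp t) / 2)"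
      by (subst ln_mult_pos) (auto simp: add_pos_pos)
    finally show ?thesis using ln_half_one_plus_exp_le[of t] t by simp
  qed
  have v: "?v = ?u - t"
  proof -
    have "2 * x / (1 + x) = 2 / (1 + x) * exp (- t)" by (simp add: x_def)
    then show ?thesis using x by (simp only: ln_mult_pos divide_pos_pos add_pos_pos zero_less_one zero_less_numeral exp_gt_zero ln_exp)
  qed
  define Q where "Q = {(a, b) \<in> {1..k} \<times> {1..k}. a \<noteq> b}"
  have Q: "finite Q" unfolding Q_def by (rule finite_subset[of _ "{1..k} \<times> {1..k}"]) auto
  have cQ: "real (card Q) = real k * (real k - 1)"
    unfolding Q_def card_off_diagonal_pairs using k by (simp add: of_nat_diff)
  then have cQ0: "real (card Q) > 0" using k by simp
  then have Qne: "Q \<noteq> {}" by auto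
  let ?e = "extend_labels z J"
  let ?pw = "\<lambda>a b c i. pair_weight k lam z I J x a b (?e c) i"
  have pw_pos: "?pw a b c i > 0" for a b c i using x by (simp add: pair_weight_def)
  define \<Phi> where "\<Phi> c = (\<Sum>(a, b)\<in>Q. \<Sum>i\<in>J. ln (?pw a b c i))" for c
  let ?M = "\<lambda>c. real (card (wrong_misses k lam z I J (?e c)))"
  let ?F = "\<lambda>c. real (card (wrong_fits k lam z I J (?e c)))"
  let ?B = "{c \<in> C. (1 - t / 4) * ?M c \<ge> (real k - 1) * (1 + t / 4) * ?F c + real k * (real k - 1) * L / t}"
  have \<Phi>_ge: "\<Phi> c / card Q \<ge> L" if c: "c \<in> ?B" for c
  proof -
    have e: "?e c i \<in> {1..k}" if "i \<in> J" for i
      using c that by (auto simp: extend_labels_def C_def)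
    have "2 * (?u * (?M c - ?F c) + ?v * (real k - 2) * ?F c) \<le> \<Phi> c"
      unfolding \<Phi>_def Q_def by (rule sum_ln_pair_weight_ge[OF J k e z x])
    then have "real k * (real k - 1) * L \<le> \<Phi> c"
      unfolding v by (rule weighted_margin_ge[OF _ u]) (use c k t in auto)
    then show ?thesis using cQ0 unfolding cQ[symmetric] by (simp add: field_simps)
  qed
  have "real (card ?B) * exp L = (\<Sum>c\<in>?B. exp L)" by simp
  also have "\<dots> \<le> (\<Sum>c\<in>?B. exp (\<Phi> c / card Q))" using \<Phi>_ge by (intro sum_mono) simp
  also have "\<dots> \<le> (\<Sum>c\<in>C. exp (\<Phi> c / card Q))" using finC by (intro sum_mono2) auto
  also have "\<dots> \<le> (\<Sum>c\<in>C. \<Sum>(a, b)\<in>Q. (1 / card Q) * (\<Prod>i\<in>J. ?pw a b c i))"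
  proof (intro sum_mono)
    fix c
    have "exp (\<Sum>p\<in>Q. (1 / card Q) *\<^sub>R (case p of (a, b) \<Rightarrow> \<Sum>i\<in>J. ln (?pw a b c i)))
       \<le> (\<Sum>p\<in>Q. (1 / card Q) * exp (case p of (a, b) \<Rightarrow> \<Sum>i\<in>J. ln (?pw a b c i)))"
      using Q Qne cQ0 by (intro convex_on_sum[OF _ _ exp_convex]) auto
    also have "(\<Sum>p\<in>Q. (1 / card Q) *\<^sub>R (case p of (a, b) \<Rightarrow> \<Sum>i\<in>J. ln (?pw a b c i))) = \<Phi> c / card Q"
      unfolding \<Phi>_def by (simp add: sum_divide_distrib case_prod_unfold)
    also have "(\<Sum>p\<in>Q. (1 / card Q) * exp (case p of (a, b) \<Rightarrow> \<Sum>i\<in>J. ln (?pw a b c i)))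
        = (\<Sum>(a, b)\<in>Q. (1 / card Q) * (\<Prod>i\<in>J. ?pw a b c i))"
      using J pw_pos by (intro sum.cong) (auto simp: exp_sum)
    finally show "exp (\<Phi> c / card Q) \<le> (\<Sum>(a, b)\<in>Q. (1 / card Q) * (\<Prod>i\<in>J. ?pw a b c i))" .
  qed
  also have "\<dots> = (\<Sum>(a, b)\<in>Q. (1 / card Q) * (\<Sum>c\<in>C. \<Prod>i\<in>J. ?pw a b c i))"
    by (subst sum.swap) (simp add: case_prod_unfold sum_distrib_left)
  also have "\<dots> \<le> (\<Sum>(a, b)\<in>Q. (1 / card Q) * real (card C))"
    unfolding case_prod_unfold C_def
    by (intro sum_mono mult_left_mono sum_labels_pair_weight_le I k x) (auto simp: Q_def)
  also have "\<dots> = card C" using cQ0 by simp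
  finally show ?thesis by (simp add: exp_minus field_simps)
qed

section \<open>Leaving one point out, and measurability\<close>

text \<open>Training on a different label multiplies the score of \<open>t\<close> by 1 - h and
  every other score by no less before adding a nonnegative term, so a class that beat
  \<open>t\<close> still does. At leverage 1 the scores are the one-hot label itself.\<close>

lemma err_leave_one_out_imp_not_pred:
  fixes T :: "nat \<Rightarrow> (real^'d) \<times> nat"
  assumes I: "finite I" "i \<in> I" and t: "t \<noteq> snd (T i)" "t \<in> {1..k}" and c: "snd (T i) \<in> {1..k}"
    and err: "t \<notin> argmax_cls k (ridge_w lam T (I - {i})) (fst (T i))"
  shows "t \<notin> pred k lam T I i"
proof
  assume pred: "t \<in> pred k lam T I i"
  let ?f = "\<lambda>j. ridge_w lam T I j \<bullet> fst (T i)" and ?g = "\<lambda>j. ridge_w lam T (I - {i}) j \<bullet> fst (T i)"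
  obtain h where h: "h \<in> {0..1}" "\<And>j. ?f j = (1 - h) * ?g j + h * of_bool (snd (T i) = j)"
    using ridge_w_leave_one_out[OF I, of lam T] by blast
  obtain g where g: "g \<in> {1..k}" "?g g > ?g t" using err t by (auto simp: argmax_cls_def not_le)
  have le: "?f j \<le> ?f t" if "j \<in> {1..k}" for j
    using pred that by (auto simp: pred_def argmax_cls_def)
  have ft: "?f t = (1 - h) * ?g t" using h(2)[of t] t by simp
  show False
  proof (cases "h = 1")
    case True
    then show False using le[OF c] h(2)[of "snd (T i)"] ft by simp
  next
    case False
    then have "(1 - h) * ?g t < (1 - h) * ?g g" using h(1) g by (intro mult_strict_left_mono) auto
    also have "\<dots> \<le> ?f g" using h by simp
    also have "\<dots> \<le> ?f t" by (rule le[OF g(1)])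
    finally show False using ft by simp
  qed
qed

section \<open>Measurability of ridge solutions and their errors\<close>

lemma borel_measurable_vec_nth':
  fixes v :: "'a \<Rightarrow> real^'d"
  assumes "v \<in> borel_measurable \<Omega>"
  shows "(\<lambda>w. v w $ a) \<in> borel_measurable \<Omega>"
proof -
  have "(\<lambda>w. v w \<bullet> axis a 1) \<in> borel_measurable \<Omega>" using assms by measurable
  then show ?thesis by (simp add: inner_axis)
qed

lemma borel_measurable_vecI:
  fixes v :: "'a \<Rightarrow> real^'d"
  assumes "\<And>a. (\<lambda>w. v w $ a) \<in> borel_measurable \<Omega>"
  shows "v \<in> borel_measurable \<Omega>"
  using assms by (subst borel_measurable_euclidean_space) (auto simp: Basis_vec_def inner_axis)

lemma borel_measurable_det:
  fixes A :: "'a \<Rightarrow> real^'d^'d"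
  assumes "\<And>a b. (\<lambda>w. A w $ a $ b) \<in> borel_measurable \<Omega>"
  shows "(\<lambda>w. det (A w)) \<in> borel_measurable \<Omega>"
  unfolding det_def using assms by measurable

context
  fixes \<Omega> :: "'a measure" and X :: "'a \<Rightarrow> nat \<Rightarrow> (real^'d) \<times> nat" and J :: "nat set"
  assumes J: "finite J"
    and X1: "\<And>l. l \<in> J \<Longrightarrow> (\<lambda>w. fst (X w l)) \<in> borel_measurable \<Omega>"
    and X2: "\<And>l. l \<in> J \<Longrightarrow> (\<lambda>w. snd (X w l)) \<in> measurable \<Omega> (count_space UNIV)"
begin

lemma borel_measurable_Xty: "(\<lambda>w. Xty (X w) J j) \<in> borel_measurable \<Omega>"
  unfolding Xty_def using X1 X2 by measurable

lemma borel_measurable_gram: "(\<lambda>w. gram (X w) J $ a $ b) \<in> borel_measurable \<Omega>"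
proof -
  have "(\<lambda>w. \<Sum>l\<in>J. fst (X w l) $ a * fst (X w l) $ b) \<in> borel_measurable \<Omega>"
    using borel_measurable_vec_nth'[OF X1] by measurable
  then show ?thesis by (simp add: gram_def outer_vec_def)
qed

text \<open>Cramer's rule: the coordinates are quotients of determinants, which are polynomials in
  measurable entries.\<close>

lemma borel_measurable_ridge_sol:
  assumes "mu > 0"
  shows "(\<lambda>w. ridge_sol mu (X w) J (Xty (X w) J j)) \<in> borel_measurable \<Omega>"
proof -
  let ?A = "\<lambda>w. gram (X w) J + mu *\<^sub>R mat 1" and ?b = "\<lambda>w. Xty (X w) J j"
  have A: "(\<lambda>w. ?A w $ a $ b) \<in> borel_measurable \<Omega>" for a b
    using borel_measurable_gram by simp
  have b: "(\<lambda>w. ?b w $ a) \<in> borel_measurable \<Omega>" for a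
    by (rule borel_measurable_vec_nth'[OF borel_measurable_Xty])
  have "ridge_sol mu (X w) J (?b w)
      = (\<chi> r. det (\<chi> a b. if b = r then ?b w $ a else ?A w $ a $ b) / det (?A w))" for w
    by (rule cramer[THEN iffD1, OF _ ridge_sol_normal_eq[OF assms]])
       (use invertible_reg_gram[OF assms, of "X w" J] in \<open>simp add: invertible_det_nz\<close>)
  then have "(\<lambda>w. ridge_sol mu (X w) J (?b w) $ r) =
      (\<lambda>w. det (\<chi> a b. if b = r then ?b w $ a else ?A w $ a $ b) / det (?A w))" for r
    by (simp add: fun_eq_iff)
  moreover have "(\<lambda>w. det (\<chi> a b. if b = r then ?b w $ a else ?A w $ a $ b)) \<in> borel_measurable \<Omega>" for r
  proof (rule borel_measurable_det)
    fix a b'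
    show "(\<lambda>w. (\<chi> a b. if b = r then ?b w $ a else ?A w $ a $ b) $ a $ b') \<in> borel_measurable \<Omega>"
      using A[of a b'] b[of a] by (cases "b' = r") simp_all
  qed
  moreover have "(\<lambda>w. det (?A w)) \<in> borel_measurable \<Omega>"
    by (rule borel_measurable_det) (rule A)
  ultimately show ?thesis by (intro borel_measurable_vecI) simp
qed

lemma borel_measurable_ridge_w: "(\<lambda>w. ridge_w lam (X w) J j) \<in> borel_measurable \<Omega>"
  by (rule borel_measurable_LIMSEQ_metric[OF borel_measurable_ridge_sol[OF mu_seq_pos[of lam]]])
     (rule ridge_w_tendsto[OF J])

lemma borel_measurable_err01:
  assumes Y1: "(\<lambda>w. fst (Y w)) \<in> borel_measurable \<Omega>"
    and Y2: "(\<lambda>w. snd (Y w)) \<in> measurable \<Omega> (count_space UNIV)"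
  shows "(\<lambda>w. err01 k (ridge_w lam (X w) J) (Y w)) \<in> borel_measurable \<Omega>"
proof -
  have [measurable]: "(\<lambda>w. ridge_w lam (X w) J j) \<in> borel_measurable \<Omega>" for j
    by (rule borel_measurable_ridge_w)
  note [measurable] = Y1 Y2
  have eq: "err01 k (ridge_w lam (X w) J) (Y w) = (if \<exists>j\<in>{1..k}. snd (Y w) = j \<and>
     (\<forall>l\<in>{1..k}. ridge_w lam (X w) J l \<bullet> fst (Y w) \<le> ridge_w lam (X w) J j \<bullet> fst (Y w)) then 0 else 1)" for w
    by (auto simp: err01_def argmax_cls_def)
  show ?thesis unfolding eq by measurable
qed

end

text \<open>The solution depends on the training points as a multiset. The exchange of correctly
  labelled sites and the swap of two deletions both rest on this.\<close>

lemma ridge_w_reindex: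
  assumes bij: "bij_betw \<pi> J J'" and eq: "\<And>l. l \<in> J \<Longrightarrow> T l = T' (\<pi> l)"
  shows "ridge_w lam T J = ridge_w lam T' J'"
proof (rule ext, rule ridge_w_cong)
  show "gram T J = gram T' J'" unfolding gram_def sum.reindex_bij_betw[OF bij, symmetric]
    by (intro sum.cong refl) (simp add: eq)
  show "Xty T J j = Xty T' J' j" for j unfolding Xty_def sum.reindex_bij_betw[OF bij, symmetric]
    by (intro sum.cong refl) (simp add: eq)
qed

text \<open>Classes start at 1, hence the offset before reduction. A uniform shift yields a uniform
  label whatever \<open>t\<close> is, so the shift can be drawn independently of the true
  label.\<close>

definition shift_label :: "nat \<Rightarrow> nat \<Rightarrow> nat \<Rightarrow> nat" where
  "shift_label k t r = 1 + (t - 1 + r) mod k"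

lemma shift_label_range: "0 < k \<Longrightarrow> shift_label k t r \<in> {1..k}"
  by (simp add: shift_label_def Suc_leI)

lemma mod_less_double: "a < 2 * k \<Longrightarrow> a mod k = (if a < k then a else a - k)" for a k :: nat
  by (cases "a < k") (simp_all add: le_mod_geq)

lemma shift_label_eq_iff:
  assumes "t \<in> {1..k}" "r < k"
  shows "shift_label k t r = t \<longleftrightarrow> r = 0"
proof -
  have "(t - 1 + r) mod k = (if t - 1 + r < k then t - 1 + r else t - 1 + r - k)"
    using assms by (intro mod_less_double) auto
  then show ?thesis using assms by (auto simp: shift_label_def)
qed

lemma inj_on_shift_label: "inj_on (shift_label k t) {..<k}"
proof (rule inj_onI)
  fix r r' assume rs: "r \<in> {..<k}" "r' \<in> {..<k}" and "shift_label k t r = shift_label k t r'"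
  then have eq: "((t - 1) mod k + r) mod k = ((t - 1) mod k + r') mod k" by (simp add: shift_label_def mod_add_left_eq)
  have "(t - 1) mod k < k" using rs by (intro mod_less_divisor) auto
  with eq show "r = r'" using rs by (auto simp: mod_less_double split: if_splits)
qed

lemma sum_of_bool_card: "finite A \<Longrightarrow> (\<Sum>x\<in>A. of_bool (P x)) = real (card {x \<in> A. P x})"
  by (simp add: of_bool_def sum.If_cases Int_def)

section \<open>Numerical estimates for the tolerance and the threshold\<close>

lemma fit_deficit_le:
  fixes R B F K M L \<tau> t g :: real
  assumes R: "0 \<le> R" "R \<le> 1" and B: "0 \<le> B" and K: "1 < K" and M: "0 < M" and \<tau>: "0 < \<tau>" and t: "t = 2 * K * \<tau>" "t \<le> 2"
    and L: "L = 2 * M * \<tau>\<^sup>2" and good: "(1 - t / 4) * B \<le> (K - 1) * (1 + t / 4) * F + K * (K - 1) * L / t"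
    and g: "R - K / (K - 1) / M * B \<le> g"
  shows "R - K / M * F \<le> t + (1 - t / 2) * g"
proof -
  define b where "b = K / (K - 1) / M * B"
  define f where "f = K / M * F"
  have t0: "0 < t" using t K \<tau> by simp
  have b0: "0 \<le> b" using B K M by (simp add: b_def)
  have "K / (K - 1) / M * ((1 - t / 4) * B) \<le> K / (K - 1) / M * ((K - 1) * (1 + t / 4) * F + K * (K - 1) * L / t)"
    using good K M by (intro mult_left_mono) auto
  also have "\<dots> = (1 + t / 4) * f + K * (K * L / (t * M))"
    using K M t0 by (simp add: f_def field_simps)
  \<comment> \<open>The choice t = 2K\<tau>, L = 2M\<tau>^2 makes the additive error t/2, of the
    same size as the loss from the factor 1 - t/2.\<close>
  also have "K * (K * L / (t * M)) = t / 2"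
    using K M \<tau> unfolding t L by (simp add: power2_eq_square field_simps)
  finally have 1: "(1 - t / 4) * b \<le> (1 + t / 4) * f + t / 2" by (simp add: b_def mult_ac)
  have "(1 + t / 4) * ((1 - t / 2) * b - t / 2) \<le> (1 - t / 4) * b - t / 2"
    using b0 t0 by (simp add: algebra_simps)
  then have "(1 + t / 4) * ((1 - t / 2) * b - t / 2) \<le> (1 + t / 4) * f" using 1 by linarith
  then have f: "(1 - t / 2) * b - t / 2 \<le> f" using t0 by (simp add: mult_le_cancel_left)
  have "(1 - t / 2) * (R - b) \<le> (1 - t / 2) * g" using g t by (intro mult_left_mono) (auto simp: b_def)
  moreover have "R - (1 - t / 2) * R \<le> t / 2" using mult_left_mono[OF R(2), of "t / 2"] t0 by (simp add: algebra_simps)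
  ultimately show ?thesis using f unfolding f_def[symmetric] right_diff_distrib by linarith
qed

lemma sqrt_times_pred_ge:
  assumes "2 \<le> (K :: real)"
  shows "K - 3 / 5 \<le> sqrt (K * (K - 1))"
  by (rule real_le_rsqrt) (use assms in \<open>simp add: power2_eq_square algebra_simps\<close>)

text \<open>\<theta> is what the claimed bound leaves after the tolerance 2K\<tau>. The factor 4/3
  keeps Chebyshev within three quarters of the failure probability; 173/100 is a lower bound for
  sqrt 3.\<close>

lemma threshold_square_ge:
  fixes K X \<tau> :: real
  assumes K: "3 \<le> K" and X: "0 < X" and \<tau>: "0 \<le> \<tau>" "\<tau> \<le> 5 / 6 * X"
  defines "\<theta> \<equiv> (sqrt K - K) * \<tau> + 2 * sqrt (K * (K - 1)) * X"
  shows "0 < \<theta>" and "4 / 3 * (3 * K + 1) * X\<^sup>2 \<le> \<theta>\<^sup>2"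
proof -
  have s: "173 / 100 \<le> sqrt K" by (rule real_le_rsqrt) (use K in \<open>simp add: power2_eq_square\<close>)
  have "sqrt K \<le> K" using K real_le_lsqrt[of K K] by (simp add: power2_eq_square)
  then have "(K - sqrt K) * \<tau> \<le> (K - sqrt K) * (5 / 6 * X)" using \<tau> by (intro mult_left_mono) auto
  also have "\<dots> \<le> (K - 173 / 100) * (5 / 6 * X)" using s X by (intro mult_right_mono) auto
  finally have 1: "(K - sqrt K) * \<tau> \<le> (K - 173 / 100) * (5 / 6 * X)" .
  have "2 * (K - 3 / 5) * X \<le> 2 * sqrt (K * (K - 1)) * X"
    using sqrt_times_pred_ge[of K] K X by (intro mult_right_mono) auto
  with 1 have \<theta>: "(7 / 6 * K + 24 / 100) * X \<le> \<theta>" using X unfolding \<theta>_def by (simp add: algebra_simps)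
  have pos: "0 < (7 / 6 * K + 24 / 100) * X" using K X by simp
  with \<theta> show "0 < \<theta>" by linarith
  have "3 * K \<le> K * K" using K by simp
  moreover have "(7 / 6 * K + 24 / 100)\<^sup>2 = 49 / 36 * (K * K) + 14 / 25 * K + 36 / 625"
    by (simp add: power2_eq_square field_simps)
  ultimately have "4 / 3 * (3 * K + 1) \<le> (7 / 6 * K + 24 / 100)\<^sup>2" using K by argo
  then have "4 / 3 * (3 * K + 1) * X\<^sup>2 \<le> ((7 / 6 * K + 24 / 100) * X)\<^sup>2"
    unfolding power_mult_distrib by (intro mult_right_mono) auto
  also have "\<dots> \<le> \<theta>\<^sup>2" using \<theta> pos by (intro power_mono) auto
  finally show "4 / 3 * (3 * K + 1) * X\<^sup>2 \<le> \<theta>\<^sup>2" .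
qed

text \<open>The logarithm of 1/d is at most 1/d - 1, which leaves a convex combination of ln 4 and
  1; both are at most 25/18 since ln 2 \<le> 25/36. This is the origin of the 5/6 in
  \<open>threshold_square_ge\<close>.\<close>

lemma times_ln_four_over_le:
  assumes "0 < d" "d \<le> (1 :: real)"
  shows "d * ln (4 / d) \<le> 25 / 18"
proof -
  have "ln (1 / d) \<le> 1 / d - 1" using assms by (intro ln_le_minus_one) auto
  then have "d * ln (1 / d) \<le> d * (1 / d - 1)" using assms by (intro mult_left_mono) auto
  then have 1: "d * ln (1 / d) \<le> 1 - d" using assms by (simp add: algebra_simps)
  have l4: "ln 4 = 2 * ln (2 :: real)" using ln_realpow[of "2 :: real" 2] by simp
  have l2: "1 / 2 \<le> ln (2 :: real)" using ln2_ge_two_thirds by simp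
  have "ln (4 / d) = ln 4 + ln (1 / d)" using assms by (simp add: ln_div)
  then have "d * ln (4 / d) \<le> d * ln 4 + (1 - d) * 1" using 1 by (simp add: algebra_simps)
  also have "\<dots> \<le> d * ln 4 + (1 - d) * ln 4" using l2 l4 assms by (intro add_left_mono mult_left_mono) auto
  also have "\<dots> \<le> 25 / 18" using l4 ln2_le_25_over_36 by (simp add: algebra_simps)
  finally show ?thesis .
qed

section \<open>Samples as true labels with random shifts\<close>

lemma integral_pair_uniform_count_left:
  fixes h :: "'c \<times> 'a \<Rightarrow> real"
  assumes M: "prob_space M" and C: "finite C" "C \<noteq> {}"
    and h: "h \<in> borel_measurable (uniform_count_measure C \<Otimes>\<^sub>M M)"
    and bound: "\<And>p. p \<in> space (uniform_count_measure C \<Otimes>\<^sub>M M) \<Longrightarrow> \<bar>h p\<bar> \<le> B"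
  shows "integral\<^sup>L (uniform_count_measure C \<Otimes>\<^sub>M M) h = (\<Sum>c\<in>C. \<integral>z. h (c, z) \<partial>M) / card C"
proof -
  interpret U: prob_space "uniform_count_measure C" by (rule prob_space_uniform_count_measure[OF C])
  interpret M: prob_space M by fact
  interpret P: pair_prob_space "uniform_count_measure C" M ..
  have "integrable (uniform_count_measure C \<Otimes>\<^sub>M M) h"
    by (rule P.integrable_const_bound[where B = B]) (use h bound in auto)
  from P.integral_fst'[OF this] show ?thesis
    by (simp add: integral_uniform_count_measure[OF C(1)])
qed

text \<open>Every site, noisy ones included, carries a draw of \<open>D\<close> with its true label;
  random labels are drawn separately.\<close>

definition latent_dist :: "nat \<Rightarrow> ((real^'d) \<times> nat) measure \<Rightarrow> (nat \<Rightarrow> (real^'d) \<times> nat) measure" where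
  "latent_dist N D = (\<Pi>\<^sub>M l\<in>{..<N}. D)"

definition labelled :: "nat \<Rightarrow> nat \<Rightarrow> (nat \<Rightarrow> (real^'d) \<times> nat) \<Rightarrow> (nat \<Rightarrow> nat) \<Rightarrow> nat \<Rightarrow> (real^'d) \<times> nat" where
  "labelled n m z c = (\<lambda>l\<in>{..<n+m}. if l < n then z l else (fst (z l), c l))"

locale noisy_sample =
  fixes D :: "((real^'d) \<times> nat) measure" and k n m :: nat
  assumes D: "prob_space D" and sets_D: "sets D = sets (borel \<Otimes>\<^sub>M count_space {1..k})"
    and k: "2 \<le> k" and m: "0 < m" and mn: "m < n"
begin

sublocale D: prob_space D by (rule D)

abbreviation "\<mu> \<equiv> latent_dist (n + m) D"
abbreviation "noisy \<equiv> {n..<n+m}"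
abbreviation "CC \<equiv> noisy \<rightarrow>\<^sub>E {1..k}"
abbreviation "RR \<equiv> rand_label_dist k D"

lemma space_D: "space D = UNIV \<times> {1..k}"
  using sets_eq_imp_space_eq[OF sets_D] by (simp add: space_pair_measure)

lemma CC: "finite CC" "CC \<noteq> {}" "card CC = k ^ m"
  using k by (auto simp: card_PiE PiE_eq_empty_iff intro!: finite_PiE)

lemma fst_measurable_D [measurable]: "fst \<in> measurable D borel"
  using measurable_fst[of borel "count_space {1..k}"] measurable_cong_sets[OF sets_D refl] by blast

lemma snd_measurable_D [measurable]: "snd \<in> measurable D (count_space UNIV)"
proof -
  have "snd \<in> measurable D (count_space {1..k})"
    using measurable_snd[of borel "count_space {1..k}"] measurable_cong_sets[OF sets_D refl] by blast
  then show ?thesis by (rule measurable_compose) simp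
qed

lemma Pair_measurable_D:
  assumes "f \<in> borel_measurable M" "g \<in> measurable M (count_space UNIV)" "\<And>x. x \<in> space M \<Longrightarrow> g x \<in> {1..k}"
  shows "(\<lambda>x. (f x, g x)) \<in> measurable M D"
proof -
  have "g \<in> measurable M (count_space {1..k})"
    by (rule measurable_count_space_extend[OF subset_UNIV _ assms(2)]) (use assms(3) in blast)
  with assms(1) have "(\<lambda>x. (f x, g x)) \<in> measurable M (borel \<Otimes>\<^sub>M count_space {1..k})" by (rule measurable_Pair)
  then show ?thesis unfolding measurable_cong_sets[OF refl sets_D] .
qed

lemma sets_RR: "sets RR = sets D"
  unfolding rand_label_dist_def sets_D
  by (intro sets_pair_measure_cong) (simp_all only: sets_uniform_count_measure sets_count_space sets_distr)

lemma RR: "prob_space RR"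
proof -
  interpret A: prob_space "distr D borel fst" by (rule D.prob_space_distr) simp
  interpret B: prob_space "uniform_count_measure {1..k}" by (rule prob_space_uniform_count_measure) (use k in auto)
  interpret pair_prob_space "distr D borel fst" "uniform_count_measure {1..k}" ..
  show ?thesis unfolding rand_label_dist_def by unfold_locales
qed

lemma Pair_fst_measurable: "c \<in> {1..k} \<Longrightarrow> (\<lambda>q. (fst q, c)) \<in> measurable D D"
  by (rule Pair_measurable_D) auto

lemma measure_RR:
  assumes A: "A \<in> sets D"
  shows "measure RR A = (\<Sum>c\<in>{1..k}. measure D {q \<in> space D. (fst q, c) \<in> A}) / k"
proof -
  interpret X: prob_space "distr D borel fst" by (rule D.prob_space_distr) simp
  interpret B: prob_space "uniform_count_measure {1..k}" by (rule prob_space_uniform_count_measure) (use k in auto)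
  interpret P: pair_prob_space "distr D borel fst" "uniform_count_measure {1..k}" ..
  have A': "A \<in> sets RR" using A sets_RR by simp
  interpret RR: prob_space RR by (rule RR)
  have meas: "(\<lambda>x. indicator A (x, c) :: real) \<in> borel_measurable borel" if "c \<in> {1..k}" for c
  proof -
    have "(\<lambda>x. (x, c)) \<in> measurable borel D" by (rule Pair_measurable_D) (use that in auto)
    then show ?thesis using A by (intro borel_measurable_indicator') (auto dest: measurable_sets)
  qed
  have "measure RR A = integral\<^sup>L RR (indicator A)" using A' by (simp add: RR.emeasure_eq_measure)
  also have "\<dots> = (\<integral>x. (\<integral>c. indicator A (x, c) \<partial>uniform_count_measure {1..k}) \<partial>distr D borel fst)"
    unfolding rand_label_dist_def
    by (rule P.integral_fst'[symmetric]) (use A' RR.emeasure_finite[of A] in \<open>simp add: rand_label_dist_def integrable_real_indicator less_top\<close>)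
  also have "\<dots> = (\<integral>x. (\<Sum>c\<in>{1..k}. indicator A (x, c)) / k \<partial>distr D borel fst)"
    by (simp add: integral_uniform_count_measure)
  also have "\<dots> = (\<integral>q. (\<Sum>c\<in>{1..k}. indicator A (fst q, c)) / k \<partial>D)"
    using meas by (intro integral_distr) auto
  also have "\<dots> = (\<Sum>c\<in>{1..k}. \<integral>q. indicator A (fst q, c) \<partial>D) / k"
    using measurable_compose[OF fst_measurable_D meas]
    by (subst Bochner_Integration.integral_divide_zero, subst Bochner_Integration.integral_sum)
       (auto intro!: D.integrable_const_bound[where B = 1] simp: indicator_def)
  also have "(\<lambda>c. \<integral>q. indicator A (fst q, c) \<partial>D) = (\<lambda>c. \<integral>q. indicator {q \<in> space D. (fst q, c) \<in> A} q \<partial>D)"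
    by (intro ext Bochner_Integration.integral_cong) (auto simp: indicator_def)
  also have "(\<Sum>c\<in>{1..k}. \<integral>q. indicator {q \<in> space D. (fst q, c) \<in> A} q \<partial>D)
      = (\<Sum>c\<in>{1..k}. measure D {q \<in> space D. (fst q, c) \<in> A})"
    by (intro sum.cong refl, subst Bochner_Integration.integral_indicator) (auto intro!: arg_cong[where f = D.prob])
  finally show ?thesis .
qed

lemma sets_sample: "sets (sample_dist k n m D) = sets \<mu>"
  unfolding sample_dist_def latent_dist_def by (intro sets_PiM_cong) (auto simp: sets_RR)

sublocale \<mu>: prob_space \<mu>
  unfolding latent_dist_def by (intro prob_space_PiM) (rule D)

lemma component_measurable [measurable]: "l < n + m \<Longrightarrow> (\<lambda>z. z l) \<in> measurable \<mu> D"
  unfolding latent_dist_def by (rule measurable_component_singleton) simp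

lemma space_\<mu>_D: "z \<in> space \<mu> \<Longrightarrow> l < n + m \<Longrightarrow> z l \<in> UNIV \<times> {1..k}"
  using measurable_space[OF component_measurable, of l z] space_D by auto

lemma measurable_labelled: "c \<in> CC \<Longrightarrow> (\<lambda>z. labelled n m z c) \<in> measurable \<mu> \<mu>"
proof -
  assume c: "c \<in> CC"
  have "(\<lambda>z. if l < n then z l else (fst (z l), c l)) \<in> measurable \<mu> D" if "l < n + m" for l
  proof (cases "l < n")
    case False
    then have "c l \<in> {1..k}" using c that by auto
    from measurable_compose[OF component_measurable[OF that] Pair_fst_measurable[OF this]]
    show ?thesis using False by simp
  qed (use that in simp)
  then show ?thesis
    unfolding labelled_def by (subst (2) latent_dist_def) (intro measurable_restrict; simp)
qed

lemma measurable_labelled_pair: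
  "(\<lambda>p. labelled n m (snd p) (fst p)) \<in> measurable (uniform_count_measure CC \<Otimes>\<^sub>M \<mu>) \<mu>"
proof -
  have "(\<lambda>p. labelled n m (snd p) (fst p)) \<in> measurable (count_space CC \<Otimes>\<^sub>M \<mu>) \<mu>"
    by (rule measurable_pair_measure_countable1) (use CC measurable_labelled in \<open>auto intro: countable_finite\<close>)
  moreover have "sets (uniform_count_measure CC \<Otimes>\<^sub>M \<mu>) = sets (count_space CC \<Otimes>\<^sub>M \<mu>)"
    by (intro sets_pair_measure_cong) (simp_all only: sets_uniform_count_measure sets_count_space)
  ultimately show ?thesis using measurable_cong_sets by blast
qed

text \<open>Checked on measurable boxes: for fixed labels the preimage is a box of latent points,
  and a sum of products over all label functions is a product of sums.\<close>

lemma sample_dist_eq_distr: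
  "sample_dist k n m D = distr (uniform_count_measure CC \<Otimes>\<^sub>M \<mu>) \<mu> (\<lambda>p. labelled n m (snd p) (fst p))"
proof -
  let ?M = "\<lambda>l. if l < n then D else RR"
  let ?P = "uniform_count_measure CC \<Otimes>\<^sub>M \<mu>"
  interpret U: prob_space "uniform_count_measure CC" by (rule prob_space_uniform_count_measure[OF CC(1,2)])
  interpret P: pair_prob_space "uniform_count_measure CC" \<mu> ..
  interpret M: product_prob_space ?M "{..<n+m}"
    by (intro product_prob_spaceI) (use D RR in auto)
  have "distr ?P \<mu> (\<lambda>p. labelled n m (snd p) (fst p)) = PiM {..<n+m} ?M"
  proof (rule M.PiM_eqI)
    fix A assume A: "\<And>l. l \<in> {..<n+m} \<Longrightarrow> A l \<in> sets (?M l)"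
    then have A': "A l \<in> sets D" if "l < n + m" for l using that sets_RR by (cases "l < n") fastforce+
    define B where "B c l = (if l < n then A l else {q \<in> space D. (fst q, c) \<in> A l})" for c l
    have B: "B c l \<in> sets D" if "l < n + m" "l < n \<or> c \<in> {1..k}" for c l
    proof (cases "l < n")
      case False
      then show ?thesis using measurable_sets[OF Pair_fst_measurable A'[OF that(1)], of c] that
        by (auto simp: B_def vimage_def Int_def conj_commute)
    qed (use that A' in \<open>simp add: B_def\<close>)
    have "Pi\<^sub>E {..<n+m} A \<in> sets \<mu>" unfolding latent_dist_def by (intro sets_PiM_I_finite) (use A' in auto)
    then have "emeasure (distr ?P \<mu> (\<lambda>p. labelled n m (snd p) (fst p))) (Pi\<^sub>E {..<n+m} A)
       = ennreal (measure ?P ((\<lambda>p. labelled n m (snd p) (fst p)) -` Pi\<^sub>E {..<n+m} A \<inter> space ?P))" (is "_ = ennreal (measure ?P ?Y)")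
      by (subst emeasure_distr[OF measurable_labelled_pair]) (assumption, rule P.emeasure_eq_measure)
    also have "measure ?P ?Y = integral\<^sup>L ?P (indicator ?Y)"
      using \<open>Pi\<^sub>E {..<n+m} A \<in> sets \<mu>\<close> measurable_sets[OF measurable_labelled_pair] by (simp add: P.emeasure_eq_measure)
    also have "\<dots> = (\<Sum>c\<in>CC. \<integral>z. indicator ?Y (c, z) \<partial>\<mu>) / card CC"
      by (rule integral_pair_uniform_count_left[where B = 1])
         (use \<open>Pi\<^sub>E {..<n+m} A \<in> sets \<mu>\<close> measurable_sets[OF measurable_labelled_pair] CC \<mu>.prob_space_axioms
           in \<open>auto simp: indicator_def\<close>)
    also have "(\<Sum>c\<in>CC. \<integral>z. indicator ?Y (c, z) \<partial>\<mu>) = (\<Sum>c\<in>CC. \<Prod>l<n+m. measure D (B (c l) l))"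
    proof (intro sum.cong refl)
      fix c assume c: "c \<in> CC"
      have Bs: "B (c l) l \<in> sets D" if "l < n + m" for l using c that by (intro B) (auto simp: PiE_def Pi_def)
      have "(\<integral>z. indicator ?Y (c, z) \<partial>\<mu>) = (\<integral>z. (indicator :: _ \<Rightarrow> _ \<Rightarrow> real) (Pi\<^sub>E {..<n+m} (\<lambda>l. B (c l) l)) z \<partial>\<mu>)"
      proof (intro Bochner_Integration.integral_cong refl)
        fix z assume z: "z \<in> space \<mu>"
        have "z l \<in> space D" if "l < n + m" for l
          using space_\<mu>_D[OF z that] space_D by auto
        moreover have "z \<in> extensional {..<n+m}" using z by (auto simp: latent_dist_def space_PiM PiE_def)
        moreover have "(c, z) \<in> space ?P"
          using c z by (simp only: space_pair_measure space_uniform_count_measure mem_Times_iff fst_conv snd_conv)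
        ultimately have "(c, z) \<in> ?Y \<longleftrightarrow> z \<in> Pi\<^sub>E {..<n+m} (\<lambda>l. B (c l) l)"
          by (auto simp: labelled_def PiE_iff B_def split: if_splits)
        then show "indicator ?Y (c, z) = (indicator (Pi\<^sub>E {..<n+m} (\<lambda>l. B (c l) l)) z :: real)"
          by (simp add: indicator_def)
      qed
      also have "\<dots> = measure \<mu> (Pi\<^sub>E {..<n+m} (\<lambda>l. B (c l) l))"
        using Bs by (subst Bochner_Integration.integral_indicator) (auto simp: latent_dist_def sets_PiM_I_finite)
      also have "\<dots> = (\<Prod>l<n+m. measure D (B (c l) l))"
      proof -
        interpret DD: product_prob_space "\<lambda>_. D" "{..<n+m}" by (intro product_prob_spaceI D)
        interpret DDf: finite_product_prob_space "\<lambda>_. D" "{..<n+m}" by standard simp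
        show ?thesis unfolding latent_dist_def using Bs by (intro DDf.finite_measure_PiM_emb) auto
      qed
      finally show "(\<integral>z. indicator ?Y (c, z) \<partial>\<mu>) = (\<Prod>l<n+m. measure D (B (c l) l))" .
    qed
    also have "\<dots> / card CC = (\<Prod>l<n+m. measure (?M l) (A l))"
    proof -
      have split: "(\<Prod>l<n+m. f l) = (\<Prod>l<n. f l) * (\<Prod>l\<in>noisy. f l)" for f :: "nat \<Rightarrow> real"
        by (subst prod.union_disjoint[symmetric]) (auto intro!: prod.cong)
      have "(\<Sum>c\<in>CC. \<Prod>l<n+m. measure D (B (c l) l))
          = (\<Prod>l<n. measure D (A l)) * (\<Sum>c\<in>CC. \<Prod>l\<in>noisy. measure D (B (c l) l))"
        unfolding split sum_distrib_left by (intro sum.cong) (auto simp: B_def)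
      also have "(\<Sum>c\<in>CC. \<Prod>l\<in>noisy. measure D (B (c l) l)) = (\<Prod>l\<in>noisy. \<Sum>c\<in>{1..k}. measure D (B c l))"
        by (rule prod_sum_PiE[symmetric]) auto
      also have "\<dots> = (\<Prod>l\<in>noisy. k * measure RR (A l))"
        using measure_RR[OF A'] k by (intro prod.cong) (auto simp: B_def)
      also have "\<dots> = k ^ m * (\<Prod>l\<in>noisy. measure RR (A l))" by (simp add: prod.distrib)
      finally show ?thesis using k unfolding split CC(3) by simp
    qed
    also have "ennreal \<dots> = (\<Prod>l<n+m. ennreal (measure (?M l) (A l)))" by (simp add: prod_ennreal)
    also have "\<dots> = (\<Prod>l<n+m. emeasure (?M l) (A l))"
      by (intro prod.cong refl) (use D.emeasure_eq_measure finite_measure.emeasure_eq_measure[OF prob_space.finite_measure[OF RR]] in auto)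
    finally show "emeasure (distr ?P \<mu> (\<lambda>p. labelled n m (snd p) (fst p))) (Pi\<^sub>E {..<n+m} A)
       = (\<Prod>l<n+m. emeasure (?M l) (A l))" .
  qed (use sets_sample in \<open>auto simp: sample_dist_def\<close>)
  then show ?thesis unfolding sample_dist_def by simp
qed

lemma integral_sample_dist:
  fixes h :: "(nat \<Rightarrow> (real^'d) \<times> nat) \<Rightarrow> real"
  assumes h: "h \<in> borel_measurable \<mu>" and bound: "\<And>T. T \<in> space \<mu> \<Longrightarrow> \<bar>h T\<bar> \<le> B"
  shows "integral\<^sup>L (sample_dist k n m D) h = (\<Sum>c\<in>CC. \<integral>z. h (labelled n m z c) \<partial>\<mu>) / k ^ m"
proof -
  have "integral\<^sup>L (sample_dist k n m D) h
      = (\<integral>p. h (labelled n m (snd p) (fst p)) \<partial>(uniform_count_measure CC \<Otimes>\<^sub>M \<mu>))"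
    unfolding sample_dist_eq_distr by (rule integral_distr[OF measurable_labelled_pair h])
  also have "\<dots> = (\<Sum>c\<in>CC. \<integral>z. h (labelled n m z c) \<partial>\<mu>) / card CC"
    using integral_pair_uniform_count_left[OF \<mu>.prob_space_axioms CC(1,2) measurable_compose[OF measurable_labelled_pair h], of B]
      bound measurable_space[OF measurable_labelled_pair] by simp
  finally show ?thesis unfolding CC(3) by simp
qed

section \<open>Uniform shifts and expectations over them\<close>

abbreviation "SS \<equiv> noisy \<rightarrow>\<^sub>E {..<k}"

definition shifted :: "(nat \<Rightarrow> (real^'d) \<times> nat) \<Rightarrow> (nat \<Rightarrow> nat) \<Rightarrow> nat \<Rightarrow> (real^'d) \<times> nat" where
  "shifted z s = labelled n m z (\<lambda>l. shift_label k (snd (z l)) (s l))"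

lemma shifted_apply: "l < n + m \<Longrightarrow> shifted z s l = (if l < n then z l else (fst (z l), shift_label k (snd (z l)) (s l)))"
  by (simp add: shifted_def labelled_def)

lemma SS: "finite SS" "SS \<noteq> {}" "card SS = k ^ m"
  using k by (auto simp: card_PiE PiE_eq_empty_iff lessThan_empty_iff intro!: finite_PiE)

text \<open>As \<open>t\<close> is arbitrary, uniform shifts and uniform labels agree for every
  fixed latent sample.\<close>

lemma bij_betw_shift:
  "bij_betw (\<lambda>s. \<lambda>l\<in>noisy. shift_label k (t l) (s l)) SS CC"
proof -
  let ?g = "\<lambda>s. \<lambda>l\<in>noisy. shift_label k (t l) (s l)"
  have inj: "inj_on ?g SS"
  proof (rule inj_onI, rule PiE_ext)
    fix s s' l assume s: "s \<in> SS" "s' \<in> SS" and eq: "?g s = ?g s'" and l: "l \<in> noisy"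
    have "shift_label k (t l) (s l) = shift_label k (t l) (s' l)"
      using fun_cong[OF eq, of l] l by (simp only: restrict_apply if_True)
    then show "s l = s' l"
      using inj_onD[OF inj_on_shift_label[of k "t l"]] PiE_mem[OF s(1) l] PiE_mem[OF s(2) l] by blast
  qed assumption+
  moreover have sub: "?g ` SS \<subseteq> CC"
    by (intro image_subsetI) (use shift_label_range[of k] k in \<open>simp add: restrict_PiE_iff\<close>)
  moreover have "?g ` SS = CC"
    by (rule card_subset_eq[OF CC(1) sub]) (simp only: card_image[OF inj] SS(3) CC(3))
  ultimately show ?thesis by (simp add: bij_betw_def)
qed

text \<open>Expectation over a latent sample \<open>z\<close> with true labels and uniform shifts \<open>s\<close>, of which \<open>shifted\<close> makes
  the training set; \<open>s i = 0\<close> means that the random label of site \<open>i\<close> happens to be the true one.\<close>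
definition EE :: "((nat \<Rightarrow> (real^'d) \<times> nat) \<Rightarrow> (nat \<Rightarrow> nat) \<Rightarrow> real) \<Rightarrow> real" where
  "EE F = (\<Sum>s\<in>SS. \<integral>z. F z s \<partial>\<mu>) / k ^ m"

text \<open>The bound is required at all arguments, also outside the sample space, so that it
  survives overwriting a coordinate by any point.\<close>

definition tame :: "((nat \<Rightarrow> (real^'d) \<times> nat) \<Rightarrow> (nat \<Rightarrow> nat) \<Rightarrow> real) \<Rightarrow> bool" where
  "tame F \<longleftrightarrow> (\<forall>s. (\<lambda>z. F z s) \<in> borel_measurable \<mu>) \<and> (\<exists>B. \<forall>z s. \<bar>F z s\<bar> \<le> B)"

lemma tameI: "(\<And>s. (\<lambda>z. F z s) \<in> borel_measurable \<mu>) \<Longrightarrow> (\<And>z s. \<bar>F z s\<bar> \<le> B) \<Longrightarrow> tame F"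
  unfolding tame_def by blast

lemma tame_measurable: "tame F \<Longrightarrow> (\<lambda>z. F z s) \<in> borel_measurable \<mu>"
  by (simp add: tame_def)

lemma tame_bound: assumes "tame F" obtains B where "\<And>z s. \<bar>F z s\<bar> \<le> B"
  using assms by (auto simp: tame_def)

lemma tame_integrable: "tame F \<Longrightarrow> integrable \<mu> (\<lambda>z. F z s)"
  by (rule tame_bound, assumption, rule \<mu>.integrable_const_bound) (auto intro: tame_measurable)

lemma tame_const: "tame (\<lambda>z s. c)"
  by (rule tameI[where B = "\<bar>c\<bar>"]) auto

lemma tame_add:
  assumes "tame F" "tame G" shows "tame (\<lambda>z s. F z s + G z s)"
proof -
  obtain A B where AB: "\<And>z s. \<bar>F z s\<bar> \<le> A" "\<And>z s. \<bar>G z s\<bar> \<le> B" using assms by (auto simp: tame_def)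
  show ?thesis
    by (rule tameI[where B = "A + B"])
       (use tame_measurable[OF assms(1)] tame_measurable[OF assms(2)] AB in \<open>auto intro!: order_trans[OF abs_triangle_ineq] add_mono borel_measurable_add\<close>)
qed

lemma tame_mult:
  assumes "tame F" "tame G" shows "tame (\<lambda>z s. F z s * G z s)"
proof -
  obtain A B where AB: "\<And>z s. \<bar>F z s\<bar> \<le> A" "\<And>z s. \<bar>G z s\<bar> \<le> B" using assms by (auto simp: tame_def)
  show ?thesis
    by (rule tameI[where B = "A * B"])
       (use tame_measurable[OF assms(1)] tame_measurable[OF assms(2)] AB order_trans[OF abs_ge_zero AB(1)] in \<open>auto simp: abs_mult intro!: mult_mono borel_measurable_times\<close>)
qed

lemma tame_cmult: "tame F \<Longrightarrow> tame (\<lambda>z s. c * F z s)"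
  by (rule tame_mult[OF tame_const])

lemma tame_diff: "tame F \<Longrightarrow> tame G \<Longrightarrow> tame (\<lambda>z s. F z s - G z s)"
  using tame_add[of F "\<lambda>z s. (-1) * G z s"] tame_cmult[of G "-1"] by simp

lemma tame_sum: "(\<And>l. l \<in> A \<Longrightarrow> tame (F l)) \<Longrightarrow> tame (\<lambda>z s. \<Sum>l\<in>A. F l z s)"
  by (induction A rule: infinite_finite_induct) (auto intro!: tame_const tame_add)

lemma EE_add: "tame F \<Longrightarrow> tame G \<Longrightarrow> EE (\<lambda>z s. F z s + G z s) = EE F + EE G"
  by (simp add: EE_def Bochner_Integration.integral_add[OF tame_integrable tame_integrable] sum.distrib add_divide_distrib)

lemma EE_diff: "tame F \<Longrightarrow> tame G \<Longrightarrow> EE (\<lambda>z s. F z s - G z s) = EE F - EE G"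
  by (simp add: EE_def Bochner_Integration.integral_diff[OF tame_integrable tame_integrable] sum_subtractf diff_divide_distrib)

lemma EE_cmult: "EE (\<lambda>z s. c * F z s) = c * EE F"
  by (simp add: EE_def sum_distrib_left[symmetric])

lemma EE_const: "EE (\<lambda>z s. c) = c"
  using k by (simp add: EE_def \<mu>.prob_space SS(3))

lemma EE_sum: "(\<And>l. l \<in> A \<Longrightarrow> tame (F l)) \<Longrightarrow> EE (\<lambda>z s. \<Sum>l\<in>A. F l z s) = (\<Sum>l\<in>A. EE (F l))"
  by (induction A rule: infinite_finite_induct) (auto simp: EE_const EE_add tame_sum)

lemma EE_mono:
  assumes "tame F" "tame G" "\<And>z s. z \<in> space \<mu> \<Longrightarrow> s \<in> SS \<Longrightarrow> F z s \<le> G z s"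
  shows "EE F \<le> EE G"
  unfolding EE_def
  by (intro divide_right_mono sum_mono integral_mono tame_integrable[OF assms(1)] tame_integrable[OF assms(2)] assms(3)) simp_all

lemma EE_cong:
  assumes "\<And>z s. z \<in> space \<mu> \<Longrightarrow> s \<in> SS \<Longrightarrow> F z s = G z s"
  shows "EE F = EE G"
  unfolding EE_def using assms by (intro arg_cong2[where f = "(/)"] sum.cong Bochner_Integration.integral_cong) auto

lemma measurable_shifted: "(\<lambda>z. shifted z s) \<in> measurable \<mu> \<mu>"
proof -
  have "(\<lambda>z. if l < n then z l else (fst (z l), shift_label k (snd (z l)) (s l))) \<in> measurable \<mu> D" if "l < n + m" for l
  proof (cases "l < n")
    case False
    have "(\<lambda>q. (fst q, shift_label k (snd q) (s l))) \<in> measurable D D"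
      by (rule Pair_measurable_D[OF fst_measurable_D measurable_compose[OF snd_measurable_D]])
         (use k shift_label_range[of k] in auto)
    from measurable_compose[OF component_measurable[OF that] this] show ?thesis using False by simp
  qed (use that in simp)
  then show ?thesis
    unfolding shifted_def labelled_def by (subst (2) latent_dist_def) (intro measurable_restrict; simp)
qed

lemma integral_sample_dist_EE:
  assumes h: "h \<in> borel_measurable \<mu>" and bound: "\<And>T. \<bar>h T\<bar> \<le> B"
  shows "integral\<^sup>L (sample_dist k n m D) h = EE (\<lambda>z s. h (shifted z s))"
proof -
  have int: "integrable \<mu> (\<lambda>z. h (f z))" if "f \<in> measurable \<mu> \<mu>" for f
    by (rule \<mu>.integrable_const_bound[where B = B]) (use h that bound in \<open>auto intro: measurable_compose\<close>)
  have "(\<Sum>c\<in>CC. \<integral>z. h (labelled n m z c) \<partial>\<mu>) = (\<integral>z. (\<Sum>c\<in>CC. h (labelled n m z c)) \<partial>\<mu>)"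
    by (intro Bochner_Integration.integral_sum[symmetric] int measurable_labelled)
  also have "\<dots> = (\<integral>z. (\<Sum>s\<in>SS. h (shifted z s)) \<partial>\<mu>)"
  proof (intro Bochner_Integration.integral_cong refl)
    fix z
    have "labelled n m z (\<lambda>l\<in>noisy. shift_label k (snd (z l)) (s l)) = shifted z s" for s
      by (auto simp: shifted_def labelled_def)
    then show "(\<Sum>c\<in>CC. h (labelled n m z c)) = (\<Sum>s\<in>SS. h (shifted z s))"
      using sum.reindex_bij_betw[OF bij_betw_shift, of "\<lambda>c. h (labelled n m z c)" "\<lambda>l. snd (z l)"] by simp
  qed
  also have "\<dots> = (\<Sum>s\<in>SS. \<integral>z. h (shifted z s) \<partial>\<mu>)"
    by (intro Bochner_Integration.integral_sum int measurable_shifted)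
  finally show ?thesis unfolding integral_sample_dist[OF h bound] EE_def by simp
qed

section \<open>Resampling a single site\<close>

lemma measurable_upd [measurable]:
  assumes "Z \<in> measurable \<Omega> \<mu>" "q \<in> measurable \<Omega> D" "i < n + m"
  shows "(\<lambda>\<omega>. (Z \<omega>)(i := q \<omega>)) \<in> measurable \<Omega> \<mu>"
  using assms unfolding latent_dist_def by (intro measurable_fun_upd[where J = "{..<n+m}"]) auto

lemma integral_resample:
  fixes f :: "(nat \<Rightarrow> (real^'d) \<times> nat) \<Rightarrow> real"
  assumes f: "f \<in> borel_measurable \<mu>" and bound: "\<And>z. \<bar>f z\<bar> \<le> B" and i: "i < n + m"
  shows "(\<lambda>z. \<integral>v. f (z(i := v)) \<partial>D) \<in> borel_measurable \<mu>" (is ?A)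
    and "\<bar>\<integral>v. f (z(i := v)) \<partial>D\<bar> \<le> B"
    and "integral\<^sup>L \<mu> f = (\<integral>z. (\<integral>v. f (z(i := v)) \<partial>D) \<partial>\<mu>)"
proof -
  let ?g = "\<lambda>z. \<integral>v. f (z(i := v)) \<partial>D"
  have "0 \<le> B" using bound[of undefined] by linarith
  have bd: "\<bar>?g z\<bar> \<le> B" for z
  proof (cases "integrable D (\<lambda>v. f (z(i := v)))")
    case True
    have "\<bar>?g z\<bar> \<le> (\<integral>v. \<bar>f (z(i := v))\<bar> \<partial>D)" by (rule integral_abs_bound)
    also have "\<dots> \<le> B" by (rule D.integral_le_const) (use True bound in auto)
    finally show ?thesis .
  qed (simp add: not_integrable_integral_eq \<open>0 \<le> B\<close>)
  then show "\<bar>\<integral>v. f (z(i := v)) \<partial>D\<bar> \<le> B" .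
  have [measurable]: "(\<lambda>p. f ((fst p)(i := snd p))) \<in> borel_measurable (\<mu> \<Otimes>\<^sub>M D)"
    by (rule measurable_compose[OF measurable_upd f]) (rule measurable_fst measurable_snd i)+
  show g: ?A
    by (rule D.borel_measurable_lebesgue_integral) (simp add: case_prod_beta')
  interpret P: product_sigma_finite "\<lambda>_::nat. D" by standard
  let ?I = "{..<n+m} - {i}"
  have mu: "\<mu> = Pi\<^sub>M (insert i ?I) (\<lambda>_. D)" using i by (simp add: latent_dist_def insert_absorb)
  have int: "integrable \<mu> f" "integrable \<mu> ?g"
    by (rule \<mu>.integrable_const_bound[where B = B]; use f g bound bd in simp)+
  have "integral\<^sup>L \<mu> f = (\<integral>x. ?g x \<partial>Pi\<^sub>M ?I (\<lambda>_. D))"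
    unfolding mu by (rule P.product_integral_insert) (use int in \<open>simp_all only: mu finite_Diff finite_lessThan Diff_iff singletonI simp_thms\<close>)
  \<comment> \<open>\<open>?g\<close> does not depend on coordinate \<open>i\<close>, so integrating
    it over that coordinate once more changes nothing.\<close>
  also have "\<dots> = (\<integral>x. (\<integral>y. ?g (x(i := y)) \<partial>D) \<partial>Pi\<^sub>M ?I (\<lambda>_. D))"
    by (simp add: D.prob_space)
  also have "\<dots> = integral\<^sup>L \<mu> ?g"
    unfolding mu by (rule P.product_integral_insert[symmetric]) (use int in \<open>simp_all only: mu finite_Diff finite_lessThan Diff_iff singletonI simp_thms\<close>)
  finally show "integral\<^sup>L \<mu> f = integral\<^sup>L \<mu> ?g" .
qed

text \<open>Exchanging the new value \<open>r\<close> with the old \<open>s i\<close> is an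
  involution of \<open>SS \<times> {..<k}\<close>.\<close>

lemma sum_SS_resample:
  fixes G :: "(nat \<Rightarrow> nat) \<Rightarrow> real"
  assumes "i \<in> noisy"
  shows "(\<Sum>s\<in>SS. \<Sum>r<k. G (s(i := r))) = k * (\<Sum>s\<in>SS. G s)"
proof -
  have "(\<Sum>s\<in>SS. \<Sum>r<k. G (s(i := r))) = (\<Sum>(s, r)\<in>SS \<times> {..<k}. G (s(i := r)))"
    by (rule sum.cartesian_product)
  also have "\<dots> = (\<Sum>(s, r)\<in>SS \<times> {..<k}. G s)"
    by (rule sum.reindex_bij_witness[of _ "\<lambda>(s, r). (s(i := r), s i)" "\<lambda>(s, r). (s(i := r), s i)"])
       (use assms in \<open>auto simp: PiE_iff extensional_def\<close>)
  finally show ?thesis by (simp add: sum.cartesian_product[symmetric] sum_distrib_left)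
qed

text \<open>For a noisy site, the conditional expectation given all other sites: the point and its
  shift are redrawn together.\<close>

definition resample :: "nat \<Rightarrow> ((nat \<Rightarrow> (real^'d) \<times> nat) \<Rightarrow> (nat \<Rightarrow> nat) \<Rightarrow> real) \<Rightarrow> (nat \<Rightarrow> (real^'d) \<times> nat) \<Rightarrow> (nat \<Rightarrow> nat) \<Rightarrow> real" where
  "resample i F z s = (\<Sum>r<k. \<integral>v. F (z(i := v)) (s(i := r)) \<partial>D) / k"

lemma tame_resample:
  assumes F: "tame F" and i: "i < n + m"
  shows "tame (resample i F)"
proof -
  obtain B where B: "\<And>z s. \<bar>F z s\<bar> \<le> B" using F unfolding tame_def by blast
  have "\<bar>\<Sum>r<k. \<integral>v. F (z(i := v)) (s(i := r)) \<partial>D\<bar> \<le> k * B" for z s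
    using sum_mono[of "{..<k}" "\<lambda>r. \<bar>\<integral>v. F (z(i := v)) (s(i := r)) \<partial>D\<bar>" "\<lambda>_. B"]
      integral_resample(2)[OF tame_measurable[OF F] B i] by (force intro: order_trans[OF sum_abs])
  then show ?thesis
    unfolding resample_def using k
    by (intro tameI[where B = B] borel_measurable_divide borel_measurable_sum borel_measurable_const
          integral_resample(1)[OF tame_measurable[OF F] B i]) (simp_all add: field_simps)
qed

lemma EE_resample:
  assumes F: "tame F" and i: "i \<in> noisy"
  shows "EE (resample i F) = EE F"
proof -
  obtain B where B: "\<And>z s. \<bar>F z s\<bar> \<le> B" using F unfolding tame_def by blast
  have i': "i < n + m" using i by simp
  note * = integral_resample[OF tame_measurable[OF F] B i']
  have int: "integrable \<mu> (\<lambda>z. \<integral>v. F (z(i := v)) s \<partial>D)" for s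
    by (rule \<mu>.integrable_const_bound[where B = B]) (use * in auto)
  have "(\<Sum>s\<in>SS. \<integral>z. resample i F z s \<partial>\<mu>) = (\<Sum>s\<in>SS. (\<Sum>r<k. \<integral>z. F z (s(i := r)) \<partial>\<mu>) / k)"
    unfolding resample_def by (simp add: int *(3)[symmetric])
  also have "\<dots> = (\<Sum>s\<in>SS. \<integral>z. F z s \<partial>\<mu>)"
    using sum_SS_resample[OF i, of "\<lambda>s. \<integral>z. F z s \<partial>\<mu>"] k by (simp add: sum_divide_distrib[symmetric])
  finally show ?thesis by (simp add: EE_def)
qed

lemma integral_permute:
  fixes f :: "(nat \<Rightarrow> (real^'d) \<times> nat) \<Rightarrow> real"
  assumes f: "f \<in> borel_measurable \<mu>" and p: "inj_on p {..<n+m}" "p \<in> {..<n+m} \<rightarrow> {..<n+m}"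
  shows "(\<integral>z. f (\<lambda>l\<in>{..<n+m}. z (p l)) \<partial>\<mu>) = integral\<^sup>L \<mu> f"
proof -
  have "distr \<mu> \<mu> (\<lambda>z. \<lambda>l\<in>{..<n+m}. z (p l)) = \<mu>"
    using distr_PiM_reindex[of "{..<n+m}" "\<lambda>_. D" p "{..<n+m}"] D p by (simp add: latent_dist_def)
  moreover have "(\<lambda>z. \<lambda>l\<in>{..<n+m}. z (p l)) \<in> measurable \<mu> \<mu>"
    unfolding latent_dist_def using p by (intro measurable_restrict measurable_component_singleton) auto
  ultimately show ?thesis using f integral_distr by metis
qed

end

section \<open>Second moments\<close>

locale ridge_sample = noisy_sample D k n m for D :: "((real^'d) \<times> nat) measure" and k n m +
  fixes lam beta :: real
  assumes stable: "hyp_stable k n m lam D beta"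
begin

definition er :: "nat set \<Rightarrow> (nat \<Rightarrow> (real^'d) \<times> nat) \<Rightarrow> (real^'d) \<times> nat \<Rightarrow> real" where
  "er J T q = err01 k (ridge_w lam T J) q"

definition risk :: "nat set \<Rightarrow> (nat \<Rightarrow> (real^'d) \<times> nat) \<Rightarrow> real" where
  "risk J T = (\<integral>q. er J T q \<partial>D)"

abbreviation "\<I> \<equiv> {..<n+m}"
abbreviation "but i \<equiv> {..<n+m} - {i}"
abbreviation "loss i z s \<equiv> er (but i) (shifted z s) (z i)"

definition gap :: "nat \<Rightarrow> (nat \<Rightarrow> (real^'d) \<times> nat) \<Rightarrow> real" where
  "gap i T = (\<integral>q. \<bar>er \<I> T q - er (but i) T q\<bar> \<partial>D)"

definition stab :: real where "stab = beta / real (n + m)"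

definition khat :: real where "khat = real k / (real k - 1)"

text \<open>\<open>kap (s i)\<close> is an importance weight of mean 1: since \<open>s i\<close> is independent of \<open>z i\<close>, weighting the
  leave-one-out error on the true label by it still estimates the risk.\<close>
definition kap :: "nat \<Rightarrow> real" where "kap r = (if r = 0 then 0 else khat)"

lemma er_bounds: "0 \<le> er J T q" "er J T q \<le> 1" "\<bar>er J T q\<bar> \<le> 1" "er J T q * er J T q = er J T q"
  by (auto simp: er_def err01_def)

lemma khat: "1 \<le> khat" "khat \<le> 2"
  using k by (auto simp: khat_def field_simps)

lemma kap: "0 \<le> kap r" "kap r \<le> khat" "\<bar>kap r\<bar> \<le> khat" "\<bar>kap r\<bar> \<le> 2"
  using khat by (auto simp: kap_def)

lemma sum_kap: "(\<Sum>r<k. kap r) = k" "(\<Sum>r<k. kap r * kap r) = khat * k"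
proof -
  have "(\<Sum>r<k. kap r * c (kap r)) = (\<Sum>r\<in>{..<k} - {0}. khat * c khat)" for c :: "real \<Rightarrow> real"
    by (intro sum.mono_neutral_cong_right) (auto simp: kap_def)
  moreover have "real (card ({..<k} - {0})) * khat = k"
    using k by (simp add: khat_def of_nat_diff)
  ultimately have "(\<Sum>r<k. kap r * c (kap r)) = k * c khat" for c :: "real \<Rightarrow> real"
    by (simp flip: mult.assoc)
  from this[of "\<lambda>_. 1"] this[of "\<lambda>x. x"] show "(\<Sum>r<k. kap r) = k" "(\<Sum>r<k. kap r * kap r) = khat * k"
    by simp_all
qed

lemma abs_integral_D_le:
  assumes "\<And>q. \<bar>f q\<bar> \<le> (B :: real)"
  shows "\<bar>\<integral>q. f q \<partial>D\<bar> \<le> B"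
proof (cases "integrable D f")
  case True
  have "\<bar>\<integral>q. f q \<partial>D\<bar> \<le> (\<integral>q. \<bar>f q\<bar> \<partial>D)" by (rule integral_abs_bound)
  also have "\<dots> \<le> B" by (rule D.integral_le_const) (use True assms in auto)
  finally show ?thesis .
next
  case False
  then show ?thesis using order_trans[OF abs_ge_zero assms] by (simp add: not_integrable_integral_eq)
qed

lemma abs_average_le:
  assumes "\<And>r. \<bar>g r\<bar> \<le> (B :: real)"
  shows "\<bar>(\<Sum>r<k. g r) / k\<bar> \<le> B"
proof -
  have "(\<Sum>r<k. \<bar>g r\<bar>) \<le> k * B"
    using sum_mono[of "{..<k}" "\<lambda>r. \<bar>g r\<bar>" "\<lambda>_. B"] assms by simp
  then have "\<bar>\<Sum>r<k. g r\<bar> \<le> k * B" by (rule order_trans[OF sum_abs])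
  then show ?thesis using k by (simp add: abs_divide field_simps)
qed

lemma risk_bounds: "0 \<le> risk J T" "risk J T \<le> 1" "\<bar>risk J T\<bar> \<le> 1"
proof -
  show "0 \<le> risk J T" unfolding risk_def by (intro Bochner_Integration.integral_nonneg er_bounds)
  show "\<bar>risk J T\<bar> \<le> 1" unfolding risk_def by (intro abs_integral_D_le er_bounds)
  then show "risk J T \<le> 1" by linarith
qed

lemma gap_bounds: "0 \<le> gap i T" "\<bar>gap i T\<bar> \<le> 1"
proof -
  show "0 \<le> gap i T" unfolding gap_def by (intro Bochner_Integration.integral_nonneg) auto
  have "\<bar>\<bar>er A T q - er B T q\<bar>\<bar> \<le> 1" for A B q using er_bounds[of A T q] er_bounds[of B T q] by linarith
  then show "\<bar>gap i T\<bar> \<le> 1" unfolding gap_def by (rule abs_integral_D_le)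
qed

lemma er_measurable [measurable]:
  assumes Z: "Z \<in> measurable \<Omega> \<mu>" and q: "q \<in> measurable \<Omega> D" and J: "J \<subseteq> \<I>"
  shows "(\<lambda>w. er J (Z w) (q w)) \<in> borel_measurable \<Omega>"
  unfolding er_def
proof (rule borel_measurable_err01)
  show "finite J" using J finite_subset by blast
  have c: "(\<lambda>w. Z w l) \<in> measurable \<Omega> D" if "l \<in> J" for l
    by (rule measurable_compose[OF Z component_measurable]) (use that J in auto)
  show "(\<lambda>w. fst (Z w l)) \<in> borel_measurable \<Omega>" "(\<lambda>w. snd (Z w l)) \<in> measurable \<Omega> (count_space UNIV)"
    if "l \<in> J" for l
    by (rule measurable_compose[OF c[OF that] fst_measurable_D] measurable_compose[OF c[OF that] snd_measurable_D])+
  show "(\<lambda>w. fst (q w)) \<in> borel_measurable \<Omega>" by (rule measurable_compose[OF q fst_measurable_D])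
  show "(\<lambda>w. snd (q w)) \<in> measurable \<Omega> (count_space UNIV)" by (rule measurable_compose[OF q snd_measurable_D])
qed

lemma er_integrable: "T \<in> space \<mu> \<Longrightarrow> J \<subseteq> \<I> \<Longrightarrow> integrable D (er J T)"
  by (rule D.integrable_const_bound[where B = 1]) (use er_bounds er_measurable[of "\<lambda>_. T" D "\<lambda>q. q" J] in auto)

lemma risk_measurable [measurable]:
  assumes Z: "Z \<in> measurable \<Omega> \<mu>" and J: "J \<subseteq> \<I>"
  shows "(\<lambda>w. risk J (Z w)) \<in> borel_measurable \<Omega>"
  unfolding risk_def
proof (rule D.borel_measurable_lebesgue_integral)
  have "(\<lambda>p. er J (Z (fst p)) (snd p)) \<in> borel_measurable (\<Omega> \<Otimes>\<^sub>M D)"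
    by (rule er_measurable[OF measurable_compose[OF measurable_fst Z] measurable_snd J])
  then show "(\<lambda>(x, y). er J (Z x) y) \<in> borel_measurable (\<Omega> \<Otimes>\<^sub>M D)" by (simp add: case_prod_beta')
qed

lemma gap_measurable [measurable]:
  assumes Z: "Z \<in> measurable \<Omega> \<mu>"
  shows "(\<lambda>w. gap i (Z w)) \<in> borel_measurable \<Omega>"
  unfolding gap_def
proof (rule D.borel_measurable_lebesgue_integral)
  have "(\<lambda>p. \<bar>er \<I> (Z (fst p)) (snd p) - er (but i) (Z (fst p)) (snd p)\<bar>) \<in> borel_measurable (\<Omega> \<Otimes>\<^sub>M D)"
    by (intro borel_measurable_abs borel_measurable_diff er_measurable[OF measurable_compose[OF measurable_fst Z] measurable_snd]) auto
  then show "(\<lambda>(x, y). \<bar>er \<I> (Z x) y - er (but i) (Z x) y\<bar>) \<in> borel_measurable (\<Omega> \<Otimes>\<^sub>M D)" by (simp add: case_prod_beta')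
qed

lemma EE_gap: assumes "i < n + m" shows "EE (\<lambda>z s. gap i (shifted z s)) \<le> stab"
proof -
  have "EE (\<lambda>z s. gap i (shifted z s)) = integral\<^sup>L (sample_dist k n m D) (gap i)"
    by (rule integral_sample_dist_EE[symmetric, where B = 1]) (use gap_bounds gap_measurable[of "\<lambda>z. z" \<mu> i] in auto)
  also have "\<dots> \<le> stab"
    using stable assms by (simp add: hyp_stable_def gap_def[abs_def] er_def stab_def)
  finally show ?thesis .
qed

text \<open>The sign of \<open>beta\<close> is not assumed; it follows because \<open>stab\<close>
  bounds the expectation of a nonnegative gap.\<close>

lemma stab_nonneg: "0 \<le> stab"
proof -
  have "tame (\<lambda>z s. gap 0 (shifted z s))"
    by (rule tameI[where B = 1]) (rule gap_measurable measurable_shifted gap_bounds)+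
  then have "EE (\<lambda>z s. 0) \<le> EE (\<lambda>z s. gap 0 (shifted z s))"
    by (intro EE_mono tame_const gap_bounds)
  also have "\<dots> \<le> stab" by (rule EE_gap) (use m in simp)
  finally show ?thesis by (simp add: EE_const)
qed

lemma risk_diff_le_gap:
  assumes T: "T \<in> space \<mu>"
  shows "\<bar>risk \<I> T - risk (but i) T\<bar> \<le> gap i T"
proof -
  have "risk \<I> T - risk (but i) T = (\<integral>q. er \<I> T q - er (but i) T q \<partial>D)"
    unfolding risk_def by (rule Bochner_Integration.integral_diff[symmetric]; rule er_integrable[OF T]; blast)
  then show ?thesis unfolding gap_def using integral_abs_bound[of D "\<lambda>q. er \<I> T q - er (but i) T q"] by simp
qed

lemma er_upd:
  assumes "i \<notin> J" "J \<subseteq> \<I>"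
  shows "er J (shifted (z(i := v)) (s(i := r))) q = er J (shifted z s) q"
proof -
  have "ridge_w lam (shifted (z(i := v)) (s(i := r))) J = ridge_w lam (shifted z s) J"
    by (rule ridge_w_reindex[where \<pi> = "\<lambda>l. l"]) (use assms in \<open>auto simp: bij_betw_def subset_iff shifted_apply\<close>)
  then show ?thesis by (simp add: er_def)
qed

text \<open>Both training sets consist of the untouched sites and the one overwritten point, which
  sits in slot \<open>i\<close> on one side and in slot \<open>j\<close> on the other.\<close>

lemma er_swap:
  assumes "i \<in> noisy" "j \<in> noisy" "i \<noteq> j"
  shows "er (but j) (shifted (z(i := v)) (s(i := r))) q = er (but i) (shifted (z(j := v)) (s(j := r))) q"
proof -
  have "ridge_w lam (shifted (z(i := v)) (s(i := r))) (but j) = ridge_w lam (shifted (z(j := v)) (s(j := r))) (but i)"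
  proof (rule ridge_w_reindex[where \<pi> = "\<lambda>l. if l = i then j else l"])
    show "bij_betw (\<lambda>l. if l = i then j else l) (but j) (but i)"
      by (rule bij_betw_byWitness[where f' = "\<lambda>l. if l = j then i else l"]) (use assms in auto)
  qed (use assms in \<open>auto simp: shifted_apply\<close>)
  then show ?thesis by (simp add: er_def)
qed

lemma risk_upd: "i \<notin> J \<Longrightarrow> J \<subseteq> \<I> \<Longrightarrow> risk J (shifted (z(i := v)) (s(i := r))) = risk J (shifted z s)"
  by (simp add: risk_def er_upd)

lemma risk_swap:
  assumes "i \<in> noisy" "j \<in> noisy" "i \<noteq> j"
  shows "risk (but j) (shifted (z(i := v)) (s(i := r))) = risk (but i) (shifted (z(j := v)) (s(j := r)))"
  by (simp add: risk_def er_swap[OF assms])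

lemma tame_er: "J \<subseteq> \<I> \<Longrightarrow> i < n + m \<Longrightarrow> tame (\<lambda>z s. er J (shifted z s) (z i))"
  by (rule tameI[where B = 1]) (rule er_measurable measurable_shifted component_measurable er_bounds | assumption)+

lemma tame_risk: "J \<subseteq> \<I> \<Longrightarrow> tame (\<lambda>z s. risk J (shifted z s))"
  by (rule tameI[where B = 1]) (rule risk_measurable measurable_shifted risk_bounds | assumption)+

lemma tame_gap: "tame (\<lambda>z s. gap i (shifted z s))"
  by (rule tameI[where B = 1]) (rule gap_measurable measurable_shifted gap_bounds)+

lemma tame_kap: "tame (\<lambda>z s. kap (s i))"
  by (rule tameI[where B = khat]) (auto simp: kap)

text \<open>The predictor without \<open>i\<close> does not see that site, and the shift is
  independent of the point. Given the other sites, the expectation factorizes into the mean of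
  \<phi> and the leave-one-out risk.\<close>

lemma EE_site:
  assumes i: "i \<in> noisy" and A: "tame A" "\<And>z s v r. A (z(i := v)) (s(i := r)) = A z s"
    and \<phi>: "\<And>r. \<bar>\<phi> r\<bar> \<le> (B :: real)"
  shows "EE (\<lambda>z s. A z s * (\<phi> (s i) * loss i z s))
    = (\<Sum>r<k. \<phi> r) / k * EE (\<lambda>z s. A z s * risk (but i) (shifted z s))"
proof -
  let ?F = "\<lambda>z s. A z s * (\<phi> (s i) * loss i z s)"
  have "tame (\<lambda>z s. \<phi> (s i))" by (rule tameI[where B = B]) (auto simp: \<phi>)
  then have "tame ?F" by (intro tame_mult A tame_er) (use i in auto)
  then have "EE ?F = EE (resample i ?F)" by (rule EE_resample[OF _ i, symmetric])
  also have "resample i ?F = (\<lambda>z s. (\<Sum>r<k. \<phi> r) / k * (A z s * risk (but i) (shifted z s)))"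
    unfolding resample_def A(2)
    by (simp add: er_upd risk_def sum_distrib_right sum_distrib_left mult_ac)
  finally show ?thesis unfolding EE_cmult .
qed

lemmas kernel_measurable = borel_measurable_times borel_measurable_const er_measurable
  measurable_compose[OF _ measurable_shifted] measurable_upd

text \<open>Deleting \<open>j\<close> after overwriting slot \<open>i\<close> and deleting \<open>i\<close> after overwriting slot \<open>j\<close> leave the same
  training set.\<close>
lemma EE_swap_kernel:
  assumes ij: "i \<in> noisy" "j \<in> noisy" "i \<noteq> j"
  defines "H \<equiv> \<lambda>z s. (\<Sum>r<k. \<integral>v. kap r * er (but j) (shifted z s) v *
     (kap (s j) * er (but j) (shifted (z(i := v)) (s(i := r))) (z j)) \<partial>D) / k"
  shows "tame H" and "EE H = EE (\<lambda>z s. risk (but i) (shifted z s) * (kap (s j) * loss j z s))"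
proof -
  let ?a = "\<lambda>z s r v. kap r * er (but j) (shifted z s) v"
  let ?b = "\<lambda>z s r v q. er (but j) (shifted (z(i := v)) (s(i := r))) q"
  have i: "i < n + m" and j: "j < n + m" using ij by auto
  show tame: "tame H"
  proof (rule tameI)
    fix s
    have "(\<lambda>z. \<integral>v. ?a z s r v * (kap (s j) * ?b z s r v (z j)) \<partial>D) \<in> borel_measurable \<mu>" for r
    proof (rule D.borel_measurable_lebesgue_integral)
      have "(\<lambda>p. ?a (fst p) s r (snd p) * (kap (s j) * ?b (fst p) s r (snd p) (fst p j))) \<in> borel_measurable (\<mu> \<Otimes>\<^sub>M D)"
        by (intro kernel_measurable measurable_fst measurable_snd measurable_compose[OF measurable_fst component_measurable] i j Diff_subset)
      then show "(\<lambda>(z, v). ?a z s r v * (kap (s j) * ?b z s r v (z j))) \<in> borel_measurable (\<mu> \<Otimes>\<^sub>M D)"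
        by (simp add: case_prod_beta')
    qed
    then show "(\<lambda>z. H z s) \<in> borel_measurable \<mu>" unfolding H_def by (intro borel_measurable_divide borel_measurable_sum) auto
  next
    fix z s
    have "\<bar>?a z s r v * (kap (s j) * ?b z s r v (z j))\<bar> \<le> (2 * 1) * (2 * 1)" for r v
      unfolding abs_mult by (intro mult_mono kap(4) er_bounds(3)) auto
    then have "\<bar>\<integral>v. ?a z s r v * (kap (s j) * ?b z s r v (z j)) \<partial>D\<bar> \<le> 4" for r
      using abs_integral_D_le by simp
    then show "\<bar>H z s\<bar> \<le> 4" unfolding H_def by (rule abs_average_le)
  qed
  let ?F = "\<lambda>z s. risk (but i) (shifted z s) * (kap (s j) * loss j z s)"
  have F: "tame ?F" by (intro tame_mult tame_risk tame_kap tame_er j Diff_subset)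
  \<comment> \<open>Once site \<open>j\<close> is redrawn, the factor at \<open>z j\<close> becomes
    a risk after deleting \<open>j\<close>, and \<open>risk_swap\<close> identifies the result with
    the redrawn \<open>?F\<close>.\<close>
  have "EE H = EE (resample j H)" by (rule EE_resample[OF tame ij(2), symmetric])
  also have "\<dots> = EE (resample j ?F)"
  proof (rule EE_cong)
    fix z s assume z: "z \<in> space \<mu>"
    interpret DD: pair_prob_space D D ..
    have upd: "er (but j) (shifted (z(j := v', i := v)) (s(j := r', i := r))) q = ?b z s r v q" for v' v r r' q
      using er_upd[of j "but j" "z(i := v)" v' "s(i := r)" r' q] ij(3) by (simp add: fun_upd_twist)
    have fubini: "(\<integral>v'. (\<integral>v. ?a z s r v * ?b z s r v v' \<partial>D) \<partial>D) = (\<integral>v. ?a z s r v * risk (but j) (shifted (z(i := v)) (s(i := r))) \<partial>D)" for r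
    proof -
      have "(\<lambda>p. ?a z s r (fst p) * ?b z s r (fst p) (snd p)) \<in> borel_measurable (D \<Otimes>\<^sub>M D)"
        by (intro kernel_measurable measurable_fst measurable_snd measurable_const z i Diff_subset)
      moreover have "\<bar>?a z s r v * ?b z s r v q\<bar> \<le> (2 * 1) * 1" for v q
        unfolding abs_mult by (intro mult_mono kap(4) er_bounds(3)) auto
      ultimately have "integrable (D \<Otimes>\<^sub>M D) (\<lambda>p. ?a z s r (fst p) * ?b z s r (fst p) (snd p))"
        by (intro DD.integrable_const_bound[where B = 2]) auto
      from DD.Fubini_integral[of "\<lambda>v q. ?a z s r v * ?b z s r v q"] this show ?thesis
        by (simp add: case_prod_beta' risk_def)
    qed
    let ?K = "\<Sum>r<k. \<integral>v. ?a z s r v * risk (but j) (shifted (z(i := v)) (s(i := r))) \<partial>D"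
    have "(\<integral>v'. H (z(j := v')) (s(j := r')) \<partial>D) = kap r' * (?K / k)" for r'
    proof -
      have "H (z(j := v')) (s(j := r')) = kap r' * ((\<Sum>r<k. \<integral>v. ?a z s r v * ?b z s r v v' \<partial>D) / k)" for v'
        unfolding H_def using ij(3) by (simp add: er_upd upd sum_distrib_left mult.left_commute[of _ "kap r'"])
      then have "(\<integral>v'. H (z(j := v')) (s(j := r')) \<partial>D)
          = kap r' * ((\<integral>v'. (\<Sum>r<k. \<integral>v. ?a z s r v * ?b z s r v v' \<partial>D) \<partial>D) / k)" by simp
      also have "(\<integral>v'. (\<Sum>r<k. \<integral>v. ?a z s r v * ?b z s r v v' \<partial>D) \<partial>D) = ?K"
      proof (subst Bochner_Integration.integral_sum)
        fix r
        have "(\<lambda>p. ?a z s r (snd p) * ?b z s r (snd p) (fst p)) \<in> borel_measurable (D \<Otimes>\<^sub>M D)"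
          by (intro kernel_measurable measurable_fst measurable_snd measurable_const z i Diff_subset)
        then have "(\<lambda>q. \<integral>v. ?a z s r v * ?b z s r v q \<partial>D) \<in> borel_measurable D"
          by (intro D.borel_measurable_lebesgue_integral) (simp add: case_prod_beta')
        moreover have "\<bar>?a z s r v * ?b z s r v q\<bar> \<le> (2 * 1) * 1" for v q
          unfolding abs_mult by (intro mult_mono kap(4) er_bounds(3)) auto
        then have "\<bar>\<integral>v. ?a z s r v * ?b z s r v q \<partial>D\<bar> \<le> (2 * 1) * 1" for q
          by (rule abs_integral_D_le)
        ultimately show "integrable D (\<lambda>q. \<integral>v. ?a z s r v * ?b z s r v q \<partial>D)"
          by (intro D.integrable_const_bound[where B = 2]) auto
      qed (simp add: fubini)
      finally show ?thesis .
    qed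
    then have "resample j H z s = (\<Sum>r<k. kap r) * (?K / k) / k" by (simp only: resample_def sum_distrib_right)
    also have "\<dots> = ?K / k" using k by (simp add: sum_kap)
    also have "\<dots> = resample j ?F z s"
      unfolding resample_def risk_swap[OF ij] by (simp add: er_upd mult_ac)
    finally show "resample j H z s = resample j ?F z s" .
  qed
  also have "\<dots> = EE ?F" by (rule EE_resample[OF F ij(2)])
  finally show "EE H = EE ?F" .
qed

text \<open>The loss at \<open>j\<close> depends on site \<open>i\<close> through its training set,
  so redrawing \<open>i\<close> does not separate the two factors. Predicting without
  \<open>j\<close> instead of without \<open>i\<close> costs 2 (\<open>gap i\<close> +
  \<open>gap j\<close>), then \<open>EE_swap_kernel\<close> applies, and restoring \<open>i\<close>
  in the risk costs 2 \<open>gap i\<close>: six times \<open>stab\<close> in all.\<close>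

lemma EE_cross_le:
  assumes ij: "i \<in> noisy" "j \<in> noisy" "i \<noteq> j"
  shows "EE (\<lambda>z s. (kap (s i) * loss i z s) * (kap (s j) * loss j z s))
    \<le> EE (\<lambda>z s. risk \<I> (shifted z s) * (kap (s j) * loss j z s)) + 6 * stab"
proof -
  let ?T = shifted
  let ?F = "\<lambda>z s. (kap (s i) * er (but i) (?T z s) (z i)) * (kap (s j) * er (but j) (?T z s) (z j))"
  let ?b = "\<lambda>z s r v. kap (s j) * er (but j) (shifted (z(i := v)) (s(i := r))) (z j)"
  define H where "H = (\<lambda>z s. (\<Sum>r<k. \<integral>v. kap r * er (but j) (?T z s) v * ?b z s r v \<partial>D) / k)"
  note H = EE_swap_kernel[OF ij, folded H_def]
  have i: "i < n + m" and j: "j < n + m" using ij by auto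
  have F: "tame ?F" by (intro tame_mult tame_kap tame_er i j Diff_subset)
  have F2: "tame (\<lambda>z s. risk J (?T z s) * (kap (s j) * er (but j) (?T z s) (z j)))" if "J \<subseteq> \<I>" for J
    by (intro tame_mult tame_risk tame_kap tame_er j Diff_subset that)
  have ub: "\<bar>?b z s r v\<bar> \<le> 2 * 1" for z s r v
    unfolding abs_mult by (intro mult_mono kap(4) er_bounds(3)) auto
  have "EE ?F = EE (resample i ?F)" by (rule EE_resample[OF F ij(1), symmetric])
  also have "\<dots> \<le> EE (\<lambda>z s. H z s + 2 * (gap i (?T z s) + gap j (?T z s)))"
  proof (rule EE_mono)
    show "tame (resample i ?F)" by (rule tame_resample[OF F i])
    show "tame (\<lambda>z s. H z s + 2 * (gap i (?T z s) + gap j (?T z s)))"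
      by (intro tame_add tame_cmult tame_gap H(1))
    fix z s assume z: "z \<in> space \<mu>"
    let ?g = "gap i (?T z s) + gap j (?T z s)"
    have T: "?T z s \<in> space \<mu>" using measurable_space[OF measurable_shifted z] .
    have step: "(\<integral>v. kap r * er (but i) (?T z s) v * ?b z s r v \<partial>D)
        \<le> (\<integral>v. kap r * er (but j) (?T z s) v * ?b z s r v \<partial>D) + kap r * (2 * ?g)" for r
    proof -
      let ?d = "\<lambda>l v. \<bar>er \<I> (?T z s) v - er (but l) (?T z s) v\<bar>"
      have int: "integrable D (\<lambda>v. kap r * er (but l) (?T z s) v * ?b z s r v)" for l
      proof (rule D.integrable_const_bound[where B = "(2 * 1) * (2 * 1)"])
        have zj: "z j \<in> space D" using measurable_space[OF component_measurable[OF j] z] .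
        show "(\<lambda>v. kap r * er (but l) (?T z s) v * ?b z s r v) \<in> borel_measurable D"
          by (intro kernel_measurable measurable_ident_sets[OF refl] measurable_const z zj i Diff_subset)
        have "\<bar>kap r * er (but l) (?T z s) v * ?b z s r v\<bar> \<le> (2 * 1) * (2 * 1)" for v
          unfolding abs_mult[of "_ * _" "?b z s r v"] abs_mult[of "kap r"] by (intro mult_mono kap(4) er_bounds(3) ub) auto
        then show "AE v in D. norm (kap r * er (but l) (?T z s) v * ?b z s r v) \<le> (2 * 1) * (2 * 1)" by simp
      qed
      have intd: "integrable D (?d l)" for l
        by (intro integrable_abs Bochner_Integration.integrable_diff er_integrable[OF T]) auto
      have "(\<integral>v. kap r * er (but i) (?T z s) v * ?b z s r v \<partial>D)
          \<le> (\<integral>v. kap r * er (but j) (?T z s) v * ?b z s r v + kap r * (2 * (?d i v + ?d j v)) \<partial>D)"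
      proof (rule integral_mono)
        fix v
        have "(er (but i) (?T z s) v - er (but j) (?T z s) v) * ?b z s r v
            \<le> \<bar>er (but i) (?T z s) v - er (but j) (?T z s) v\<bar> * \<bar>?b z s r v\<bar>"
          by (simp flip: abs_mult)
        also have "\<dots> \<le> (?d i v + ?d j v) * 2" by (intro mult_mono order_trans[OF ub]) auto
        finally have "kap r * ((er (but i) (?T z s) v - er (but j) (?T z s) v) * ?b z s r v) \<le> kap r * ((?d i v + ?d j v) * 2)"
          by (rule mult_left_mono) (rule kap(1))
        then show "kap r * er (but i) (?T z s) v * ?b z s r v
            \<le> kap r * er (but j) (?T z s) v * ?b z s r v + kap r * (2 * (?d i v + ?d j v))"
          by (simp add: algebra_simps)
      qed (intro int intd Bochner_Integration.integrable_add integrable_mult_right)+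
      also have "\<dots> = (\<integral>v. kap r * er (but j) (?T z s) v * ?b z s r v \<partial>D) + kap r * (2 * ?g)"
        unfolding gap_def
        by (subst Bochner_Integration.integral_add, rule int, intro intd Bochner_Integration.integrable_add integrable_mult_right)
           (simp only: integral_mult_right_zero Bochner_Integration.integral_add[OF intd intd])
      finally show ?thesis .
    qed
    have "resample i ?F z s = (\<Sum>r<k. \<integral>v. kap r * er (but i) (?T z s) v * ?b z s r v \<partial>D) / k"
      unfolding resample_def using ij(3) by (simp add: er_upd)
    also have "\<dots> \<le> (\<Sum>r<k. (\<integral>v. kap r * er (but j) (?T z s) v * ?b z s r v \<partial>D) + kap r * (2 * ?g)) / k"
      by (intro divide_right_mono sum_mono step) simp
    also have "\<dots> = H z s + 2 * ?g"
      unfolding sum.distrib sum_distrib_right[symmetric] sum_kap H_def using k by (simp add: add_divide_distrib)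
    finally show "resample i ?F z s \<le> H z s + 2 * ?g" .
  qed
  also have "\<dots> = EE H + 2 * (EE (\<lambda>z s. gap i (?T z s)) + EE (\<lambda>z s. gap j (?T z s)))"
    unfolding EE_add[OF tame_gap tame_gap, symmetric] EE_cmult[symmetric]
    by (intro EE_add H(1) tame_cmult tame_add tame_gap)
  finally have 1: "EE ?F \<le> \<dots>" .
  have "EE H = EE (\<lambda>z s. risk (but i) (?T z s) * (kap (s j) * er (but j) (?T z s) (z j)))" by (rule H(2))
  also have "\<dots> \<le> EE (\<lambda>z s. risk \<I> (?T z s) * (kap (s j) * er (but j) (?T z s) (z j)) + 2 * gap i (?T z s))"
  proof (rule EE_mono[OF F2[OF Diff_subset] tame_add[OF F2[OF subset_refl] tame_cmult[OF tame_gap]]])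
    fix z s assume z: "z \<in> space \<mu>"
    let ?c = "kap (s j) * er (but j) (?T z s) (z j)"
    have T: "?T z s \<in> space \<mu>" using measurable_space[OF measurable_shifted z] .
    have "\<bar>?c\<bar> \<le> 2 * 1" unfolding abs_mult by (intro mult_mono kap(4) er_bounds(3)) auto
    then have "\<bar>risk (but i) (?T z s) - risk \<I> (?T z s)\<bar> * \<bar>?c\<bar> \<le> gap i (?T z s) * 2"
      using risk_diff_le_gap[OF T, of i] by (intro mult_mono) auto
    then have "(risk (but i) (?T z s) - risk \<I> (?T z s)) * ?c \<le> gap i (?T z s) * 2"
      unfolding abs_mult[symmetric] by (rule order_trans[OF abs_ge_self])
    then show "risk (but i) (?T z s) * ?c \<le> risk \<I> (?T z s) * ?c + 2 * gap i (?T z s)"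
      by (simp add: algebra_simps)
  qed
  also have "\<dots> = EE (\<lambda>z s. risk \<I> (?T z s) * (kap (s j) * er (but j) (?T z s) (z j))) + 2 * EE (\<lambda>z s. gap i (?T z s))"
    by (subst EE_add[OF F2[OF subset_refl] tame_cmult[OF tame_gap]]) (simp only: EE_cmult)
  finally have 2: "EE H \<le> \<dots>" .
  have "F \<le> X + 6 * b" if "F \<le> h + 2 * (g + g')" "h \<le> X + 2 * g" "g \<le> b" "g' \<le> b" for F X h g g' b :: real
    using that by argo
  from this[OF 1 2 EE_gap[OF i] EE_gap[OF j]] show ?thesis .
qed

section \<open>Deviation of the risk from its leave-one-out estimate\<close>

definition dev :: "nat \<Rightarrow> (nat \<Rightarrow> (real^'d) \<times> nat) \<Rightarrow> (nat \<Rightarrow> nat) \<Rightarrow> real" where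
  "dev i z s = risk \<I> (shifted z s) - kap (s i) * loss i z s"

lemma tame_dev: "i < n + m \<Longrightarrow> tame (dev i)"
  unfolding dev_def[abs_def] by (intro tame_diff tame_mult tame_risk tame_kap tame_er Diff_subset subset_refl)

lemma EE_diff_add:
  "tame F \<Longrightarrow> tame G \<Longrightarrow> tame H \<Longrightarrow> EE (\<lambda>z s. F z s - G z s + H z s) = EE F - EE G + EE H"
  by (simp add: EE_add[OF tame_diff] EE_diff)

text \<open>Up to four gaps the risk may be replaced by R, the risk without \<open>i\<close>, which
  is the conditional mean of the weighted loss. The variance left is \<open>khat\<close> R - R^2, at
  most 2R - R^2 \<le> 1.\<close>

lemma EE_dev_square_le:
  assumes i: "i \<in> noisy"
  shows "EE (\<lambda>z s. dev i z s * dev i z s) \<le> 1 + 4 * stab"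
proof -
  have i': "i < n + m" using i by simp
  let ?R = "\<lambda>z s. risk (but i) (shifted z s)" and ?e = "\<lambda>z s. loss i z s"
  let ?G = "\<lambda>z s. ?R z s * ?R z s - 2 * (?R z s * (kap (s i) * ?e z s)) + 1 * (kap (s i) * kap (s i) * ?e z s)"
  have R: "tame ?R" by (intro tame_risk Diff_subset)
  have t: "tame (\<lambda>z s. ?R z s * ?R z s)" "tame (\<lambda>z s. ?R z s * (kap (s i) * ?e z s))"
    "tame (\<lambda>z s. 1 * (kap (s i) * kap (s i) * ?e z s))"
    by (intro tame_mult R tame_kap tame_er i' Diff_subset tame_const)+
  have G: "tame ?G" by (intro tame_add tame_diff tame_cmult t)
  have "EE (\<lambda>z s. dev i z s * dev i z s) \<le> EE (\<lambda>z s. ?G z s + 4 * gap i (shifted z s))"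
  proof (rule EE_mono)
    show "tame (\<lambda>z s. dev i z s * dev i z s)" by (intro tame_mult tame_dev i')
    show "tame (\<lambda>z s. ?G z s + 4 * gap i (shifted z s))" by (intro tame_add tame_cmult tame_gap G)
    fix z s assume z: "z \<in> space \<mu>"
    let ?S = "risk \<I> (shifted z s)" and ?c = "kap (s i) * ?e z s"
    have T: "shifted z s \<in> space \<mu>" using measurable_space[OF measurable_shifted z] .
    have "0 \<le> ?c" "?c \<le> 2 * 1"
      using kap(1)[of "s i"] kap(4)[of "s i"] er_bounds[of "but i" "shifted z s" "z i"] by (auto intro!: mult_mono)
    then have "\<bar>?S + ?R z s - 2 * ?c\<bar> \<le> 4" using risk_bounds[of _ "shifted z s"] by (smt (verit))
    then have "\<bar>?S - ?R z s\<bar> * \<bar>?S + ?R z s - 2 * ?c\<bar> \<le> gap i (shifted z s) * 4"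
      using risk_diff_le_gap[OF T, of i] by (intro mult_mono) auto
    then have "(?S - ?R z s) * (?S + ?R z s - 2 * ?c) \<le> gap i (shifted z s) * 4"
      unfolding abs_mult[symmetric] by (rule order_trans[OF abs_ge_self])
    moreover have "dev i z s * dev i z s = (?R z s - ?c) * (?R z s - ?c) + (?S - ?R z s) * (?S + ?R z s - 2 * ?c)"
      unfolding dev_def by (simp add: algebra_simps)
    moreover have "?c * ?c = kap (s i) * kap (s i) * ?e z s"
      using er_bounds(4)[of "but i" "shifted z s" "z i"] by (simp add: mult.assoc mult.left_commute)
    then have "(?R z s - ?c) * (?R z s - ?c) = ?G z s" by (simp add: algebra_simps)
    ultimately show "dev i z s * dev i z s \<le> ?G z s + 4 * gap i (shifted z s)" by linarith
  qed
  also have "\<dots> = EE (\<lambda>z s. ?R z s * ?R z s) - 2 * EE (\<lambda>z s. ?R z s * (kap (s i) * ?e z s))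
      + EE (\<lambda>z s. 1 * (kap (s i) * kap (s i) * ?e z s)) + 4 * EE (\<lambda>z s. gap i (shifted z s))"
    unfolding EE_cmult[symmetric]
    by (subst EE_add, intro tame_add tame_diff tame_cmult t, intro tame_cmult tame_gap)
       (intro arg_cong2[where f = "(+)"] refl EE_diff_add tame_cmult t)
  finally have 1: "EE (\<lambda>z s. dev i z s * dev i z s) \<le> \<dots>" .
  have 2: "EE (\<lambda>z s. ?R z s * (kap (s i) * ?e z s)) = EE (\<lambda>z s. ?R z s * ?R z s)"
    using EE_site[where \<phi> = kap, OF i R _ kap(3)] risk_upd[of i "but i"] k by (simp add: sum_kap)
  have 3: "EE (\<lambda>z s. 1 * (kap (s i) * kap (s i) * ?e z s)) = khat * EE (\<lambda>z s. 1 * ?R z s)"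
  proof -
    have "\<bar>kap r * kap r\<bar> \<le> 2 * 2" for r unfolding abs_mult by (intro mult_mono kap(4)) auto
    then show ?thesis using EE_site[OF i tame_const[of 1] refl, of "\<lambda>r. kap r * kap r" 4] k by (simp add: sum_kap)
  qed
  have "EE (\<lambda>z s. ?R z s * ?R z s) - 2 * EE (\<lambda>z s. ?R z s * ?R z s) + khat * EE (\<lambda>z s. 1 * ?R z s)
      = EE (\<lambda>z s. khat * ?R z s - ?R z s * ?R z s)"
    by (subst EE_diff) (simp_all add: EE_cmult t(1) tame_cmult R)
  also have "\<dots> \<le> EE (\<lambda>z s. 1)"
  proof (rule EE_mono)
    show "tame (\<lambda>z s. khat * ?R z s - ?R z s * ?R z s)" by (intro tame_diff tame_cmult R t)
    fix z s
    have "khat * ?R z s \<le> 2 * ?R z s" using khat risk_bounds(1)[of "but i" "shifted z s"] by (intro mult_right_mono)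
    moreover have "0 \<le> (?R z s - 1) * (?R z s - 1)" by simp
    ultimately show "khat * ?R z s - ?R z s * ?R z s \<le> 1" by (simp add: algebra_simps)
  qed (rule tame_const)
  finally have "EE (\<lambda>z s. ?R z s * ?R z s) - 2 * EE (\<lambda>z s. ?R z s * ?R z s) + khat * EE (\<lambda>z s. 1 * ?R z s) \<le> 1"
    unfolding EE_const .
  then show ?thesis using 1 EE_gap[OF i'] unfolding 2 3 by linarith
qed

text \<open>In the expansion, the risk times the weighted loss at \<open>j\<close> cancels against
  the bound of \<open>EE_cross_le\<close>, leaving 6 \<open>stab\<close>. The remaining term would
  have mean 0 with the risk without \<open>i\<close>; passing to that risk costs 2
  \<open>stab\<close>.\<close>

lemma EE_dev_prod_le:
  assumes ij: "i \<in> noisy" "j \<in> noisy" "i \<noteq> j"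
  shows "EE (\<lambda>z s. dev i z s * dev j z s) \<le> 8 * stab"
proof -
  let ?R = "\<lambda>z s. risk \<I> (shifted z s)" and ?Ri = "\<lambda>z s. risk (but i) (shifted z s)"
  let ?c = "\<lambda>l z s. kap (s l) * loss l z s"
  have i: "i < n + m" and j: "j < n + m" using ij by auto
  have c: "tame (?c l)" if "l < n + m" for l by (intro tame_mult tame_kap tame_er Diff_subset that)
  have R: "tame ?R" and Ri: "tame ?Ri" by (intro tame_risk Diff_subset subset_refl)+
  have "EE (\<lambda>z s. dev i z s * dev j z s)
      = EE (\<lambda>z s. ?R z s * (?R z s - ?c i z s) - ?R z s * ?c j z s + ?c i z s * ?c j z s)"
    by (rule EE_cong) (simp add: dev_def algebra_simps)
  also have "\<dots> = EE (\<lambda>z s. ?R z s * (?R z s - ?c i z s)) - EE (\<lambda>z s. ?R z s * ?c j z s) + EE (\<lambda>z s. ?c i z s * ?c j z s)"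
    by (rule EE_diff_add) (intro tame_diff tame_mult[OF R] tame_mult[OF c c] R c i j)+
  finally have 1: "EE (\<lambda>z s. dev i z s * dev j z s) = \<dots>" .
  have "EE (\<lambda>z s. ?R z s * (?R z s - ?c i z s)) \<le> EE (\<lambda>z s. ?Ri z s * ?Ri z s - ?Ri z s * ?c i z s + 2 * gap i (shifted z s))"
  proof (rule EE_mono)
    show "tame (\<lambda>z s. ?R z s * (?R z s - ?c i z s))" by (intro tame_diff tame_mult[OF R] R c i)
    show "tame (\<lambda>z s. ?Ri z s * ?Ri z s - ?Ri z s * ?c i z s + 2 * gap i (shifted z s))"
      by (intro tame_add tame_diff tame_cmult tame_gap tame_mult[OF Ri] Ri c i)
    fix z s assume z: "z \<in> space \<mu>"
    have T: "shifted z s \<in> space \<mu>" using measurable_space[OF measurable_shifted z] .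
    have "0 \<le> ?c i z s" "?c i z s \<le> 2 * 1"
      using kap(1)[of "s i"] kap(4)[of "s i"] er_bounds[of "but i" "shifted z s" "z i"] by (auto intro!: mult_mono)
    then have "\<bar>?R z s + ?Ri z s - ?c i z s\<bar> \<le> 2" using risk_bounds[of _ "shifted z s"] by (smt (verit))
    then have "\<bar>?R z s - ?Ri z s\<bar> * \<bar>?R z s + ?Ri z s - ?c i z s\<bar> \<le> gap i (shifted z s) * 2"
      using risk_diff_le_gap[OF T, of i] by (intro mult_mono) auto
    then have "(?R z s - ?Ri z s) * (?R z s + ?Ri z s - ?c i z s) \<le> gap i (shifted z s) * 2"
      unfolding abs_mult[symmetric] by (rule order_trans[OF abs_ge_self])
    then show "?R z s * (?R z s - ?c i z s) \<le> ?Ri z s * ?Ri z s - ?Ri z s * ?c i z s + 2 * gap i (shifted z s)"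
      by (simp add: algebra_simps)
  qed
  also have "\<dots> = EE (\<lambda>z s. ?Ri z s * ?Ri z s) - EE (\<lambda>z s. ?Ri z s * ?c i z s) + 2 * EE (\<lambda>z s. gap i (shifted z s))"
    unfolding EE_cmult[symmetric]
    by (rule EE_diff_add) (intro tame_mult[OF Ri] Ri c i tame_cmult tame_gap)+
  also have "EE (\<lambda>z s. ?Ri z s * ?c i z s) = EE (\<lambda>z s. ?Ri z s * ?Ri z s)"
    using EE_site[where \<phi> = kap, OF ij(1) Ri _ kap(3)] risk_upd[of i "but i"] k by (simp add: sum_kap)
  finally show ?thesis using 1 EE_cross_le[OF ij] EE_gap[OF i] by linarith
qed

lemma EE_dev_mean_square_le:
  "EE (\<lambda>z s. ((\<Sum>i\<in>noisy. dev i z s) / m) ^ 2) \<le> 1 / m + 8 * stab"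
proof -
  let ?A = "noisy"
  have "EE (\<lambda>z s. ((\<Sum>i\<in>?A. dev i z s) / m) ^ 2) = EE (\<lambda>z s. (1 / m ^ 2) * (\<Sum>i\<in>?A. \<Sum>j\<in>?A. dev i z s * dev j z s))"
    by (rule EE_cong) (simp add: power2_eq_square sum_product)
  also have "\<dots> = (1 / m ^ 2) * (\<Sum>i\<in>?A. \<Sum>j\<in>?A. EE (\<lambda>z s. dev i z s * dev j z s))"
  proof -
    have t: "tame (\<lambda>z s. dev i z s * dev j z s)" if "i \<in> ?A" "j \<in> ?A" for i j
      by (intro tame_mult tame_dev) (use that in auto)
    have "EE (\<lambda>z s. \<Sum>i\<in>?A. \<Sum>j\<in>?A. dev i z s * dev j z s) = (\<Sum>i\<in>?A. EE (\<lambda>z s. \<Sum>j\<in>?A. dev i z s * dev j z s))"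
      by (rule EE_sum) (intro tame_sum t)
    also have "\<dots> = (\<Sum>i\<in>?A. \<Sum>j\<in>?A. EE (\<lambda>z s. dev i z s * dev j z s))"
      by (intro sum.cong refl EE_sum t)
    finally show ?thesis unfolding EE_cmult by simp
  qed
  also have "\<dots> \<le> (1 / m ^ 2) * (\<Sum>i\<in>?A. \<Sum>j\<in>?A. 8 * stab + (if i = j then 1 else 0))"
  proof (intro mult_left_mono sum_mono)
    fix i j assume "i \<in> ?A" "j \<in> ?A"
    then show "EE (\<lambda>z s. dev i z s * dev j z s) \<le> 8 * stab + (if i = j then 1 else 0)"
      using EE_dev_square_le[of i] EE_dev_prod_le[of i j] stab_nonneg by (cases "i = j") auto
  qed simp
  also have "\<dots> = 1 / m + 8 * stab"
    using m by (simp add: sum.distrib power2_eq_square field_simps)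
  finally show ?thesis .
qed

lemma tame_of_bool_less:
  assumes "tame F" "tame G" shows "tame (\<lambda>z s. of_bool (F z s < G z s))"
proof (rule tameI[where B = 1])
  fix s
  have [measurable]: "(\<lambda>z. F z s) \<in> borel_measurable \<mu>" "(\<lambda>z. G z s) \<in> borel_measurable \<mu>"
    using assms by (auto intro: tame_measurable)
  show "(\<lambda>z. of_bool (F z s < G z s) :: real) \<in> borel_measurable \<mu>"
    unfolding of_bool_def by measurable
qed (simp add: of_bool_def)

lemma EE_chebyshev:
  assumes V: "tame V" and "0 < \<theta>"
  shows "EE (\<lambda>z s. of_bool (\<theta> < V z s)) \<le> EE (\<lambda>z s. V z s * V z s) / \<theta>\<^sup>2"
proof -
  have "EE (\<lambda>z s. of_bool (\<theta> < V z s)) \<le> EE (\<lambda>z s. (1 / \<theta>\<^sup>2) * (V z s * V z s))"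
  proof (rule EE_mono)
    show "tame (\<lambda>z s. of_bool (\<theta> < V z s))" by (intro tame_of_bool_less tame_const V)
    show "tame (\<lambda>z s. (1 / \<theta>\<^sup>2) * (V z s * V z s))" by (intro tame_cmult tame_mult V)
    fix z s
    have "\<theta> * \<theta> \<le> V z s * V z s" if "\<theta> < V z s" using that assms(2) by (intro mult_mono) auto
    then show "of_bool (\<theta> < V z s) \<le> (1 / \<theta>\<^sup>2) * (V z s * V z s)"
      using assms(2) by (auto simp: power2_eq_square field_simps)
  qed
  then show ?thesis unfolding EE_cmult by simp
qed

lemma EE_label:
  assumes i: "i \<in> noisy" and A: "tame A" "\<And>z s v r. A (z(i := v)) (s(i := r)) = A z s"
    and \<phi>: "\<And>r. \<bar>\<phi> r\<bar> \<le> (B :: real)"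
  shows "EE (\<lambda>z s. A z s * \<phi> (s i)) = (\<Sum>r<k. \<phi> r) / k * EE A"
proof -
  have "tame (\<lambda>z s. \<phi> (s i))" by (rule tameI[where B = B]) (auto simp: \<phi>)
  then have "EE (\<lambda>z s. A z s * \<phi> (s i)) = EE (resample i (\<lambda>z s. A z s * \<phi> (s i)))"
    by (intro EE_resample[OF _ i, symmetric] tame_mult A)
  also have "resample i (\<lambda>z s. A z s * \<phi> (s i)) = (\<lambda>z s. (\<Sum>r<k. \<phi> r) / k * A z s)"
    unfolding resample_def A(2) by (simp add: D.prob_space sum_distrib_left sum_distrib_right mult_ac)
  finally show ?thesis unfolding EE_cmult .
qed

section \<open>Exchangeability of the correctly labelled sites\<close>

definition fit :: "nat \<Rightarrow> (nat \<Rightarrow> (real^'d) \<times> nat) \<Rightarrow> real" where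
  "fit l T = 1 - er \<I> T (T l)"

lemma fit_bounds: "0 \<le> fit l T" "fit l T \<le> 1" "\<bar>fit l T\<bar> \<le> 1" "fit l T * fit l T = fit l T"
  using er_bounds[of \<I> T "T l"] by (auto simp: fit_def algebra_simps)

lemma fit_measurable: "l < n + m \<Longrightarrow> fit l \<in> borel_measurable \<mu>"
  unfolding fit_def
  by (intro borel_measurable_diff borel_measurable_const er_measurable measurable_ident_sets[OF refl]
      component_measurable subset_refl)

lemma tame_fit: "l < n + m \<Longrightarrow> tame (\<lambda>z s. fit l (shifted z s))"
  by (rule tameI[where B = 1]) (rule measurable_compose[OF measurable_shifted fit_measurable] fit_bounds | assumption)+

lemma shifted_clean:
  assumes z: "z \<in> space \<mu>" and l: "l < n + m" "l < n \<or> s l = 0"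
  shows "shifted z s l = z l"
  using space_\<mu>_D[OF z l(1)] l shift_label_eq_iff[of "snd (z l)" k 0] k
  by (auto simp: shifted_apply prod_eq_iff mem_Times_iff)

text \<open>Correctly labelled sites enter training with the latent point itself. Permuting these
  latent points only reorders the training set, so the predictor is unchanged.\<close>

lemma integral_fit_permute:
  assumes Q: "Q \<subseteq> {l \<in> \<I>. l < n \<or> s l = 0}" and p: "p permutes Q" and l: "l \<in> Q" "l' \<in> Q"
  shows "(\<integral>z. fit l (shifted z s) * fit l' (shifted z s) \<partial>\<mu>) = (\<integral>z. fit (p l) (shifted z s) * fit (p l') (shifted z s) \<partial>\<mu>)"
proof -
  have p': "p permutes \<I>" using permutes_subset[OF p] Q by blast
  have pl: "p l < n + m" "p l' < n + m" "l < n + m" "l' < n + m" using Q l permutes_in_image[OF p] by auto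
  let ?f = "\<lambda>z. fit l (shifted z s) * fit l' (shifted z s)"
  have "integral\<^sup>L \<mu> ?f = (\<integral>z. ?f (\<lambda>l\<in>\<I>. z (p l)) \<partial>\<mu>)"
    by (rule integral_permute[symmetric])
       (use measurable_compose[OF measurable_shifted fit_measurable] pl permutes_in_image[OF p'] permutes_inj_on[OF p']
         in \<open>auto intro!: borel_measurable_times\<close>)
  also have "\<dots> = (\<integral>z. fit (p l) (shifted z s) * fit (p l') (shifted z s) \<partial>\<mu>)"
  proof (intro Bochner_Integration.integral_cong refl)
    fix z assume z: "z \<in> space \<mu>"
    let ?z = "\<lambda>l\<in>\<I>. z (p l)"
    have z': "?z \<in> space \<mu>"
      using z permutes_in_image[OF p'] by (auto simp: latent_dist_def space_PiM PiE_iff)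
    have eq: "shifted ?z s h = shifted z s (p h)" if "h < n + m" for h
    proof (cases "h \<in> Q")
      case True
      then have "p h \<in> Q" using permutes_in_image[OF p] by simp
      then show ?thesis using True Q that by (subst (1 2) shifted_clean) (auto simp: z z')
    next
      case False
      then have "p h = h" using p by (simp add: permutes_def)
      then show ?thesis using that by (simp add: shifted_apply)
    qed
    then have "ridge_w lam (shifted ?z s) \<I> = ridge_w lam (shifted z s) \<I>"
      by (intro ridge_w_reindex[OF permutes_imp_bij[OF p']]) simp
    then show "?f ?z = fit (p l) (shifted z s) * fit (p l') (shifted z s)"
      using eq pl by (simp add: fit_def er_def)
  qed
  finally show ?thesis .
qed

text \<open>\<open>clean_gap\<close> compares the fit on the clean sample with that on the noisy sites whose random label
  happens to be correct.\<close>
definition wt :: "(nat \<Rightarrow> nat) \<Rightarrow> nat \<Rightarrow> real" where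
  "wt s l = (if l < n then 1 / n else if s l = 0 then - real k / m else 0)"

definition clean_gap :: "(nat \<Rightarrow> (real^'d) \<times> nat) \<Rightarrow> (nat \<Rightarrow> nat) \<Rightarrow> real" where
  "clean_gap z s = (\<Sum>l<n+m. wt s l * fit l (shifted z s))"

lemma wt_bound: "\<bar>wt s l\<bar> \<le> 1 + real k"
proof -
  have "1 / real n \<le> 1" using mn by simp
  moreover have "real k / m \<le> real k" using divide_left_mono[of 1 "real m" "real k"] m by simp
  ultimately show ?thesis by (auto simp: wt_def intro: add_increasing add_increasing2)
qed

lemma tame_wt: "tame (\<lambda>z s. wt s l)"
  by (rule tameI[where B = "1 + real k"]) (auto simp: wt_bound)

lemma tame_clean_gap: "tame clean_gap"
  unfolding clean_gap_def[abs_def] by (intro tame_sum tame_mult tame_wt tame_fit) simp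

text \<open>Given \<open>s\<close>, the correctly labelled sites are exchangeable, so only one variance and one covariance
  occur.\<close>
lemma integral_clean_gap_square_le:
  assumes s: "s \<in> SS"
  shows "(\<integral>z. clean_gap z s * clean_gap z s \<partial>\<mu>) \<le> (\<Sum>l<n+m. wt s l * wt s l) / 2 + (\<Sum>l<n+m. wt s l)\<^sup>2"
proof -
  let ?Q = "{l \<in> \<I>. l < n \<or> s l = 0}"
  let ?i = "\<lambda>l l'. \<integral>z. fit l (shifted z s) * fit l' (shifted z s) \<partial>\<mu>"
  have n: "0 < n" "1 < n" using m mn by auto
  have int: "integrable \<mu> (\<lambda>z. fit l (shifted z s) * fit l' (shifted z s))" if "l < n + m" "l' < n + m" for l l'
    using tame_integrable[OF tame_mult[OF tame_fit[OF that(1)] tame_fit[OF that(2)]]] .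
  have diag: "?i l l = ?i 0 0" if "l \<in> ?Q" for l
    using integral_fit_permute[OF subset_refl permutes_swap_id[of 0 ?Q l], of 0 0] that n by simp
  have off: "?i l l' = ?i 0 1" if l: "l \<in> ?Q" "l' \<in> ?Q" "l \<noteq> l'" for l l'
  proof -
    let ?t = "Transposition.transpose 0 l" let ?p = "?t \<circ> Transposition.transpose 1 (?t l')"
    have t: "?t permutes ?Q" by (rule permutes_swap_id) (use l n in auto)
    then have "?t l' \<in> ?Q" using permutes_in_image[OF t] l by simp
    then have p: "?p permutes ?Q" by (intro permutes_compose t permutes_swap_id) (use n in auto)
    \<comment> \<open>Hence the inner transposition fixes 0, and the composition sends 0 to
      \<open>l\<close> and 1 to \<open>l'\<close>.\<close>
    have "?t l' \<noteq> 0" using l by (auto simp: Transposition.transpose_def)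
    then have "?p 0 = l" "?p 1 = l'" using l(3) by (auto simp: Transposition.transpose_def)
    then show ?thesis using integral_fit_permute[OF subset_refl p, of 0 1] n by simp
  qed
  have i01: "?i 0 1 \<le> 1" "0 \<le> ?i 0 1"
    by (rule \<mu>.integral_le_const[OF int], use n in simp, use n in simp,
        intro AE_I2 mult_le_one fit_bounds, intro Bochner_Integration.integral_nonneg mult_nonneg_nonneg fit_bounds)
  \<comment> \<open>The difference of two indicators has square at most 1, and by exchangeability
    the mean of this square is twice the left-hand side.\<close>
  have half: "?i 0 0 - ?i 0 1 \<le> 1 / 2"
  proof -
    have "?i 0 0 + ?i 1 1 - 2 * ?i 0 1 = (\<integral>z. fit 0 (shifted z s) * fit 0 (shifted z s) + fit 1 (shifted z s) * fit 1 (shifted z s)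
        - 2 * (fit 0 (shifted z s) * fit 1 (shifted z s)) \<partial>\<mu>)"
      using int[of 0 0] int[of 1 1] int[of 0 1] n by simp
    also have "\<dots> \<le> 1"
    proof (rule \<mu>.integral_le_const)
      show "integrable \<mu> (\<lambda>z. fit 0 (shifted z s) * fit 0 (shifted z s) + fit 1 (shifted z s) * fit 1 (shifted z s)
        - 2 * (fit 0 (shifted z s) * fit 1 (shifted z s)))"
        using int[of 0 0] int[of 1 1] int[of 0 1] n by simp
      have "fit 0 T * fit 0 T + fit 1 T * fit 1 T - 2 * (fit 0 T * fit 1 T) \<le> 1" for T
        by (auto simp: fit_def er_def err01_def)
      then show "AE z in \<mu>. fit 0 (shifted z s) * fit 0 (shifted z s) + fit 1 (shifted z s) * fit 1 (shifted z s)
        - 2 * (fit 0 (shifted z s) * fit 1 (shifted z s)) \<le> 1" by simp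
    qed
    finally show ?thesis using diag[of 1] n by simp
  qed
  have "(\<integral>z. clean_gap z s * clean_gap z s \<partial>\<mu>)
      = (\<integral>z. (\<Sum>l<n+m. \<Sum>l'<n+m. wt s l * wt s l' * (fit l (shifted z s) * fit l' (shifted z s))) \<partial>\<mu>)"
    unfolding clean_gap_def sum_product by (simp add: mult_ac)
  also have "\<dots> = (\<Sum>l<n+m. \<Sum>l'<n+m. wt s l * wt s l' * ?i l l')"
    by (subst Bochner_Integration.integral_sum) (auto intro!: Bochner_Integration.integrable_sum integrable_mult_right int
        sum.cong simp: Bochner_Integration.integral_sum int)
  also have "\<dots> = (\<Sum>l<n+m. \<Sum>l'<n+m. wt s l * wt s l' * ?i 0 1 + (if l = l' then wt s l * wt s l * (?i 0 0 - ?i 0 1) else 0))"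
  proof (intro sum.cong refl)
    fix l l' assume "l \<in> \<I>" "l' \<in> \<I>"
    show "wt s l * wt s l' * ?i l l' = wt s l * wt s l' * ?i 0 1 + (if l = l' then wt s l * wt s l * (?i 0 0 - ?i 0 1) else 0)"
    proof (cases "l \<in> ?Q \<and> l' \<in> ?Q")
      case True
      then have "?i l l' = (if l = l' then ?i 0 0 else ?i 0 1)"
        using diag[of l] off[of l l'] by (cases "l = l'") auto
      then have eq: "wt s l * wt s l' * ?i l l' = wt s l * wt s l' * (if l = l' then ?i 0 0 else ?i 0 1)" by simp
      show ?thesis unfolding eq by (cases "l = l'") (simp_all add: algebra_simps)
    next
      case False
      then have "wt s l = 0 \<or> wt s l' = 0" using \<open>l \<in> \<I>\<close> \<open>l' \<in> \<I>\<close> by (auto simp: wt_def)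
      then show ?thesis by auto
    qed
  qed
  also have "\<dots> = (\<Sum>l<n+m. wt s l)\<^sup>2 * ?i 0 1 + (\<Sum>l<n+m. wt s l * wt s l) * (?i 0 0 - ?i 0 1)"
  proof -
    have "(\<Sum>l<n+m. \<Sum>l'<n+m. wt s l * wt s l' * c) = (\<Sum>l<n+m. wt s l)\<^sup>2 * c" for c
      unfolding power2_eq_square sum_product by (simp only: sum_distrib_right)
    then show ?thesis unfolding sum.distrib by (simp add: sum_distrib_right)
  qed
  also have "\<dots> \<le> (\<Sum>l<n+m. wt s l)\<^sup>2 * 1 + (\<Sum>l<n+m. wt s l * wt s l) * (1 / 2)"
    by (intro add_mono mult_left_mono i01 half sum_nonneg) auto
  finally show ?thesis by simp
qed

lemma sum_wt: "(\<Sum>l<n+m. wt s l) = (\<Sum>i\<in>noisy. 1 - real k * of_bool (s i = 0)) / m"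
  and sum_wt_square: "(\<Sum>l<n+m. wt s l * wt s l) = 1 / n + (\<Sum>i\<in>noisy. (real k / m)\<^sup>2 * of_bool (s i = 0))"
proof -
  have split: "(\<Sum>l<n+m. f l) = (\<Sum>l<n. f l) + (\<Sum>l\<in>noisy. f l)" for f :: "nat \<Rightarrow> real"
    by (subst sum.union_disjoint[symmetric]) (auto intro!: sum.cong)
  have "(\<Sum>i\<in>noisy. wt s i) = (\<Sum>i\<in>noisy. - real k * of_bool (s i = 0) / m)"
    by (intro sum.cong) (auto simp: wt_def)
  then show "(\<Sum>l<n+m. wt s l) = (\<Sum>i\<in>noisy. 1 - real k * of_bool (s i = 0)) / m"
    using m mn by (simp add: split wt_def sum_subtractf sum_divide_distrib[symmetric] diff_divide_distrib sum_negf)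
  have "(\<Sum>i\<in>noisy. wt s i * wt s i) = (\<Sum>i\<in>noisy. (real k / m)\<^sup>2 * of_bool (s i = 0))"
    by (intro sum.cong) (auto simp: wt_def power2_eq_square)
  then show "(\<Sum>l<n+m. wt s l * wt s l) = 1 / n + (\<Sum>i\<in>noisy. (real k / m)\<^sup>2 * of_bool (s i = 0))"
    using mn by (simp add: split wt_def)
qed

text \<open>The sum of the weights is the mean of \<open>m\<close> independent centered variables 1
  - k [s i = 0] of variance k - 1, which gives the last term; the first is half the expected sum of
  squared weights.\<close>

lemma EE_clean_gap_square_le:
  "EE (\<lambda>z s. clean_gap z s * clean_gap z s) \<le> (1 / n + k / m) / 2 + (real k - 1) / m"
proof -
  let ?A = "noisy"
  let ?Y = "\<lambda>r. 1 - real k * of_bool (r = (0 :: nat))"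
  have Yb: "\<bar>?Y r\<bar> \<le> 1 + real k" and zb: "\<bar>of_bool (r = 0) :: real\<bar> \<le> 1" for r :: nat by auto
  have tY: "tame (\<lambda>z s. ?Y (s i))" and tz: "tame (\<lambda>z s. of_bool (s i = 0))" for i
    by (rule tameI[where B = "1 + real k"], use Yb in auto)+
  have sums: "(\<Sum>r<k. of_bool (r = 0) :: real) = 1" using k by (simp add: of_bool_def)
  have sY: "(\<Sum>r<k. ?Y r) = 0" by (simp only: sum_subtractf sum_distrib_left[symmetric] sums) simp
  have sY2: "(\<Sum>r<k. ?Y r * ?Y r) = k * (real k - 1)"
  proof -
    have "(\<Sum>r<k. ?Y r * ?Y r) = (\<Sum>r<k. 1 + (real k * real k - 2 * real k) * of_bool (r = 0))"
      by (intro sum.cong) (auto simp: algebra_simps)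
    also have "\<dots> = k + (real k * real k - 2 * real k) * 1" by (simp only: sum.distrib sum_distrib_left[symmetric] sums) simp
    finally show ?thesis by (simp add: algebra_simps)
  qed
  have E0: "EE (\<lambda>z s. of_bool (s i = 0)) = 1 / k" if "i \<in> ?A" for i
    using EE_label[OF that tame_const[of 1] refl, of "\<lambda>r. of_bool (r = 0)" 1] sums by (simp add: EE_const)
  have EY: "EE (\<lambda>z s. ?Y (s i) * ?Y (s j)) = (if i = j then real k - 1 else 0)" if "i \<in> ?A" "j \<in> ?A" for i j
  proof (cases "i = j")
    case True
    have "\<bar>?Y r * ?Y r\<bar> \<le> (1 + real k) * (1 + real k)" for r
      unfolding abs_mult by (intro mult_mono Yb) auto
    from EE_label[where \<phi> = "\<lambda>r. ?Y r * ?Y r", OF that(1) tame_const[of 1] refl this]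
    have "EE (\<lambda>z s. 1 * (?Y (s i) * ?Y (s i))) = k * (real k - 1) / k" unfolding sY2 EE_const by simp
    then show ?thesis using True k by simp
  next
    case False
    then show ?thesis
      using EE_label[where \<phi> = ?Y, OF that(2) tY[of i] _ Yb] unfolding sY by simp
  qed
  let ?W = "\<lambda>s. (1 / 2) * (\<Sum>l<n+m. wt s l * wt s l) + (1 / m ^ 2) * (\<Sum>i\<in>?A. \<Sum>j\<in>?A. ?Y (s i) * ?Y (s j))"
  have W: "(\<Sum>l<n+m. wt s l * wt s l) / 2 + (\<Sum>l<n+m. wt s l)\<^sup>2 = ?W s" for s
    unfolding sum_wt by (simp add: power2_eq_square sum_product)
  have "EE (\<lambda>z s. clean_gap z s * clean_gap z s) \<le> EE (\<lambda>z s. ?W s)"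
    unfolding EE_def
  proof (intro divide_right_mono sum_mono)
    fix s assume "s \<in> SS"
    then show "(\<integral>z. clean_gap z s * clean_gap z s \<partial>\<mu>) \<le> (\<integral>z. ?W s \<partial>\<mu>)"
      using integral_clean_gap_square_le unfolding W by (simp add: \<mu>.prob_space)
  qed simp
  also have "\<dots> = (1 / 2) * EE (\<lambda>z s. \<Sum>l<n+m. wt s l * wt s l) + (1 / m ^ 2) * EE (\<lambda>z s. \<Sum>i\<in>?A. \<Sum>j\<in>?A. ?Y (s i) * ?Y (s j))"
    unfolding EE_cmult[symmetric] by (rule EE_add) (intro tame_cmult tame_sum tame_mult tame_wt tY)+
  also have "EE (\<lambda>z s. \<Sum>i\<in>?A. \<Sum>j\<in>?A. ?Y (s i) * ?Y (s j)) = (\<Sum>i\<in>?A. EE (\<lambda>z s. \<Sum>j\<in>?A. ?Y (s i) * ?Y (s j)))"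
    by (rule EE_sum) (intro tame_sum tame_mult tY)
  also have "\<dots> = (\<Sum>i\<in>?A. \<Sum>j\<in>?A. EE (\<lambda>z s. ?Y (s i) * ?Y (s j)))"
    by (intro sum.cong refl EE_sum tame_mult tY)
  also have "\<dots> = (\<Sum>i\<in>?A. \<Sum>j\<in>?A. if i = j then real k - 1 else 0)" by (intro sum.cong refl EY)
  also have "\<dots> = m * (real k - 1)" by simp
  also have "EE (\<lambda>z s. \<Sum>l<n+m. wt s l * wt s l) = EE (\<lambda>z s. 1 / n) + EE (\<lambda>z s. \<Sum>i\<in>?A. (real k / m)\<^sup>2 * of_bool (s i = 0))"
    unfolding sum_wt_square by (rule EE_add) (intro tame_const tame_sum tame_cmult tz)+
  also have "EE (\<lambda>z s. \<Sum>i\<in>?A. (real k / m)\<^sup>2 * of_bool (s i = 0)) = (\<Sum>i\<in>?A. EE (\<lambda>z s. (real k / m)\<^sup>2 * of_bool (s i = 0)))"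
    by (rule EE_sum) (intro tame_cmult tz)
  also have "\<dots> = (\<Sum>i\<in>?A. (real k / m)\<^sup>2 * (1 / k))" unfolding EE_cmult by (intro sum.cong refl) (simp only: E0)
  also have "\<dots> = k / m" using m k by (simp add: power2_eq_square)
  finally show ?thesis using m by (simp add: EE_const power2_eq_square)
qed

lemma tame_of_bool_le:
  assumes "tame F" "tame G" shows "tame (\<lambda>z s. of_bool (F z s \<le> G z s))"
proof -
  have "(of_bool (F z s \<le> G z s) :: real) = 1 - of_bool (G z s < F z s)" for z s by auto
  then show ?thesis using tame_diff[OF tame_const[of 1] tame_of_bool_less[OF assms(2,1)]] by simp
qed

section \<open>The generalization bound\<close>

definition misses :: "(nat \<Rightarrow> (real^'d) \<times> nat) \<Rightarrow> (nat \<Rightarrow> nat) \<Rightarrow> real" where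
  "misses z s = (\<Sum>i\<in>noisy. of_bool (s i \<noteq> 0) * er \<I> (shifted z s) (z i))"

definition fits :: "(nat \<Rightarrow> (real^'d) \<times> nat) \<Rightarrow> (nat \<Rightarrow> nat) \<Rightarrow> real" where
  "fits z s = (\<Sum>i\<in>noisy. of_bool (s i \<noteq> 0) * fit i (shifted z s))"

lemma tame_misses: "tame misses" and tame_fits: "tame fits"
proof -
  have "tame (\<lambda>z s. of_bool (s i \<noteq> 0))" for i by (rule tameI[where B = 1]) auto
  then show "tame misses" "tame fits"
    unfolding misses_def[abs_def] fits_def[abs_def] by (intro tame_sum tame_mult tame_er tame_fit; simp)+
qed

lemma misses_nonneg: "0 \<le> misses z s" and fits_nonneg: "0 \<le> fits z s"
  unfolding misses_def fits_def by (intro sum_nonneg mult_nonneg_nonneg er_bounds fit_bounds; simp)+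

lemma misses_fits_eq_card:
  fixes s :: "nat \<Rightarrow> nat"
  assumes z: "z \<in> space \<mu>" and s: "s \<in> SS"
  defines "c \<equiv> extend_labels z noisy (\<lambda>l\<in>noisy. shift_label k (snd (z l)) (s l))"
  shows "misses z s = card (wrong_misses k lam z \<I> noisy c)"
    and "fits z s = card (wrong_fits k lam z \<I> noisy c)"
proof -
  have eq: "relabel z c l = shifted z s l" if "l < n + m" for l
    using that by (auto simp: relabel_def c_def extend_labels_def shifted_apply)
  then have w: "ridge_w lam (relabel z c) \<I> = ridge_w lam (shifted z s) \<I>"
    by (intro ridge_w_reindex[where \<pi> = "\<lambda>l. l"]) (auto simp: bij_betw_def)
  have t: "snd (z i) \<in> {1..k}" if "i \<in> noisy" for i
    using space_\<mu>_D[OF z, of i] that by (auto simp: mem_Times_iff)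
  have c: "c i = shift_label k (snd (z i)) (s i)" "c i \<noteq> snd (z i) \<longleftrightarrow> s i \<noteq> 0" if "i \<in> noisy" for i
    using that shift_label_eq_iff[OF t[OF that] , of "s i"] PiE_mem[OF s that] by (auto simp: c_def extend_labels_def)
  have "misses z s = (\<Sum>i\<in>noisy. of_bool (c i \<noteq> snd (z i) \<and> snd (z i) \<notin> pred k lam (relabel z c) \<I> i))"
    unfolding misses_def by (intro sum.cong refl) (simp add: c(2) pred_def w er_def err01_def)
  also have "\<dots> = card (wrong_misses k lam z \<I> noisy c)" unfolding wrong_misses_def by (rule sum_of_bool_card) simp
  finally show "misses z s = card (wrong_misses k lam z \<I> noisy c)" .
  have "fits z s = (\<Sum>i\<in>noisy. of_bool (c i \<noteq> snd (z i) \<and> c i \<in> pred k lam (relabel z c) \<I> i))"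
    unfolding fits_def by (intro sum.cong refl) (simp add: c(2), simp add: c(1) pred_def w fit_def er_def err01_def shifted_apply)
  also have "\<dots> = card (wrong_fits k lam z \<I> noisy c)" unfolding wrong_fits_def by (rule sum_of_bool_card) simp
  finally show "fits z s = card (wrong_fits k lam z \<I> noisy c)" .
qed

text \<open>The counting bound holds for each latent sample, where the shifts run through every
  labelling of the noisy sites exactly once; it is then integrated.\<close>

lemma EE_few_fits_le:
  assumes k3: "3 \<le> k" and t: "0 < t" "t \<le> 4"
  shows "EE (\<lambda>z s. of_bool ((real k - 1) * (1 + t / 4) * fits z s + real k * (real k - 1) * L / t \<le> (1 - t / 4) * misses z s)) \<le> exp (- L)"
proof -
  let ?P = "\<lambda>z s. (real k - 1) * (1 + t / 4) * fits z s + real k * (real k - 1) * L / t \<le> (1 - t / 4) * misses z s"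
  have tame: "tame (\<lambda>z s. of_bool (?P z s))"
    by (intro tame_of_bool_le tame_add tame_cmult tame_const tame_fits tame_misses)
  have int: "integrable \<mu> (\<lambda>z. of_bool (?P z s) :: real)" for s by (rule tame_integrable[OF tame])
  have "(\<Sum>s\<in>SS. \<integral>z. of_bool (?P z s) \<partial>\<mu> :: real) = (\<integral>z. (\<Sum>s\<in>SS. of_bool (?P z s)) \<partial>\<mu>)"
    by (rule Bochner_Integration.integral_sum[symmetric]) (rule int)
  also have "\<dots> \<le> exp (- L) * k ^ m"
  proof (rule \<mu>.integral_le_const)
    show "integrable \<mu> (\<lambda>z. \<Sum>s\<in>SS. of_bool (?P z s) :: real)" by (intro Bochner_Integration.integrable_sum int)
    show "AE z in \<mu>. (\<Sum>s\<in>SS. of_bool (?P z s)) \<le> exp (- L) * k ^ m"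
    proof (rule AE_I2)
      fix z assume z: "z \<in> space \<mu>"
      let ?A = "noisy"
      let ?Q = "\<lambda>c. (1 - t / 4) * card (wrong_misses k lam z \<I> ?A (extend_labels z ?A c))
        \<ge> (real k - 1) * (1 + t / 4) * card (wrong_fits k lam z \<I> ?A (extend_labels z ?A c)) + real k * (real k - 1) * L / t"
      have "(\<Sum>s\<in>SS. of_bool (?P z s)) = (\<Sum>s\<in>SS. of_bool (?Q (\<lambda>l\<in>?A. shift_label k (snd (z l)) (s l))) :: real)"
        by (intro sum.cong refl) (simp only: misses_fits_eq_card[OF z])
      also have "\<dots> = (\<Sum>c\<in>CC. of_bool (?Q c))"
        by (rule sum.reindex_bij_betw[OF bij_betw_shift, of "\<lambda>c. of_bool (?Q c)" "\<lambda>l. snd (z l)"])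
      also have "\<dots> = card {c \<in> CC. ?Q c}" by (rule sum_of_bool_card[OF CC(1)])
      also have "\<dots> \<le> exp (- L) * card CC"
      proof (rule card_few_wrong_fits_le[OF _ _ k3 _ t])
        show "snd (z i) \<in> {1..k}" if "i \<in> ?A" for i
          using space_\<mu>_D[OF z, of i] that by (auto simp: mem_Times_iff)
      qed auto
      finally show "(\<Sum>s\<in>SS. of_bool (?P z s)) \<le> exp (- L) * k ^ m" unfolding CC(3) by simp
    qed
  qed
  finally show ?thesis using k by (simp add: EE_def field_simps)
qed

definition dev_mean :: "(nat \<Rightarrow> (real^'d) \<times> nat) \<Rightarrow> (nat \<Rightarrow> nat) \<Rightarrow> real" where
  "dev_mean z s = (\<Sum>i\<in>noisy. dev i z s) / m"

lemma tame_dev_mean: "tame dev_mean"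
proof -
  have "tame (\<lambda>z s. (1 / m) * (\<Sum>i\<in>noisy. dev i z s))" by (intro tame_cmult tame_sum tame_dev) simp
  then show ?thesis by (simp add: dev_mean_def[abs_def])
qed

text \<open>Only wrongly labelled sites enter \<^const>\<open>dev\<close> with an error term, and there an error of the
  leave-one-out predictor on the true label persists after the wrong label has been trained on.\<close>
lemma dev_mean_ge:
  assumes z: "z \<in> space \<mu>" and s: "s \<in> SS"
  shows "risk \<I> (shifted z s) - khat / m * misses z s \<le> dev_mean z s"
proof -
  let ?T = "shifted z s" and ?A = "noisy"
  have "kap (s i) * er (but i) ?T (z i) \<le> khat * (of_bool (s i \<noteq> 0) * er \<I> ?T (z i))" if i: "i \<in> ?A" for i
  proof (cases "s i = 0 \<or> er (but i) ?T (z i) = 0")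
    case True
    then show ?thesis using khat er_bounds(1)[of \<I> ?T "z i"] by (auto simp: kap_def)
  next
    case False
    have t: "snd (z i) \<in> {1..k}" using space_\<mu>_D[OF z, of i] i by (auto simp: mem_Times_iff)
    have Ti: "?T i = (fst (z i), shift_label k (snd (z i)) (s i))" using i by (simp add: shifted_apply)
    have "snd (z i) \<notin> argmax_cls k (ridge_w lam ?T (but i)) (fst (?T i))"
      using False by (auto simp: er_def err01_def Ti split: if_splits)
    then have "snd (z i) \<notin> pred k lam ?T \<I> i"
      using shift_label_eq_iff[OF t, of "s i"] shift_label_range[of k "snd (z i)" "s i"] PiE_mem[OF s i] False t i k
      by (intro err_leave_one_out_imp_not_pred) (auto simp: Ti)
    then have "er \<I> ?T (z i) = 1" by (simp add: pred_def er_def err01_def Ti)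
    then show ?thesis using False kap(2)[of "s i"] er_bounds(2)[of "but i" ?T "z i"] khat
      by (auto simp: kap_def mult_le_cancel_left1)
  qed
  then have "(\<Sum>i\<in>?A. kap (s i) * er (but i) ?T (z i)) \<le> khat * misses z s"
    unfolding misses_def sum_distrib_left by (rule sum_mono)
  then have "(\<Sum>i\<in>?A. kap (s i) * er (but i) ?T (z i)) / m \<le> khat / m * misses z s"
    using m by (simp add: divide_right_mono)
  moreover have "dev_mean z s = risk \<I> ?T - (\<Sum>i\<in>?A. kap (s i) * er (but i) ?T (z i)) / m"
    using m by (simp add: dev_mean_def dev_def sum_subtractf diff_divide_distrib)
  ultimately show ?thesis by linarith
qed

text \<open>With two classes, missing the true label leaves only the other one, which is the wrong
  random label.\<close>

lemma misses_le_fits: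
  assumes k2: "k = 2" and z: "z \<in> space \<mu>" and s: "s \<in> SS"
  shows "misses z s \<le> fits z s"
  unfolding misses_def fits_def
proof (rule sum_mono)
  fix i assume i: "i \<in> noisy"
  let ?T = "shifted z s"
  have t: "snd (z i) \<in> {1..k}" using space_\<mu>_D[OF z, of i] i by (auto simp: mem_Times_iff)
  have Ti: "?T i = (fst (z i), shift_label k (snd (z i)) (s i))" using i by (simp add: shifted_apply)
  show "of_bool (s i \<noteq> 0) * er \<I> ?T (z i) \<le> of_bool (s i \<noteq> 0) * fit i ?T"
  proof (cases "s i = 0 \<or> er \<I> ?T (z i) = 0")
    case True
    then show ?thesis using fit_bounds(1)[of i ?T] by auto
  next
    case False
    then have "snd (z i) \<notin> argmax_cls k (ridge_w lam ?T \<I>) (fst (z i))"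
      by (auto simp: er_def err01_def split: if_splits)
    moreover obtain g where g: "g \<in> argmax_cls k (ridge_w lam ?T \<I>) (fst (z i))"
      using argmax_cls_nonempty[of k] k by fastforce
    ultimately have "g \<noteq> snd (z i)" by blast
    moreover have "g \<in> {1..k}" using g argmax_cls_subset by blast
    moreover have "shift_label k (snd (z i)) (s i) \<noteq> snd (z i)" "shift_label k (snd (z i)) (s i) \<in> {1..k}"
      using shift_label_eq_iff[OF t, of "s i"] shift_label_range[of k "snd (z i)" "s i"] PiE_mem[OF s i] False k by auto
    ultimately have "shift_label k (snd (z i)) (s i) = g" using t k2 by auto
    then have "fit i ?T = 1" using g by (simp add: fit_def er_def err01_def Ti)
    then show ?thesis using er_bounds(2)[of \<I> ?T "z i"] by simp
  qed
qed

text \<open>The two deviations are dependent, so (u + v)^2 \<le> 2u^2 + 2v^2 is used. Bounding 1/n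
  by 1/m gives the 1 next to 3k.\<close>

lemma EE_deviation_square_le:
  assumes a: "0 \<le> a" "a \<le> 1"
  shows "EE (\<lambda>z s. (clean_gap z s + a * dev_mean z s) * (clean_gap z s + a * dev_mean z s)) \<le> (3 * real k + 1) / m + 16 * stab"
proof -
  let ?V = "\<lambda>z s. clean_gap z s + a * dev_mean z s"
  have "EE (\<lambda>z s. ?V z s * ?V z s) \<le> EE (\<lambda>z s. 2 * (clean_gap z s * clean_gap z s) + 2 * (dev_mean z s * dev_mean z s))"
  proof (rule EE_mono)
    fix z s
    have "0 \<le> (clean_gap z s - a * dev_mean z s) * (clean_gap z s - a * dev_mean z s)" by simp
    moreover have "a * a * (dev_mean z s * dev_mean z s) \<le> 1 * (dev_mean z s * dev_mean z s)"
      using a by (intro mult_right_mono mult_le_one) auto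
    ultimately show "?V z s * ?V z s \<le> 2 * (clean_gap z s * clean_gap z s) + 2 * (dev_mean z s * dev_mean z s)"
      by (simp add: algebra_simps)
  qed (intro tame_add tame_mult tame_cmult tame_clean_gap tame_dev_mean)+
  also have "\<dots> = 2 * EE (\<lambda>z s. clean_gap z s * clean_gap z s) + 2 * EE (\<lambda>z s. dev_mean z s * dev_mean z s)"
    unfolding EE_cmult[symmetric] by (intro EE_add tame_mult tame_cmult tame_clean_gap tame_dev_mean)
  also have "\<dots> \<le> 2 * ((1 / n + k / m) / 2 + (real k - 1) / m) + 2 * (1 / m + 8 * stab)"
    using EE_clean_gap_square_le EE_dev_mean_square_le
    by (intro add_mono mult_left_mono) (simp_all add: dev_mean_def power2_eq_square)
  also have "\<dots> \<le> (3 * real k + 1) / m + 16 * stab"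
  proof -
    have "1 / real n \<le> 1 / m" using m mn by (simp add: frac_le)
    moreover have "2 * ((a + c) / 2 + (c - b)) + 2 * (b + 8 * e) \<le> 3 * c + b + 16 * e" if "a \<le> b" for a b c e :: real
      using that by argo
    ultimately have "2 * ((1 / n + k / m) / 2 + (real k / m - 1 / m)) + 2 * (1 / m + 8 * stab) \<le> 3 * (real k / m) + 1 / m + 16 * stab"
      by blast
    then show ?thesis by (simp only: add_divide_distrib diff_divide_distrib times_divide_eq_right)
  qed
  finally show ?thesis .
qed

text \<open>The risk minus the clean error and the label term of the claim; with errors written as
  one minus accuracies, all constants cancel.\<close>

definition excess :: "(nat \<Rightarrow> (real^'d) \<times> nat) \<Rightarrow> real" where
  "excess T = risk \<I> T + (\<Sum>l<n. fit l T) / n - k / m * (\<Sum>l\<in>noisy. fit l T)"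

lemma excess_measurable: "excess \<in> borel_measurable \<mu>"
proof -
  have "risk \<I> \<in> borel_measurable \<mu>" by (rule risk_measurable[OF measurable_ident_sets[OF refl] subset_refl])
  then show ?thesis unfolding excess_def
    by (intro borel_measurable_add borel_measurable_diff borel_measurable_divide borel_measurable_times
        borel_measurable_sum borel_measurable_const fit_measurable) auto
qed

text \<open>The fallback when the tolerance exceeds 2, where the claimed bound is trivial.\<close>

lemma excess_le_2: "excess T \<le> 2"
proof -
  have "(\<Sum>l<n. fit l T) \<le> n" using sum_bounded_above[of "{..<n}" "\<lambda>l. fit l T" 1] fit_bounds by simp
  then have "(\<Sum>l<n. fit l T) / n \<le> 1" using mn by (simp add: divide_le_eq_1)
  moreover have "0 \<le> k / m * (\<Sum>l\<in>noisy. fit l T)" by (intro mult_nonneg_nonneg sum_nonneg fit_bounds) simp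
  ultimately show ?thesis using risk_bounds(2)[of \<I> T] unfolding excess_def by linarith
qed

lemma excess_shifted: "excess (shifted z s) = clean_gap z s + risk \<I> (shifted z s) - k / m * fits z s"
proof -
  have split: "(\<Sum>l<n+m. f l) = (\<Sum>l<n. f l) + (\<Sum>l\<in>noisy. f l)" for f :: "nat \<Rightarrow> real"
    by (subst sum.union_disjoint[symmetric]) (auto intro!: sum.cong)
  have "(\<Sum>l\<in>noisy. wt s l * fit l (shifted z s))
      = (\<Sum>l\<in>noisy. k / m * (of_bool (s l \<noteq> 0) * fit l (shifted z s)) - k / m * fit l (shifted z s))"
    by (intro sum.cong refl) (auto simp: wt_def)
  also have "\<dots> = k / m * fits z s - k / m * (\<Sum>l\<in>noisy. fit l (shifted z s))"
    by (simp only: sum_subtractf sum_distrib_left[symmetric] fits_def)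
  finally show ?thesis
    unfolding excess_def clean_gap_def split by (simp add: wt_def sum_divide_distrib)
qed

lemma excess_le_dev:
  assumes k3: "3 \<le> k" and z: "z \<in> space \<mu>" and s: "s \<in> SS" and \<tau>: "0 < \<tau>" and t: "t = 2 * real k * \<tau>" "t \<le> 2"
    and L: "L = 2 * real m * \<tau>\<^sup>2"
    and good: "(1 - t / 4) * misses z s \<le> (real k - 1) * (1 + t / 4) * fits z s + real k * (real k - 1) * L / t"
  shows "excess (shifted z s) \<le> t + (clean_gap z s + (1 - t / 2) * dev_mean z s)"
  using fit_deficit_le[OF risk_bounds(1,2) misses_nonneg _ _ \<tau> t L good, of "\<I>" "shifted z s" "dev_mean z s"]
    dev_mean_ge[OF z s] k3 m unfolding excess_shifted khat_def by simp

lemma EE_excess_gt_le: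
  assumes \<delta>: "0 < \<delta>" "\<delta> < 1"
  defines "\<tau> \<equiv> sqrt (ln (4 / \<delta>) / (2 * real m))" and "X \<equiv> sqrt ((1 / real m + 3 * stab) / \<delta>)"
  assumes bd: "(real k + sqrt k) * \<tau> + 2 * sqrt (real k * (real k - 1)) * X \<le> bd"
  shows "EE (\<lambda>z s. of_bool (bd < excess (shifted z s))) \<le> \<delta>"
proof -
  let ?G = "\<lambda>z s. excess (shifted z s)"
  define L where "L = ln (4 / \<delta>)"
  have "1 < 4 / \<delta>" using \<delta> by simp
  then have L0: "0 < L" unfolding L_def by (rule ln_gt_zero)
  then have \<tau>: "0 < \<tau>" and \<tau>2: "\<tau>\<^sup>2 = L / (2 * real m)" using m by (auto simp: \<tau>_def L_def[symmetric])
  have pos: "0 < (1 / real m + 3 * stab) / \<delta>" using m \<delta> stab_nonneg by (simp add: add_pos_nonneg)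
  then have X: "0 < X" and X2: "\<delta> * X\<^sup>2 = 1 / m + 3 * stab" using \<delta> by (auto simp: X_def)
  have \<tau>X: "\<tau> \<le> 5 / 6 * X"
  proof (rule power2_le_imp_le)
    have "\<delta> * L \<le> 25 / 18" using times_ln_four_over_le[of \<delta>] \<delta> by (simp add: L_def)
    then have "\<delta> * L / (2 * real m) \<le> 25 / 18 / (2 * real m)" by (intro divide_right_mono) auto
    then have "\<delta> * \<tau>\<^sup>2 \<le> 25 / 36 * (1 / m)" unfolding \<tau>2 by simp
    also have "\<dots> \<le> 25 / 36 * (\<delta> * X\<^sup>2)" unfolding X2 using stab_nonneg by simp
    finally have "\<delta> * \<tau>\<^sup>2 \<le> \<delta> * (25 / 36 * X\<^sup>2)" by simp
    then show "\<tau>\<^sup>2 \<le> (5 / 6 * X)\<^sup>2" using \<delta> by (simp add: power_mult_distrib power2_eq_square)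
  qed (use X in simp)
  have tG: "tame ?G"
    unfolding excess_shifted by (intro tame_add tame_diff tame_clean_gap tame_risk tame_cmult tame_fits subset_refl)
  have tB: "tame (\<lambda>z s. of_bool (bd < ?G z s))" by (intro tame_of_bool_less tame_const tG)
  have tV: "tame (\<lambda>z s. clean_gap z s + a * dev_mean z s)" for a
    by (intro tame_add tame_cmult tame_clean_gap tame_dev_mean)
  have cheb: "EE (\<lambda>z s. of_bool (\<theta> < clean_gap z s + a * dev_mean z s)) \<le> ((3 * real k + 1) / m + 16 * stab) / \<theta>\<^sup>2"
    if "0 < \<theta>" "0 \<le> a" "a \<le> 1" for \<theta> a
    using order_trans[OF EE_chebyshev[OF tV that(1)] divide_right_mono[OF EE_deviation_square_le[OF that(2,3)]]] by simp
  show ?thesis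
  proof (cases "k = 2")
    case True
    have kk: "khat = 2" "real k = 2" unfolding khat_def using True by simp_all
    have bd2: "2 * sqrt 2 * X \<le> bd" 
    proof -
      have "0 \<le> (2 + sqrt 2) * \<tau>" using \<tau> by simp
      then show ?thesis using bd unfolding True by simp
    qed
    have "EE (\<lambda>z s. of_bool (bd < ?G z s)) \<le> EE (\<lambda>z s. of_bool (2 * sqrt 2 * X < clean_gap z s + 1 * dev_mean z s))"
    proof (rule EE_mono[OF tB tame_of_bool_less[OF tame_const tV]])
      fix z s assume z: "z \<in> space \<mu>" and s: "s \<in> SS"
      have "2 / m * misses z s \<le> 2 / m * fits z s" by (intro mult_left_mono misses_le_fits[OF True z s]) simp
      then have "?G z s \<le> clean_gap z s + dev_mean z s"
        using dev_mean_ge[OF z s] kk unfolding excess_shifted by simp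
      then show "of_bool (bd < ?G z s) \<le> (of_bool (2 * sqrt 2 * X < clean_gap z s + 1 * dev_mean z s) :: real)"
        using bd2 by auto
    qed
    also have "\<dots> \<le> ((3 * real k + 1) / m + 16 * stab) / (2 * sqrt 2 * X)\<^sup>2"
      by (rule cheb) (use X in auto)
    \<comment> \<open>For k = 2 the second moment is at most 7/m + 16 \<open>stab\<close>, and 8 is
      the square of 2 sqrt 2, so Chebyshev gives exactly \<delta>.\<close>
    also have "\<dots> \<le> (8 * (\<delta> * X\<^sup>2)) / (2 * sqrt 2 * X)\<^sup>2"
    proof (rule divide_right_mono)
      have "7 / real m \<le> 8 / m" using m by (simp add: divide_right_mono)
      then show "(3 * real k + 1) / m + 16 * stab \<le> 8 * (\<delta> * X\<^sup>2)"
        unfolding X2 True using stab_nonneg by simp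
    qed simp
    also have "\<dots> = \<delta>" using X by (simp add: power_mult_distrib)
    finally show ?thesis .
  next
    case False
    then have k3: "3 \<le> k" using k by simp
    then have K: "3 \<le> real k" by simp
    define t where "t = 2 * real k * \<tau>"
    have t0: "0 < t" using \<tau> k by (simp add: t_def)
    show ?thesis
    proof (cases "t \<le> 2")
      case False
      have "real k * \<tau> \<le> real k * (5 / 6 * X)" using \<tau>X by (intro mult_left_mono) auto
      also have "\<dots> \<le> (2 * (real k - 3 / 5)) * X" using K X by (simp add: mult_right_mono)
      also have "\<dots> \<le> 2 * sqrt (real k * (real k - 1)) * X"
        using sqrt_times_pred_ge[of "real k"] K X by (intro mult_right_mono) auto
      finally have "real k * \<tau> + real k * \<tau> \<le> (real k + sqrt k) * \<tau> + 2 * sqrt (real k * (real k - 1)) * X"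
        using \<tau> by (intro add_mono) auto
      from order_trans[OF this bd] have "2 * real k * \<tau> \<le> bd" by (simp add: mult_ac)
      then have "2 < bd" using False unfolding t_def by simp
      then have "?G z s \<le> bd" for z s using excess_le_2[of "shifted z s"] by linarith
      then have "EE (\<lambda>z s. of_bool (bd < ?G z s)) = EE (\<lambda>z s. 0)" by (intro EE_cong) (simp add: not_less)
      then show ?thesis using \<delta> by (simp add: EE_const)
    next
      case t2: True
      define \<theta> where "\<theta> = (sqrt k - real k) * \<tau> + 2 * sqrt (real k * (real k - 1)) * X"
      have \<theta>: "0 < \<theta>" "4 / 3 * (3 * real k + 1) * X\<^sup>2 \<le> \<theta>\<^sup>2"
        unfolding \<theta>_def by (rule threshold_square_ge[OF K X _ \<tau>X]; use \<tau> in simp)+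
      have bd\<theta>: "t + \<theta> \<le> bd" using bd by (simp add: t_def \<theta>_def algebra_simps)
      let ?P = "\<lambda>z s. (real k - 1) * (1 + t / 4) * fits z s + real k * (real k - 1) * L / t \<le> (1 - t / 4) * misses z s"
      let ?V = "\<lambda>z s. clean_gap z s + (1 - t / 2) * dev_mean z s"
      have tP: "tame (\<lambda>z s. of_bool (?P z s))"
        by (intro tame_of_bool_le tame_add tame_cmult tame_const tame_fits tame_misses)
      have tQ: "tame (\<lambda>z s. of_bool (\<theta> < ?V z s))" by (intro tame_of_bool_less tame_const tV)
      have Lm: "L = 2 * real m * \<tau>\<^sup>2" using m \<tau>2 by simp
      have "EE (\<lambda>z s. of_bool (bd < ?G z s)) \<le> EE (\<lambda>z s. of_bool (?P z s) + of_bool (\<theta> < ?V z s))"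
      proof (rule EE_mono[OF tB tame_add[OF tP tQ]])
        fix z s assume z: "z \<in> space \<mu>" and s: "s \<in> SS"
        show "of_bool (bd < ?G z s) \<le> (of_bool (?P z s) + of_bool (\<theta> < ?V z s) :: real)"
        proof (cases "?P z s \<or> \<theta> < ?V z s")
          case False
          then have "?G z s \<le> t + ?V z s"
            by (intro excess_le_dev[OF k3 z s \<tau> t_def t2 Lm]) simp
          then have "\<not> bd < ?G z s" using False bd\<theta> by linarith
          then show ?thesis by simp
        qed auto
      qed
      also have "\<dots> = EE (\<lambda>z s. of_bool (?P z s)) + EE (\<lambda>z s. of_bool (\<theta> < ?V z s))" by (rule EE_add[OF tP tQ])
      also have "\<dots> \<le> exp (- L) + ((3 * real k + 1) / m + 16 * stab) / \<theta>\<^sup>2"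
        by (intro add_mono EE_few_fits_le[OF k3 t0] cheb) (use t0 t2 \<theta> in auto)
      \<comment> \<open>A quarter of \<delta> goes to the label comparison; the rest is left to
        Chebyshev.\<close>
      also have "exp (- L) = \<delta> / 4" using \<delta> by (simp add: L_def exp_minus)
      also have "((3 * real k + 1) / m + 16 * stab) / \<theta>\<^sup>2 \<le> ((3 * real k + 1) * (\<delta> * X\<^sup>2)) / \<theta>\<^sup>2"
      proof (rule divide_right_mono)
        have "16 * stab \<le> (3 * real k + 1) * (3 * stab)" using mult_right_mono[OF K stab_nonneg] stab_nonneg by (simp add: algebra_simps)
        then show "(3 * real k + 1) / m + 16 * stab \<le> (3 * real k + 1) * (\<delta> * X\<^sup>2)"
          unfolding X2 by (simp add: distrib_left)
      qed simp
      also have "\<dots> \<le> 3 / 4 * \<delta>"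
      proof -
        have "(3 * real k + 1) * (\<delta> * X\<^sup>2) = 3 / 4 * \<delta> * (4 / 3 * (3 * real k + 1) * X\<^sup>2)" by simp
        also have "\<dots> \<le> 3 / 4 * \<delta> * \<theta>\<^sup>2" using \<delta> by (intro mult_left_mono \<theta>(2)) simp
        finally show ?thesis using \<theta>(1) by (simp add: divide_le_eq)
      qed
      finally show ?thesis by simp
    qed
  qed
qed

lemma prob_excess_le:
  assumes "EE (\<lambda>z s. of_bool (bd < excess (shifted z s))) \<le> \<delta>"
  shows "1 - \<delta> \<le> measure (sample_dist k n m D) {T \<in> space (sample_dist k n m D). excess T \<le> bd}"
proof -
  let ?S = "sample_dist k n m D" and ?h = "\<lambda>T. of_bool (excess T \<le> bd) :: real"
  have [measurable]: "excess \<in> borel_measurable \<mu>" by (rule excess_measurable)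
  have h: "?h \<in> borel_measurable \<mu>" unfolding of_bool_def by measurable
  have sp: "space ?S = space \<mu>" by (rule sets_eq_imp_space_eq[OF sets_sample])
  have "{T \<in> space \<mu>. excess T \<le> bd} \<in> sets \<mu>" by measurable
  then have A: "{T \<in> space ?S. excess T \<le> bd} \<in> sets ?S" by (simp add: sp sets_sample)
  have "measure ?S {T \<in> space ?S. excess T \<le> bd} = (\<integral>T. indicator {T \<in> space ?S. excess T \<le> bd} T \<partial>?S)"
    using A by (subst Bochner_Integration.integral_indicator) (auto intro!: arg_cong[where f = "measure ?S"])
  also have "\<dots> = integral\<^sup>L ?S ?h"
    by (intro Bochner_Integration.integral_cong refl) (auto simp: indicator_def)
  also have "\<dots> = EE (\<lambda>z s. ?h (shifted z s))"
    by (rule integral_sample_dist_EE[OF h, where B = 1]) simp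
  also have "\<dots> = EE (\<lambda>z s. 1 - of_bool (bd < excess (shifted z s)))"
    by (rule EE_cong) auto
  also have "\<dots> = 1 - EE (\<lambda>z s. of_bool (bd < excess (shifted z s)))"
  proof -
    have "tame (\<lambda>z s. excess (shifted z s))"
      unfolding excess_shifted by (intro tame_add tame_diff tame_clean_gap tame_risk tame_cmult tame_fits subset_refl)
    then show ?thesis by (subst EE_diff) (simp_all add: EE_const tame_const tame_of_bool_less)
  qed
  finally show ?thesis using assms by linarith
qed

end

theorem mainTheorem15:
  fixes D :: "((real^'d) \<times> nat) measure"
    and k n m :: nat and lam beta delta :: real
  assumes "prob_space D"
    and "sets D = sets (borel \<Otimes>\<^sub>M count_space {1..k})"
    and "k \<ge> 2"
    and "0 < m" and "m < n"
    and "lam \<ge> 0"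
    and "hyp_stable k n m lam D beta"
    and "delta > 0"
  shows "prob_space.prob (sample_dist k n m D)
     {T \<in> space (sample_dist k n m D).
        (\<integral>z. err01 k (ridge_w lam T {..<n+m}) z \<partial>D)
        \<le> (\<Sum>i<n. err01 k (ridge_w lam T {..<n+m}) (T i)) / real n
          + (real k - 1) * (1 - real k / (real k - 1)
               * ((\<Sum>i\<in>{n..<n+m}. err01 k (ridge_w lam T {..<n+m}) (T i)) / real m))
          + (real k + sqrt (real k) + real m / (real n * sqrt (real k)))
               * sqrt (ln (4 / delta) / (2 * real m))
          + sqrt (real k * (real k - 1))
               * sqrt (4 / delta * (1 / real m + 3 * beta / real (m + n)))}
     \<ge> 1 - delta"
proof -
  interpret ridge_sample D k n m lam beta
    using assms by (simp add: ridge_sample_def noisy_sample_def ridge_sample_axioms_def)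
  define bd where "bd = (real k + sqrt (real k) + real m / (real n * sqrt (real k)))
      * sqrt (ln (4 / delta) / (2 * real m))
    + sqrt (real k * (real k - 1)) * sqrt (4 / delta * (1 / real m + 3 * beta / real (m + n)))"
  have excess: "excess T = (\<integral>z. err01 k (ridge_w lam T {..<n+m}) z \<partial>D)
      - (\<Sum>i<n. err01 k (ridge_w lam T {..<n+m}) (T i)) / real n
      - (real k - 1) * (1 - real k / (real k - 1)
               * ((\<Sum>i\<in>{n..<n+m}. err01 k (ridge_w lam T {..<n+m}) (T i)) / real m))" for T
  proof -
    have lab: "(real k - 1) * (1 - real k / (real k - 1) * x) = real k - 1 - real k * x" for x
      using k by (simp add: field_simps)
    have "(\<Sum>l<n. fit l T) / n = 1 - (\<Sum>i<n. err01 k (ridge_w lam T {..<n+m}) (T i)) / real n"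
      using mn by (simp add: fit_def er_def sum_subtractf diff_divide_distrib)
    moreover have "real k / m * (\<Sum>l\<in>{n..<n+m}. fit l T)
        = real k - real k * ((\<Sum>i\<in>{n..<n+m}. err01 k (ridge_w lam T {..<n+m}) (T i)) / real m)"
      using m by (simp add: fit_def er_def sum_subtractf right_diff_distrib)
    ultimately show ?thesis unfolding lab unfolding excess_def risk_def er_def by simp
  qed
  show ?thesis
  proof (cases "delta < 1")
    case True
    have "1 < 4 / delta" using True assms by simp
    then have "0 \<le> real m / (real n * sqrt (real k)) * sqrt (ln (4 / delta) / (2 * real m))" by simp
    moreover have "sqrt (4 / delta * (1 / real m + 3 * beta / real (m + n))) = 2 * sqrt ((1 / real m + 3 * stab) / delta)"
    proof -
      have "4 / delta * (1 / real m + 3 * beta / real (m + n)) = 4 * ((1 / real m + 3 * stab) / delta)"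
        by (simp add: stab_def add.commute)
      then show ?thesis by (simp only: real_sqrt_mult real_sqrt_four)
    qed
    ultimately have "(real k + sqrt k) * sqrt (ln (4 / delta) / (2 * real m))
        + 2 * sqrt (real k * (real k - 1)) * sqrt ((1 / real m + 3 * stab) / delta) \<le> bd"
      unfolding bd_def by (simp add: distrib_right)
    from prob_excess_le[OF EE_excess_gt_le[OF assms(8) True this]] show ?thesis
      unfolding excess bd_def by (simp add: algebra_simps)
  next
    \<comment> \<open>For \<open>delta\<close> \<ge> 1 the asserted lower bound is not
      positive.\<close>
    case False
    then show ?thesis by (simp add: order_trans[OF _ measure_nonneg])
  qed
qed

end
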